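(* Let $V$ be a divisible and valuative monoid and let $V\to P$ be an sfp map of saturated monoids. Then $V\to P$ is saturated and $P$ is finitely presented over $V$.
   Context: All monoids are commutative, written additively. For a monoid $P$, $P^{\mathrm{gp}}$ is its group completion; $P$ is integral if $P\to P^{\mathrm{gp}}$ is injective, and saturated if it is integral and $np\in P$ with $p\in P^{\mathrm{gp}}$, $n\ge1$ implies $p\in P$. $P^{\mathrm{int}}$ and $P^{\mathrm{sat}}$ denote integralisation and saturation (left adjoints to the inclusions of integral, resp. saturated monoids into monoids). $\oplus$ denotes pushout in the category of monoids. A monoid $V$ is valuative if it is integral and for every $x\in V^{\mathrm{gp}}$ either $x\in V$ or $-x\in V$ (it is then saturated). A saturated monoid $P$ is divisible if multiplication by $n$ on $P$ is surjective for every $n\ge1$, equivalently if $P^{\mathrm{gp}}$ is a divisible group. A monoid homomorphism $P\to Q$ is of finite presentation if $Q$ is isomorphic over $P$ to the quotient of some $P\oplus\mathbb{N}^r$ by the congruence generated by finitely many pairs. A morphism of saturated monoids $P\to Q$ is sfp if it factors as $P\to Q'\to Q$ with $P\to Q'$ of finite presentation and $Q'\to Q$ inducing $(Q')^{\mathrm{sat}}\cong Q$. A homomorphism $P\to Q$ of integral monoids is integral if for every homomorphism $P\to P'$ into an integral monoid, $P'\oplus_PQ=(P'\oplus_PQ)^{\mathrm{int}}$. It is saturated if it is integral, $P$ and $Q$ are saturated, and for every homomorphism $P\to P'$ into a saturated monoid, $P'\oplus_PQ=(P'\oplus_PQ)^{\mathrm{sat}}$. *)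

theory Defs
  imports "HOL-Algebra.Group"
begin

text \<open>
  Commutative monoids are records satisfying \<^locale>\<open>comm_monoid\<close>, hence written
  multiplicatively; the multiple \<open>n p\<close> of additive notation is the power \<open>p [^] n\<close>.
\<close>

section \<open>Homomorphisms, congruences and quotients\<close>

text \<open>\<^const>\<open>hom\<close> does not ask for preservation of the unit.\<close>

definition mhom :: "'a monoid \<Rightarrow> 'b monoid \<Rightarrow> ('a \<Rightarrow> 'b) set" where
  "mhom M N = {f \<in> hom M N. f \<one>\<^bsub>M\<^esub> = \<one>\<^bsub>N\<^esub>}"

definition mcong :: "'a monoid \<Rightarrow> ('a \<times> 'a) set \<Rightarrow> bool" where
  "mcong M R \<longleftrightarrow> equiv (carrier M) R \<and>
     (\<forall>(a, b) \<in> R. \<forall>(c, d) \<in> R. (a \<otimes>\<^bsub>M\<^esub> c, b \<otimes>\<^bsub>M\<^esub> d) \<in> R)"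

definition mcong_gen :: "'a monoid \<Rightarrow> ('a \<times> 'a) set \<Rightarrow> ('a \<times> 'a) set" where
  "mcong_gen M S = \<Inter> {R. mcong M R \<and> S \<subseteq> R}"

definition mquot :: "'a monoid \<Rightarrow> ('a \<times> 'a) set \<Rightarrow> 'a set monoid" where
  "mquot M R = \<lparr> carrier = carrier M // R,
                 monoid.mult = (\<lambda>A B. \<Union>a\<in>A. \<Union>b\<in>B. R `` {a \<otimes>\<^bsub>M\<^esub> b}),
                 one = R `` {\<one>\<^bsub>M\<^esub>} \<rparr>"

definition mpushout ::
    "'p monoid \<Rightarrow> 'a monoid \<Rightarrow> 'b monoid \<Rightarrow> ('p \<Rightarrow> 'a) \<Rightarrow> ('p \<Rightarrow> 'b) \<Rightarrow> ('a \<times> 'b) set monoid" where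
  "mpushout P A B f g =
     mquot (A \<times>\<times> B)
       (mcong_gen (A \<times>\<times> B) {((f p, \<one>\<^bsub>B\<^esub>), (\<one>\<^bsub>A\<^esub>, g p)) | p. p \<in> carrier P})"


section \<open>Group completion, integralisation, saturation\<close>

text \<open>The pair \<open>(a, b)\<close> stands for the formal difference \<open>a - b\<close>.\<close>

definition gp_rel :: "'a monoid \<Rightarrow> (('a \<times> 'a) \<times> ('a \<times> 'a)) set" where
  "gp_rel M = {((a, b), (c, d)).
     a \<in> carrier M \<and> b \<in> carrier M \<and> c \<in> carrier M \<and> d \<in> carrier M \<and>
     (\<exists>k \<in> carrier M. a \<otimes>\<^bsub>M\<^esub> d \<otimes>\<^bsub>M\<^esub> k = c \<otimes>\<^bsub>M\<^esub> b \<otimes>\<^bsub>M\<^esub> k)}"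

definition gp :: "'a monoid \<Rightarrow> ('a \<times> 'a) set monoid" where
  "gp M = mquot (M \<times>\<times> M) (gp_rel M)"

definition gp_unit :: "'a monoid \<Rightarrow> 'a \<Rightarrow> ('a \<times> 'a) set" where
  "gp_unit M x = gp_rel M `` {(x, \<one>\<^bsub>M\<^esub>)}"

definition integral_monoid :: "'a monoid \<Rightarrow> bool" where
  "integral_monoid M \<longleftrightarrow> comm_monoid M \<and> inj_on (gp_unit M) (carrier M)"

definition saturated_monoid :: "'a monoid \<Rightarrow> bool" where
  "saturated_monoid M \<longleftrightarrow> integral_monoid M \<and>
     (\<forall>p \<in> carrier (gp M). \<forall>n::nat. n \<ge> 1 \<longrightarrow>
        p [^]\<^bsub>gp M\<^esub> n \<in> gp_unit M ` carrier M \<longrightarrow> p \<in> gp_unit M ` carrier M)"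

definition valuative :: "'a monoid \<Rightarrow> bool" where
  "valuative M \<longleftrightarrow> integral_monoid M \<and>
     (\<forall>x \<in> carrier (gp M).
        x \<in> gp_unit M ` carrier M \<or> inv\<^bsub>gp M\<^esub> x \<in> gp_unit M ` carrier M)"

definition divisible_monoid :: "'a monoid \<Rightarrow> bool" where
  "divisible_monoid M \<longleftrightarrow> saturated_monoid M \<and>
     (\<forall>n::nat. n \<ge> 1 \<longrightarrow> (\<lambda>x. x [^]\<^bsub>M\<^esub> n) ` carrier M = carrier M)"

text \<open>
  The two reflections are realised inside the group completion, both with unit
  \<^const>\<open>gp_unit\<close>; their universal properties are proved at the end of this theory.
\<close>

definition integralisation :: "'a monoid \<Rightarrow> ('a \<times> 'a) set monoid" where
  "integralisation M = (gp M) \<lparr> carrier := gp_unit M ` carrier M \<rparr>"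

definition saturation :: "'a monoid \<Rightarrow> ('a \<times> 'a) set monoid" where
  "saturation M = (gp M) \<lparr> carrier :=
     {p \<in> carrier (gp M). \<exists>n::nat. n \<ge> 1 \<and> p [^]\<^bsub>gp M\<^esub> n \<in> gp_unit M ` carrier M} \<rparr>"


section \<open>Finite presentation\<close>

definition free_cmonoid :: "nat \<Rightarrow> (nat \<Rightarrow> nat) monoid" where
  "free_cmonoid r = \<lparr> carrier = {v. \<forall>i. i \<ge> r \<longrightarrow> v i = 0},
                      monoid.mult = (\<lambda>v w i. v i + w i),
                      one = (\<lambda>i. 0) \<rparr>"

text \<open>The coproduct of two commutative monoids is their direct product.\<close>

definition fin_pres :: "'a monoid \<Rightarrow> 'b monoid \<Rightarrow> ('a \<Rightarrow> 'b) \<Rightarrow> bool" where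
  "fin_pres P Q f \<longleftrightarrow> comm_monoid P \<and> comm_monoid Q \<and> f \<in> mhom P Q \<and>
     (\<exists>r S \<phi>.
        finite S \<and>
        S \<subseteq> carrier (P \<times>\<times> free_cmonoid r) \<times> carrier (P \<times>\<times> free_cmonoid r) \<and>
        \<phi> \<in> iso (mquot (P \<times>\<times> free_cmonoid r) (mcong_gen (P \<times>\<times> free_cmonoid r) S)) Q \<and>
        (\<forall>p \<in> carrier P.
           \<phi> (mcong_gen (P \<times>\<times> free_cmonoid r) S `` {(p, \<one>\<^bsub>free_cmonoid r\<^esub>)}) = f p))"

text \<open>
  HOL definitions cannot quantify over types, so the type \<open>'d\<close> carrying the intermediate
  monoid is a parameter. With \<open>sfp TYPE('d) P Q f\<close> as a premise of a theorem in which \<open>'d\<close>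
  does not occur elsewhere, the intermediate monoid is arbitrary.
\<close>

definition sfp :: "'d itself \<Rightarrow> 'a monoid \<Rightarrow> 'b monoid \<Rightarrow> ('a \<Rightarrow> 'b) \<Rightarrow> bool" where
  "sfp _ P Q f \<longleftrightarrow> saturated_monoid P \<and> saturated_monoid Q \<and> f \<in> mhom P Q \<and>
     (\<exists>(Q' :: 'd monoid) g h.
        fin_pres P Q' g \<and> h \<in> mhom Q' Q \<and> (\<forall>p \<in> carrier P. f p = h (g p)) \<and>
        (\<exists>\<phi> \<in> iso (saturation Q') Q. \<forall>x \<in> carrier Q'. \<phi> (gp_unit Q' x) = h x))"


section \<open>Integral and saturated homomorphisms\<close>

text \<open>
  Here the parameter \<open>'c\<close> is the type carrying the test monoids \<open>P'\<close>. As the conclusion of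
  a theorem in which \<open>'c\<close> does not occur elsewhere, these predicates cover all test monoids.
\<close>

definition integral_hom :: "'c itself \<Rightarrow> 'a monoid \<Rightarrow> 'b monoid \<Rightarrow> ('a \<Rightarrow> 'b) \<Rightarrow> bool" where
  "integral_hom _ P Q f \<longleftrightarrow> integral_monoid P \<and> integral_monoid Q \<and> f \<in> mhom P Q \<and>
     (\<forall>(P' :: 'c monoid) u. integral_monoid P' \<longrightarrow> u \<in> mhom P P' \<longrightarrow>
        gp_unit (mpushout P P' Q u f)
          \<in> iso (mpushout P P' Q u f) (integralisation (mpushout P P' Q u f)))"

definition saturated_hom :: "'c itself \<Rightarrow> 'a monoid \<Rightarrow> 'b monoid \<Rightarrow> ('a \<Rightarrow> 'b) \<Rightarrow> bool" where
  "saturated_hom T P Q f \<longleftrightarrow> integral_hom T P Q f \<and>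
     saturated_monoid P \<and> saturated_monoid Q \<and>
     (\<forall>(P' :: 'c monoid) u. saturated_monoid P' \<longrightarrow> u \<in> mhom P P' \<longrightarrow>
        gp_unit (mpushout P P' Q u f)
          \<in> iso (mpushout P P' Q u f) (saturation (mpushout P P' Q u f)))"


section \<open>Universal properties\<close>

lemma mhomI:
  assumes "\<And>x. x \<in> carrier M \<Longrightarrow> f x \<in> carrier N"
    "\<And>x y. x \<in> carrier M \<Longrightarrow> y \<in> carrier M \<Longrightarrow> f (x \<otimes>\<^bsub>M\<^esub> y) = f x \<otimes>\<^bsub>N\<^esub> f y"
    "f \<one>\<^bsub>M\<^esub> = \<one>\<^bsub>N\<^esub>"
  shows "f \<in> mhom M N"
  using assms by (auto simp: mhom_def hom_def)

lemma mhomD: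
  assumes "f \<in> mhom M N"
  shows "x \<in> carrier M \<Longrightarrow> f x \<in> carrier N"
    "x \<in> carrier M \<Longrightarrow> y \<in> carrier M \<Longrightarrow> f (x \<otimes>\<^bsub>M\<^esub> y) = f x \<otimes>\<^bsub>N\<^esub> f y"
    "f \<one>\<^bsub>M\<^esub> = \<one>\<^bsub>N\<^esub>"
  using assms by (auto simp: mhom_def hom_def)

lemma mhom_pow:
  assumes "monoid M" "f \<in> mhom M N" "x \<in> carrier M"
  shows "f (x [^]\<^bsub>M\<^esub> (n::nat)) = f x [^]\<^bsub>N\<^esub> n"
proof -
  interpret monoid M by fact
  show ?thesis
    using assms by (induction n) (auto simp: mhomD)
qed

lemma comm_monoid_DirProd:
  assumes "comm_monoid A" "comm_monoid B"
  shows "comm_monoid (A \<times>\<times> B)"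
proof -
  interpret A: comm_monoid A by fact
  interpret B: comm_monoid B by fact
  show ?thesis
    by (rule comm_monoidI) (auto simp: mult_DirProd' A.m_ac B.m_ac)
qed

lemma mcong_mult:
  "mcong M R \<Longrightarrow> (a, b) \<in> R \<Longrightarrow> (c, d) \<in> R \<Longrightarrow> (a \<otimes>\<^bsub>M\<^esub> c, b \<otimes>\<^bsub>M\<^esub> d) \<in> R"
  by (fastforce simp: mcong_def)

lemma mcong_gen_mcong:
  assumes "monoid M" "S \<subseteq> carrier M \<times> carrier M"
  shows "mcong M (mcong_gen M S)"
proof -
  interpret monoid M by fact
  let ?\<R> = "{R. mcong M R \<and> S \<subseteq> R}"
  have top: "carrier M \<times> carrier M \<in> ?\<R>"
    using assms by (auto simp: mcong_def equiv_def refl_on_def sym_def trans_def)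
  have eq: "equiv (carrier M) R" if "R \<in> ?\<R>" for R
    using that by (auto simp: mcong_def)
  have "equiv (carrier M) (\<Inter> ?\<R>)"
  proof (rule equivI)
    show "\<Inter> ?\<R> \<subseteq> carrier M \<times> carrier M" using top by blast
    show "refl_on (carrier M) (\<Inter> ?\<R>)"
      using eq by (auto simp: equiv_def refl_on_def)
    show "sym (\<Inter> ?\<R>)" using eq by (auto simp: equiv_def sym_def)
    show "trans (\<Inter> ?\<R>)" using eq unfolding equiv_def trans_def by blast
  qed
  moreover have "(a \<otimes>\<^bsub>M\<^esub> c, b \<otimes>\<^bsub>M\<^esub> d) \<in> \<Inter> ?\<R>"
    if "(a, b) \<in> \<Inter> ?\<R>" "(c, d) \<in> \<Inter> ?\<R>" for a b c d
    using that by (blast intro: mcong_mult)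
  ultimately show ?thesis
    unfolding mcong_def mcong_gen_def by blast
qed

lemma mcong_gen_incl: "S \<subseteq> mcong_gen M S"
  by (auto simp: mcong_gen_def)

lemma mcong_gen_least: "mcong M R \<Longrightarrow> S \<subseteq> R \<Longrightarrow> mcong_gen M S \<subseteq> R"
  by (auto simp: mcong_gen_def)

lemma mcong_kernel:
  assumes "monoid M" "h \<in> mhom M N"
  shows "mcong M {(x, y). x \<in> carrier M \<and> y \<in> carrier M \<and> h x = h y}"
proof -
  interpret monoid M by fact
  show ?thesis using assms
    by (auto simp: mcong_def equiv_def refl_on_def sym_def trans_def mhomD)
qed

lemma mquot_carrier: "carrier (mquot M R) = (\<lambda>x. R `` {x}) ` carrier M"
  by (auto simp: mquot_def quotient_def)

lemma mquot_one: "\<one>\<^bsub>mquot M R\<^esub> = R `` {\<one>\<^bsub>M\<^esub>}"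
  by (simp add: mquot_def)

lemma mquot_mult:
  assumes "mcong M R" "a \<in> carrier M" "b \<in> carrier M"
  shows "R `` {a} \<otimes>\<^bsub>mquot M R\<^esub> R `` {b} = R `` {a \<otimes>\<^bsub>M\<^esub> b}"
proof -
  have e: "equiv (carrier M) R" using assms by (simp add: mcong_def)
  have c: "congruent2 R R (\<lambda>a b. R `` {a \<otimes>\<^bsub>M\<^esub> b})"
    by (rule congruent2I') (metis assms(1) e equiv_class_eq mcong_mult)
  show ?thesis
    using UN_equiv_class2[OF e e c assms(2,3)] by (simp add: mquot_def)
qed

lemma mquot_comm_monoid:
  assumes "comm_monoid M" "mcong M R"
  shows "comm_monoid (mquot M R)"
proof -
  interpret comm_monoid M by fact
  show ?thesis
    by (rule comm_monoidI)
      (auto simp: mquot_carrier mquot_one mquot_mult[OF assms(2)] m_ac)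
qed

lemma mquot_proj:
  assumes "mcong M R"
  shows "(\<lambda>x. R `` {x}) \<in> mhom M (mquot M R)"
  by (rule mhomI) (auto simp: mquot_carrier mquot_one mquot_mult[OF assms])

lemma mquot_lift:
  assumes "monoid M" "mcong M R" "h \<in> mhom M N" "\<And>x y. (x, y) \<in> R \<Longrightarrow> h x = h y"
  obtains \<phi> where "\<phi> \<in> mhom (mquot M R) N" "\<And>x. x \<in> carrier M \<Longrightarrow> \<phi> (R `` {x}) = h x"
proof -
  interpret monoid M by fact
  define \<phi> where "\<phi> = (\<lambda>A. h (SOME x. x \<in> A))"
  have \<phi>: "\<phi> (R `` {x}) = h x" if "x \<in> carrier M" for x
  proof -
    have "x \<in> R `` {x}" using that assms(2) by (auto simp: mcong_def equiv_def refl_on_def)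
    then have "(SOME y. y \<in> R `` {x}) \<in> R `` {x}" by (rule someI)
    then show ?thesis using assms(4) by (auto simp: \<phi>_def)
  qed
  have "\<phi> \<in> mhom (mquot M R) N"
    using assms by (intro mhomI) (auto simp: mquot_carrier mquot_one mquot_mult[OF assms(2)] \<phi> mhomD)
  with \<phi> that show ?thesis by blast
qed

lemma mquot_gen_lift:
  assumes "monoid M" "S \<subseteq> carrier M \<times> carrier M" "h \<in> mhom M N"
    "\<And>x y. (x, y) \<in> S \<Longrightarrow> h x = h y"
  obtains \<phi> where "\<phi> \<in> mhom (mquot M (mcong_gen M S)) N"
    "\<And>x. x \<in> carrier M \<Longrightarrow> \<phi> (mcong_gen M S `` {x}) = h x"
proof (rule mquot_lift[OF assms(1) mcong_gen_mcong[OF assms(1,2)] assms(3)])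
  fix x y assume "(x, y) \<in> mcong_gen M S"
  moreover have "S \<subseteq> {(x, y). x \<in> carrier M \<and> y \<in> carrier M \<and> h x = h y}"
    using assms by auto
  ultimately show "h x = h y"
    using mcong_gen_least[OF mcong_kernel[OF assms(1,3)]] by blast
qed (use that in blast)

context
  fixes P :: "'p monoid" and A :: "'a monoid" and B :: "'b monoid" and f g
  assumes P: "comm_monoid P" and A: "comm_monoid A" and B: "comm_monoid B"
    and f: "f \<in> mhom P A" and g: "g \<in> mhom P B"
begin

private abbreviation (input) "S \<equiv> {((f p, \<one>\<^bsub>B\<^esub>), (\<one>\<^bsub>A\<^esub>, g p)) | p. p \<in> carrier P}"
private abbreviation (input) "C \<equiv> mcong_gen (A \<times>\<times> B) S"

interpretation A: comm_monoid A by (rule A)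
interpretation B: comm_monoid B by (rule B)
interpretation AB: comm_monoid "A \<times>\<times> B" by (rule comm_monoid_DirProd[OF A B])

private lemma S: "S \<subseteq> carrier (A \<times>\<times> B) \<times> carrier (A \<times>\<times> B)"
  using f g by (auto simp: mhomD)

private lemma C: "mcong (A \<times>\<times> B) C"
  by (rule mcong_gen_mcong[OF AB.monoid_axioms S])

lemma mpushout_comm_monoid: "comm_monoid (mpushout P A B f g)"
  unfolding mpushout_def by (rule mquot_comm_monoid[OF AB.comm_monoid_axioms C])

lemma mpushout_inl: "(\<lambda>a. C `` {(a, \<one>\<^bsub>B\<^esub>)}) \<in> mhom A (mpushout P A B f g)"
  and mpushout_inr: "(\<lambda>b. C `` {(\<one>\<^bsub>A\<^esub>, b)}) \<in> mhom B (mpushout P A B f g)"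
  unfolding mpushout_def
  by (rule mhomI; simp add: mquot_carrier mquot_one mquot_mult[OF C])+

lemma mpushout_commutes:
  assumes "p \<in> carrier P"
  shows "C `` {(f p, \<one>\<^bsub>B\<^esub>)} = C `` {(\<one>\<^bsub>A\<^esub>, g p)}"
proof -
  have "((f p, \<one>\<^bsub>B\<^esub>), (\<one>\<^bsub>A\<^esub>, g p)) \<in> C" using mcong_gen_incl[of S "A \<times>\<times> B"] assms by blast
  then show ?thesis
    using C unfolding mcong_def by (metis (no_types, lifting) equiv_class_eq)
qed

lemma mpushout_universal:
  assumes T: "comm_monoid T" and u: "u \<in> mhom A T" and v: "v \<in> mhom B T"
    and uv: "\<And>p. p \<in> carrier P \<Longrightarrow> u (f p) = v (g p)"
  shows "\<exists>\<phi> \<in> mhom (mpushout P A B f g) T.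
    (\<forall>a \<in> carrier A. \<phi> (C `` {(a, \<one>\<^bsub>B\<^esub>)}) = u a) \<and>
    (\<forall>b \<in> carrier B. \<phi> (C `` {(\<one>\<^bsub>A\<^esub>, b)}) = v b) \<and>
    (\<forall>\<psi> \<in> mhom (mpushout P A B f g) T.
       (\<forall>a \<in> carrier A. \<psi> (C `` {(a, \<one>\<^bsub>B\<^esub>)}) = u a) \<and>
       (\<forall>b \<in> carrier B. \<psi> (C `` {(\<one>\<^bsub>A\<^esub>, b)}) = v b) \<longrightarrow>
       (\<forall>z \<in> carrier (mpushout P A B f g). \<psi> z = \<phi> z))"
proof -
  let ?M = "mpushout P A B f g"
  define \<pi> where "\<pi> = (\<lambda>x. C `` {x})"
  have \<pi>: "\<pi> \<in> mhom (A \<times>\<times> B) ?M"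
    unfolding \<pi>_def mpushout_def by (rule mquot_proj[OF C])
  have surj: "carrier ?M = \<pi> ` carrier (A \<times>\<times> B)"
    by (simp add: mpushout_def mquot_carrier \<pi>_def)
  interpret T: comm_monoid T by fact
  define h where "h = (\<lambda>(a, b). u a \<otimes>\<^bsub>T\<^esub> v b)"
  have h: "h \<in> mhom (A \<times>\<times> B) T"
    by (rule mhomI) (auto simp: h_def mhomD[OF u] mhomD[OF v] T.m_ac)
  obtain \<phi> where \<phi>: "\<phi> \<in> mhom ?M T" "\<And>x. x \<in> carrier (A \<times>\<times> B) \<Longrightarrow> \<phi> (\<pi> x) = h x"
  proof (rule mquot_gen_lift[OF AB.monoid_axioms S h])
    show "h x = h y" if "(x, y) \<in> S" for x y
      using that by (auto simp: h_def mhomD[OF u] mhomD[OF v] mhomD[OF f] mhomD[OF g] uv)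
  qed (use that in \<open>auto simp: mpushout_def \<pi>_def\<close>)
  have split: "\<pi> (a, b) = \<pi> (a, \<one>\<^bsub>B\<^esub>) \<otimes>\<^bsub>?M\<^esub> \<pi> (\<one>\<^bsub>A\<^esub>, b)"
    if "a \<in> carrier A" "b \<in> carrier B" for a b
    using that mhomD(2)[OF \<pi>, of "(a, \<one>\<^bsub>B\<^esub>)" "(\<one>\<^bsub>A\<^esub>, b)"] by simp
  have \<pi>_eq: "C `` {x} = \<pi> x" for x by (simp add: \<pi>_def)
  show ?thesis unfolding \<pi>_eq
  proof (intro bexI[OF _ \<phi>(1)] conjI ballI impI)
    fix \<psi> z
    assume \<psi>: "\<psi> \<in> mhom ?M T"
      and eq: "(\<forall>a \<in> carrier A. \<psi> (\<pi> (a, \<one>\<^bsub>B\<^esub>)) = u a) \<and> (\<forall>b \<in> carrier B. \<psi> (\<pi> (\<one>\<^bsub>A\<^esub>, b)) = v b)"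
      and "z \<in> carrier ?M"
    then obtain a b where ab: "a \<in> carrier A" "b \<in> carrier B" "z = \<pi> (a, b)"
      by (auto simp: surj)
    have "\<psi> z = \<psi> (\<pi> (a, \<one>\<^bsub>B\<^esub>)) \<otimes>\<^bsub>T\<^esub> \<psi> (\<pi> (\<one>\<^bsub>A\<^esub>, b))"
      unfolding ab(3) split[OF ab(1,2)]
      by (rule mhomD(2)[OF \<psi>]) (use ab in \<open>auto intro: mhomD(1)[OF \<pi>]\<close>)
    then have "\<psi> z = u a \<otimes>\<^bsub>T\<^esub> v b" using ab eq by simp
    then show "\<psi> z = \<phi> z" using ab \<phi>(2)[of "(a, b)"] by (simp add: h_def)
  qed (simp_all add: \<phi>(2) h_def mhomD[OF u] mhomD[OF v])
qed

end

lemma gp_rel_mcong: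
  assumes "comm_monoid M"
  shows "mcong (M \<times>\<times> M) (gp_rel M)"
proof -
  interpret comm_monoid M by fact
  have tr: "\<exists>k\<in>carrier M. a \<otimes>\<^bsub>M\<^esub> d' \<otimes>\<^bsub>M\<^esub> k = c' \<otimes>\<^bsub>M\<^esub> b \<otimes>\<^bsub>M\<^esub> k"
    if [simp]: "a \<in> carrier M" "b \<in> carrier M" "c \<in> carrier M" "d \<in> carrier M"
      "c' \<in> carrier M" "d' \<in> carrier M" "k \<in> carrier M" "l \<in> carrier M"
      and e: "a \<otimes>\<^bsub>M\<^esub> d \<otimes>\<^bsub>M\<^esub> k = c \<otimes>\<^bsub>M\<^esub> b \<otimes>\<^bsub>M\<^esub> k"
      "c \<otimes>\<^bsub>M\<^esub> d' \<otimes>\<^bsub>M\<^esub> l = c' \<otimes>\<^bsub>M\<^esub> d \<otimes>\<^bsub>M\<^esub> l"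
    for a b c d c' d' k l
  proof (intro bexI)
    have "a \<otimes>\<^bsub>M\<^esub> d' \<otimes>\<^bsub>M\<^esub> (d \<otimes>\<^bsub>M\<^esub> k \<otimes>\<^bsub>M\<^esub> l) = (a \<otimes>\<^bsub>M\<^esub> d \<otimes>\<^bsub>M\<^esub> k) \<otimes>\<^bsub>M\<^esub> d' \<otimes>\<^bsub>M\<^esub> l"
      by (simp add: m_ac)
    also have "\<dots> = (c \<otimes>\<^bsub>M\<^esub> d' \<otimes>\<^bsub>M\<^esub> l) \<otimes>\<^bsub>M\<^esub> b \<otimes>\<^bsub>M\<^esub> k" unfolding e(1) by (simp add: m_ac)
    also have "\<dots> = c' \<otimes>\<^bsub>M\<^esub> b \<otimes>\<^bsub>M\<^esub> (d \<otimes>\<^bsub>M\<^esub> k \<otimes>\<^bsub>M\<^esub> l)" unfolding e(2) by (simp add: m_ac)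
    finally show "a \<otimes>\<^bsub>M\<^esub> d' \<otimes>\<^bsub>M\<^esub> (d \<otimes>\<^bsub>M\<^esub> k \<otimes>\<^bsub>M\<^esub> l) = c' \<otimes>\<^bsub>M\<^esub> b \<otimes>\<^bsub>M\<^esub> (d \<otimes>\<^bsub>M\<^esub> k \<otimes>\<^bsub>M\<^esub> l)" .
  qed simp
  have mu: "\<exists>k\<in>carrier M. a \<otimes>\<^bsub>M\<^esub> a' \<otimes>\<^bsub>M\<^esub> (d \<otimes>\<^bsub>M\<^esub> d') \<otimes>\<^bsub>M\<^esub> k = c \<otimes>\<^bsub>M\<^esub> c' \<otimes>\<^bsub>M\<^esub> (b \<otimes>\<^bsub>M\<^esub> b') \<otimes>\<^bsub>M\<^esub> k"
    if [simp]: "a \<in> carrier M" "b \<in> carrier M" "c \<in> carrier M" "d \<in> carrier M"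
      "a' \<in> carrier M" "b' \<in> carrier M" "c' \<in> carrier M" "d' \<in> carrier M"
      "k \<in> carrier M" "l \<in> carrier M"
      and e: "a \<otimes>\<^bsub>M\<^esub> d \<otimes>\<^bsub>M\<^esub> k = c \<otimes>\<^bsub>M\<^esub> b \<otimes>\<^bsub>M\<^esub> k"
      "a' \<otimes>\<^bsub>M\<^esub> d' \<otimes>\<^bsub>M\<^esub> l = c' \<otimes>\<^bsub>M\<^esub> b' \<otimes>\<^bsub>M\<^esub> l"
    for a b c d a' b' c' d' k l
  proof (intro bexI)
    have "a \<otimes>\<^bsub>M\<^esub> a' \<otimes>\<^bsub>M\<^esub> (d \<otimes>\<^bsub>M\<^esub> d') \<otimes>\<^bsub>M\<^esub> (k \<otimes>\<^bsub>M\<^esub> l)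
        = (a \<otimes>\<^bsub>M\<^esub> d \<otimes>\<^bsub>M\<^esub> k) \<otimes>\<^bsub>M\<^esub> (a' \<otimes>\<^bsub>M\<^esub> d' \<otimes>\<^bsub>M\<^esub> l)" by (simp add: m_ac)
    also have "\<dots> = c \<otimes>\<^bsub>M\<^esub> c' \<otimes>\<^bsub>M\<^esub> (b \<otimes>\<^bsub>M\<^esub> b') \<otimes>\<^bsub>M\<^esub> (k \<otimes>\<^bsub>M\<^esub> l)" unfolding e by (simp add: m_ac)
    finally show "a \<otimes>\<^bsub>M\<^esub> a' \<otimes>\<^bsub>M\<^esub> (d \<otimes>\<^bsub>M\<^esub> d') \<otimes>\<^bsub>M\<^esub> (k \<otimes>\<^bsub>M\<^esub> l)
        = c \<otimes>\<^bsub>M\<^esub> c' \<otimes>\<^bsub>M\<^esub> (b \<otimes>\<^bsub>M\<^esub> b') \<otimes>\<^bsub>M\<^esub> (k \<otimes>\<^bsub>M\<^esub> l)" .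
  qed simp
  have "equiv (carrier (M \<times>\<times> M)) (gp_rel M)"
  proof (rule equivI)
    show "gp_rel M \<subseteq> carrier (M \<times>\<times> M) \<times> carrier (M \<times>\<times> M)" by (auto simp: gp_rel_def)
    show "refl_on (carrier (M \<times>\<times> M)) (gp_rel M)" by (auto simp: gp_rel_def refl_on_def)
    show "sym (gp_rel M)" by (force simp: gp_rel_def sym_def)
    show "trans (gp_rel M)"
      by (rule transI) (auto simp: gp_rel_def intro: tr)
  qed
  then show ?thesis
    by (auto simp: mcong_def gp_rel_def intro: mu)
qed

definition gp_frac :: "'a monoid \<Rightarrow> 'a \<Rightarrow> 'a \<Rightarrow> ('a \<times> 'a) set" where
  "gp_frac M a b = gp_rel M `` {(a, b)}"

context
  fixes M :: "'a monoid"
  assumes M: "comm_monoid M"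
begin

interpretation comm_monoid M by (rule M)

lemma gp_frac_mult:
  "\<lbrakk>a \<in> carrier M; b \<in> carrier M; c \<in> carrier M; d \<in> carrier M\<rbrakk> \<Longrightarrow>
   gp_frac M a b \<otimes>\<^bsub>gp M\<^esub> gp_frac M c d = gp_frac M (a \<otimes>\<^bsub>M\<^esub> c) (b \<otimes>\<^bsub>M\<^esub> d)"
  using mquot_mult[OF gp_rel_mcong[OF M], of "(a, b)" "(c, d)"] by (simp add: gp_frac_def gp_def)

lemma gp_carrier: "carrier (gp M) = {gp_frac M a b | a b. a \<in> carrier M \<and> b \<in> carrier M}"
  by (force simp: gp_def mquot_carrier gp_frac_def)

lemma gp_frac_closed: "a \<in> carrier M \<Longrightarrow> b \<in> carrier M \<Longrightarrow> gp_frac M a b \<in> carrier (gp M)"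
  by (auto simp: gp_carrier)

lemma gp_one: "\<one>\<^bsub>gp M\<^esub> = gp_frac M \<one>\<^bsub>M\<^esub> \<one>\<^bsub>M\<^esub>"
  by (simp add: gp_def mquot_one gp_frac_def)

lemma gp_frac_eq_iff:
  assumes "a \<in> carrier M" "b \<in> carrier M" "c \<in> carrier M" "d \<in> carrier M"
  shows "gp_frac M a b = gp_frac M c d \<longleftrightarrow>
    (\<exists>k \<in> carrier M. a \<otimes>\<^bsub>M\<^esub> d \<otimes>\<^bsub>M\<^esub> k = c \<otimes>\<^bsub>M\<^esub> b \<otimes>\<^bsub>M\<^esub> k)"
proof -
  have "equiv (carrier (M \<times>\<times> M)) (gp_rel M)" using gp_rel_mcong[OF M] by (simp add: mcong_def)
  then have "gp_frac M a b = gp_frac M c d \<longleftrightarrow> ((a, b), (c, d)) \<in> gp_rel M"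
    unfolding gp_frac_def using assms by (intro eq_equiv_class_iff) auto
  then show ?thesis using assms by (simp add: gp_rel_def)
qed

lemma gp_comm_group: "comm_group (gp M)"
proof (rule comm_groupI)
  have "comm_monoid (gp M)"
    unfolding gp_def by (rule mquot_comm_monoid[OF comm_monoid_DirProd[OF M M] gp_rel_mcong[OF M]])
  then interpret G: comm_monoid "gp M" .
  show "\<exists>y\<in>carrier (gp M). y \<otimes>\<^bsub>gp M\<^esub> x = \<one>\<^bsub>gp M\<^esub>" if x: "x \<in> carrier (gp M)" for x
  proof -
    obtain a b where "a \<in> carrier M" "b \<in> carrier M" "x = gp_frac M a b"
      using x by (auto simp: gp_carrier)
    then show ?thesis
      by (intro bexI[of _ "gp_frac M b a"])
        (auto simp: gp_frac_mult gp_one gp_frac_eq_iff m_ac intro!: gp_frac_closed)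
  qed
qed (auto simp: comm_monoid.axioms comm_monoid.m_comm monoid.m_assoc
    mquot_comm_monoid[OF comm_monoid_DirProd[OF M M] gp_rel_mcong[OF M], folded gp_def]
    intro: monoid.m_closed monoid.one_closed)

interpretation G: comm_group "gp M" by (rule gp_comm_group)

lemma gp_unit_frac: "gp_unit M a = gp_frac M a \<one>\<^bsub>M\<^esub>"
  by (simp add: gp_unit_def gp_frac_def)

lemma gp_unit_mhom: "gp_unit M \<in> mhom M (gp M)"
  by (rule mhomI) (auto simp: gp_unit_frac gp_frac_closed gp_frac_mult gp_one)

lemma gp_frac_unit:
  assumes "a \<in> carrier M" "b \<in> carrier M"
  shows "gp_frac M a b = gp_unit M a \<otimes>\<^bsub>gp M\<^esub> inv\<^bsub>gp M\<^esub> (gp_unit M b)"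
proof -
  have "gp_frac M a b \<otimes>\<^bsub>gp M\<^esub> gp_unit M b = gp_unit M a"
    using assms by (auto simp: gp_unit_frac gp_frac_mult gp_frac_eq_iff m_ac)
  then show ?thesis
    using assms by (metis G.inv_solve_right' gp_frac_closed gp_unit_mhom mhomD(1))
qed

lemma gp_lift:
  assumes "comm_group T" "h \<in> mhom M T"
  obtains \<phi> where "\<phi> \<in> mhom (gp M) T" "\<And>x. x \<in> carrier M \<Longrightarrow> \<phi> (gp_unit M x) = h x"
proof -
  interpret T: comm_group T by fact
  let ?h = "\<lambda>(a, b). h a \<otimes>\<^bsub>T\<^esub> inv\<^bsub>T\<^esub> h b"
  have MM: "monoid (M \<times>\<times> M)" by (rule DirProd_monoid) (rule monoid_axioms)+
  have "?h \<in> mhom (M \<times>\<times> M) T"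
    by (rule mhomI) (auto simp: mhomD[OF assms(2)] T.inv_mult T.m_ac)
  then obtain \<phi> where \<phi>: "\<phi> \<in> mhom (gp M) T"
    "\<And>x. x \<in> carrier (M \<times>\<times> M) \<Longrightarrow> \<phi> (gp_rel M `` {x}) = ?h x"
  proof (rule mquot_lift[OF MM gp_rel_mcong[OF M]])
    fix x y assume "(x, y) \<in> gp_rel M"
    then obtain a b c d k where xy: "x = (a, b)" "y = (c, d)"
      and [simp]: "a \<in> carrier M" "b \<in> carrier M" "c \<in> carrier M" "d \<in> carrier M" "k \<in> carrier M"
      and e: "a \<otimes>\<^bsub>M\<^esub> d \<otimes>\<^bsub>M\<^esub> k = c \<otimes>\<^bsub>M\<^esub> b \<otimes>\<^bsub>M\<^esub> k"
      by (auto simp: gp_rel_def)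
    have [simp]: "\<And>x. x \<in> carrier M \<Longrightarrow> h x \<in> carrier T" by (rule mhomD(1)[OF assms(2)])
    have "h (a \<otimes>\<^bsub>M\<^esub> d \<otimes>\<^bsub>M\<^esub> k) = h (c \<otimes>\<^bsub>M\<^esub> b \<otimes>\<^bsub>M\<^esub> k)" using e by simp
    then have e2: "h a \<otimes>\<^bsub>T\<^esub> h d = h c \<otimes>\<^bsub>T\<^esub> h b"
      by (simp add: mhomD(2)[OF assms(2)])
    have "h a \<otimes>\<^bsub>T\<^esub> inv\<^bsub>T\<^esub> h b = (h a \<otimes>\<^bsub>T\<^esub> h d) \<otimes>\<^bsub>T\<^esub> (inv\<^bsub>T\<^esub> h d \<otimes>\<^bsub>T\<^esub> inv\<^bsub>T\<^esub> h b)"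
      by (simp add: T.m_assoc) (simp flip: T.m_assoc)
    also have "\<dots> = h c \<otimes>\<^bsub>T\<^esub> inv\<^bsub>T\<^esub> h d"
    proof -
      have sw: "p \<otimes>\<^bsub>T\<^esub> q \<otimes>\<^bsub>T\<^esub> (x \<otimes>\<^bsub>T\<^esub> y) = p \<otimes>\<^bsub>T\<^esub> x \<otimes>\<^bsub>T\<^esub> (q \<otimes>\<^bsub>T\<^esub> y)"
        if "p \<in> carrier T" "q \<in> carrier T" "x \<in> carrier T" "y \<in> carrier T" for p q x y
        using that by (simp add: T.m_ac)
      show ?thesis unfolding e2 by (subst sw) simp_all
    qed
    finally show "?h x = ?h y" by (simp add: xy)
  qed (auto simp: gp_def)
  show ?thesis
  proof
    show "\<phi> \<in> mhom (gp M) T" by fact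
    show "\<phi> (gp_unit M x) = h x" if "x \<in> carrier M" for x
      using \<phi>(2)[of "(x, \<one>\<^bsub>M\<^esub>)"] that by (simp add: gp_unit_def mhomD[OF assms(2)])
  qed
qed

lemma integral_monoid_iff:
  "integral_monoid M \<longleftrightarrow>
    (\<forall>a \<in> carrier M. \<forall>b \<in> carrier M. \<forall>k \<in> carrier M. a \<otimes>\<^bsub>M\<^esub> k = b \<otimes>\<^bsub>M\<^esub> k \<longrightarrow> a = b)"
  using M by (auto simp: integral_monoid_def inj_on_def gp_unit_frac gp_frac_eq_iff)

lemma saturated_monoid_iff:
  "saturated_monoid M \<longleftrightarrow> integral_monoid M \<and>
    (\<forall>a \<in> carrier M. \<forall>b \<in> carrier M. \<forall>c \<in> carrier M. \<forall>n::nat. n \<ge> 1 \<longrightarrow>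
       a [^]\<^bsub>M\<^esub> n = c \<otimes>\<^bsub>M\<^esub> b [^]\<^bsub>M\<^esub> n \<longrightarrow> (\<exists>d \<in> carrier M. a = d \<otimes>\<^bsub>M\<^esub> b))"
proof -
  have pw: "gp_frac M a b [^]\<^bsub>gp M\<^esub> n = gp_frac M (a [^]\<^bsub>M\<^esub> n) (b [^]\<^bsub>M\<^esub> n)"
    if "a \<in> carrier M" "b \<in> carrier M" for a b and n :: nat
    using that by (induction n) (auto simp: gp_one gp_frac_mult)
  have fu: "gp_frac M a b \<in> gp_unit M ` carrier M \<longleftrightarrow> (\<exists>d \<in> carrier M. a = d \<otimes>\<^bsub>M\<^esub> b)"
    if "integral_monoid M" and [simp]: "a \<in> carrier M" "b \<in> carrier M" for a b
  proof -
    have "gp_frac M a b = gp_unit M d \<longleftrightarrow> a = d \<otimes>\<^bsub>M\<^esub> b" if [simp]: "d \<in> carrier M" for d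
    proof -
      have "gp_frac M a b = gp_unit M d \<longleftrightarrow> (\<exists>k \<in> carrier M. a \<otimes>\<^bsub>M\<^esub> k = d \<otimes>\<^bsub>M\<^esub> b \<otimes>\<^bsub>M\<^esub> k)"
        by (simp add: gp_unit_frac gp_frac_eq_iff)
      also have "\<dots> \<longleftrightarrow> a = d \<otimes>\<^bsub>M\<^esub> b"
      proof
        show "a = d \<otimes>\<^bsub>M\<^esub> b" if "\<exists>k \<in> carrier M. a \<otimes>\<^bsub>M\<^esub> k = d \<otimes>\<^bsub>M\<^esub> b \<otimes>\<^bsub>M\<^esub> k"
          using that \<open>integral_monoid M\<close>[unfolded integral_monoid_iff, rule_format, of a "d \<otimes>\<^bsub>M\<^esub> b"]
          by (elim bexE) simp
      qed (use one_closed in blast)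
      finally show ?thesis .
    qed
    then show ?thesis by (auto simp: image_iff)
  qed
  show ?thesis
  proof (cases "integral_monoid M")
    case True
    have "saturated_monoid M \<longleftrightarrow> (\<forall>a \<in> carrier M. \<forall>b \<in> carrier M. \<forall>n::nat. n \<ge> 1 \<longrightarrow>
        gp_frac M a b [^]\<^bsub>gp M\<^esub> n \<in> gp_unit M ` carrier M \<longrightarrow>
        gp_frac M a b \<in> gp_unit M ` carrier M)"
      using True unfolding saturated_monoid_def gp_carrier by blast
    also have "\<dots> \<longleftrightarrow> (\<forall>a \<in> carrier M. \<forall>b \<in> carrier M. \<forall>n::nat. n \<ge> 1 \<longrightarrow>
        (\<exists>c \<in> carrier M. a [^]\<^bsub>M\<^esub> n = c \<otimes>\<^bsub>M\<^esub> b [^]\<^bsub>M\<^esub> n) \<longrightarrow>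
        (\<exists>d \<in> carrier M. a = d \<otimes>\<^bsub>M\<^esub> b))"
      by (intro ball_cong all_cong1 refl) (simp only: pw fu[OF True] nat_pow_closed)
    also have "\<dots> \<longleftrightarrow> (\<forall>a \<in> carrier M. \<forall>b \<in> carrier M. \<forall>c \<in> carrier M. \<forall>n::nat. n \<ge> 1 \<longrightarrow>
       a [^]\<^bsub>M\<^esub> n = c \<otimes>\<^bsub>M\<^esub> b [^]\<^bsub>M\<^esub> n \<longrightarrow> (\<exists>d \<in> carrier M. a = d \<otimes>\<^bsub>M\<^esub> b))"
      by (rule ball_cong[OF refl], rule ball_cong[OF refl]) fast
    finally show ?thesis using True by simp
  qed (simp add: saturated_monoid_def)
qed

end

text \<open>
  The next two lemmas are used for both reflections: \<^term>\<open>C\<close> is the carrier of a submonoid of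
  the group completion containing the image of \<^term>\<open>M\<close>.
\<close>

lemma gp_sub_integral:
  assumes "comm_monoid M" "C \<subseteq> carrier (gp M)" "gp_unit M ` carrier M \<subseteq> C"
    "\<And>x y. x \<in> C \<Longrightarrow> y \<in> C \<Longrightarrow> x \<otimes>\<^bsub>gp M\<^esub> y \<in> C"
  shows "integral_monoid ((gp M)\<lparr>carrier := C\<rparr>)"
proof -
  interpret comm_monoid M by fact
  interpret G: comm_group "gp M" by (rule gp_comm_group) fact
  have mem: "x \<in> carrier (gp M)" if "x \<in> C" for x using assms(2) that by blast
  have one: "\<one>\<^bsub>gp M\<^esub> \<in> C"
    using assms(3) mhomD(3)[OF gp_unit_mhom[OF assms(1)]] one_closed by (metis imageI subsetD)
  have "comm_monoid ((gp M)\<lparr>carrier := C\<rparr>)"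
    by (rule comm_monoidI) (simp_all add: assms(4) one mem G.m_ac)
  then show ?thesis by (auto simp: integral_monoid_iff mem)
qed

lemma gp_sub_universal:
  assumes "comm_monoid M" "C \<subseteq> carrier (gp M)" "gp_unit M ` carrier M \<subseteq> C"
    "\<And>x y. x \<in> C \<Longrightarrow> y \<in> C \<Longrightarrow> x \<otimes>\<^bsub>gp M\<^esub> y \<in> C"
    and T: "integral_monoid T" and h: "h \<in> mhom M T"
    and C: "\<And>\<Phi>. \<Phi> \<in> mhom (gp M) (gp T) \<Longrightarrow>
        (\<And>x. x \<in> carrier M \<Longrightarrow> \<Phi> (gp_unit M x) = gp_unit T (h x)) \<Longrightarrow>
        \<Phi> ` C \<subseteq> gp_unit T ` carrier T"
  shows "\<exists>\<phi> \<in> mhom ((gp M)\<lparr>carrier := C\<rparr>) T. (\<forall>x \<in> carrier M. \<phi> (gp_unit M x) = h x) \<and>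
    (\<forall>\<psi> \<in> mhom ((gp M)\<lparr>carrier := C\<rparr>) T. (\<forall>x \<in> carrier M. \<psi> (gp_unit M x) = h x) \<longrightarrow>
       (\<forall>z \<in> C. \<psi> z = \<phi> z))"
proof -
  interpret comm_monoid M by fact
  have cT: "comm_monoid T" and inj: "inj_on (gp_unit T) (carrier T)"
    using T by (auto simp: integral_monoid_def)
  interpret T: comm_monoid T by fact
  interpret G: comm_group "gp M" by (rule gp_comm_group) fact
  have mem: "x \<in> carrier (gp M)" if "x \<in> C" for x using assms(2) that by blast
  have uT: "gp_unit T \<in> mhom T (gp T)" by (rule gp_unit_mhom[OF cT])
  have uM: "gp_unit M \<in> mhom M (gp M)" by (rule gp_unit_mhom[OF assms(1)])
  have "(\<lambda>x. gp_unit T (h x)) \<in> mhom M (gp T)"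
    by (rule mhomI) (auto simp: mhomD[OF h] mhomD[OF uT])
  then obtain \<Phi> where \<Phi>: "\<Phi> \<in> mhom (gp M) (gp T)"
    "\<And>x. x \<in> carrier M \<Longrightarrow> \<Phi> (gp_unit M x) = gp_unit T (h x)"
    using gp_lift[OF assms(1) gp_comm_group[OF cT]] by blast
  define \<phi> where "\<phi> = (\<lambda>z. the_inv_into (carrier T) (gp_unit T) (\<Phi> z))"
  have \<phi>C: "\<phi> z \<in> carrier T" "gp_unit T (\<phi> z) = \<Phi> z" if "z \<in> C" for z
  proof -
    have *: "\<Phi> z \<in> gp_unit T ` carrier T" using C[OF \<Phi>] that by blast
    show "\<phi> z \<in> carrier T"
      unfolding \<phi>_def by (rule the_inv_into_into[OF inj * subset_refl])
    show "gp_unit T (\<phi> z) = \<Phi> z"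
      unfolding \<phi>_def by (rule f_the_inv_into_f[OF inj *])
  qed
  have inv: "\<phi> z = t" if "t \<in> carrier T" "\<Phi> z = gp_unit T t" for z t
    using that by (simp add: \<phi>_def the_inv_into_f_f[OF inj])
  have \<phi>: "\<phi> \<in> mhom ((gp M)\<lparr>carrier := C\<rparr>) T"
  proof (rule mhomI)
    show "\<phi> (x \<otimes>\<^bsub>(gp M)\<lparr>carrier := C\<rparr>\<^esub> y) = \<phi> x \<otimes>\<^bsub>T\<^esub> \<phi> y"
      if "x \<in> carrier ((gp M)\<lparr>carrier := C\<rparr>)" "y \<in> carrier ((gp M)\<lparr>carrier := C\<rparr>)" for x y
      using that by (intro inv) (auto simp: \<phi>C mhomD(2)[OF uT] mhomD(2)[OF \<Phi>(1)] mem)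
    show "\<phi> \<one>\<^bsub>(gp M)\<lparr>carrier := C\<rparr>\<^esub> = \<one>\<^bsub>T\<^esub>"
      by (intro inv) (auto simp: mhomD(3)[OF uT] mhomD(3)[OF \<Phi>(1)])
  qed (auto simp: \<phi>C)
  have \<phi>h: "\<phi> (gp_unit M x) = h x" if "x \<in> carrier M" for x
    using that by (intro inv) (auto simp: mhomD[OF h] \<Phi>(2))
  show ?thesis
  proof (intro bexI[OF _ \<phi>] conjI ballI impI \<phi>h)
    fix \<psi> z assume \<psi>: "\<psi> \<in> mhom ((gp M)\<lparr>carrier := C\<rparr>) T"
      and \<psi>h: "\<forall>x \<in> carrier M. \<psi> (gp_unit M x) = h x" and z: "z \<in> C"
    obtain a b where ab: "a \<in> carrier M" "b \<in> carrier M" "z = gp_frac M a b"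
      using mem[OF z] by (auto simp: gp_carrier[OF assms(1)])
    have unit: "gp_unit M x \<in> C" if "x \<in> carrier M" for x using assms(3) that by blast
    have e: "z \<otimes>\<^bsub>gp M\<^esub> gp_unit M b = gp_unit M a"
      using ab mhomD(1)[OF uM] by (simp add: gp_frac_unit[OF assms(1)] G.m_assoc)
    have "\<psi> z \<otimes>\<^bsub>T\<^esub> h b = h a"
      using mhomD(2)[OF \<psi>, of z "gp_unit M b"] z ab(1,2) \<psi>h unit e by simp
    moreover have "\<phi> z \<otimes>\<^bsub>T\<^esub> h b = h a"
      using mhomD(2)[OF \<phi>, of z "gp_unit M b"] z ab(1,2) \<phi>h unit e by simp
    ultimately show "\<psi> z = \<phi> z"
      using T[unfolded integral_monoid_iff[OF cT], rule_format, of "\<psi> z" "\<phi> z" "h b"]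
        mhomD(1)[OF \<psi>, of z] mhomD(1)[OF \<phi>, of z] mhomD(1)[OF h ab(2)] z by simp
  qed
qed

lemma
  assumes "comm_monoid M"
  shows integralisation_integral: "integral_monoid (integralisation M)"
    and integralisation_unit: "gp_unit M \<in> mhom M (integralisation M)"
proof -
  interpret comm_monoid M by fact
  note u = gp_unit_mhom[OF assms]
  show "integral_monoid (integralisation M)"
    unfolding integralisation_def
    by (rule gp_sub_integral[OF assms]) (auto simp: mhomD(1)[OF u] mhomD(2)[OF u, symmetric])
  show "gp_unit M \<in> mhom M (integralisation M)"
    unfolding integralisation_def by (rule mhomI) (auto simp: mhomD[OF u])
qed

lemma integralisation_universal:
  assumes "comm_monoid M" "integral_monoid T" "h \<in> mhom M T"
  shows "\<exists>\<phi> \<in> mhom (integralisation M) T. (\<forall>x \<in> carrier M. \<phi> (gp_unit M x) = h x) \<and>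
    (\<forall>\<psi> \<in> mhom (integralisation M) T. (\<forall>x \<in> carrier M. \<psi> (gp_unit M x) = h x) \<longrightarrow>
       (\<forall>z \<in> carrier (integralisation M). \<psi> z = \<phi> z))"
proof -
  interpret comm_monoid M by fact
  note u = gp_unit_mhom[OF assms(1)]
  have "gp_unit M ` carrier M \<subseteq> carrier (gp M)" using mhomD(1)[OF u] by blast
  moreover have "x \<otimes>\<^bsub>gp M\<^esub> y \<in> gp_unit M ` carrier M"
    if "x \<in> gp_unit M ` carrier M" "y \<in> gp_unit M ` carrier M" for x y
    using that by (auto simp flip: mhomD(2)[OF u])
  moreover have "\<Phi> ` gp_unit M ` carrier M \<subseteq> gp_unit T ` carrier T"
    if "\<And>x. x \<in> carrier M \<Longrightarrow> \<Phi> (gp_unit M x) = gp_unit T (h x)" for \<Phi>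
    using that mhomD(1)[OF assms(3)] by auto
  ultimately show ?thesis
    using gp_sub_universal[OF assms(1) _ subset_refl _ assms(2,3)]
    by (simp add: integralisation_def)
qed

lemma saturation_memI:
  "\<lbrakk>x \<in> carrier (gp M); n \<ge> 1; x [^]\<^bsub>gp M\<^esub> (n::nat) \<in> gp_unit M ` carrier M\<rbrakk> \<Longrightarrow>
   x \<in> carrier (saturation M)"
  unfolding saturation_def by (simp del: One_nat_def) blast

lemma
  assumes "comm_monoid M"
  shows saturation_sub: "carrier (saturation M) \<subseteq> carrier (gp M)"
    and saturation_sup: "gp_unit M ` carrier M \<subseteq> carrier (saturation M)"
    and saturation_mult_closed: "\<And>x y. x \<in> carrier (saturation M) \<Longrightarrow>
      y \<in> carrier (saturation M) \<Longrightarrow> x \<otimes>\<^bsub>gp M\<^esub> y \<in> carrier (saturation M)"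
proof -
  interpret comm_monoid M by fact
  interpret G: comm_group "gp M" by (rule gp_comm_group) fact
  note u = gp_unit_mhom[OF assms]
  show "carrier (saturation M) \<subseteq> carrier (gp M)" by (auto simp: saturation_def)
  show "gp_unit M ` carrier M \<subseteq> carrier (saturation M)"
    by (auto simp: saturation_def mhomD(1)[OF u] intro!: exI[of _ "1::nat"])
  fix x y assume "x \<in> carrier (saturation M)" "y \<in> carrier (saturation M)"
  then obtain m n :: nat and a b where x: "x \<in> carrier (gp M)" "m \<ge> 1" "a \<in> carrier M"
      "x [^]\<^bsub>gp M\<^esub> m = gp_unit M a"
    and y: "y \<in> carrier (gp M)" "n \<ge> 1" "b \<in> carrier M" "y [^]\<^bsub>gp M\<^esub> n = gp_unit M b"
    by (auto simp: saturation_def)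
  have "(x \<otimes>\<^bsub>gp M\<^esub> y) [^]\<^bsub>gp M\<^esub> (m * n) = x [^]\<^bsub>gp M\<^esub> (m * n) \<otimes>\<^bsub>gp M\<^esub> y [^]\<^bsub>gp M\<^esub> (n * m)"
    using x(1) y(1) by (simp add: G.nat_pow_distrib mult.commute)
  also have "\<dots> = gp_unit M a [^]\<^bsub>gp M\<^esub> n \<otimes>\<^bsub>gp M\<^esub> gp_unit M b [^]\<^bsub>gp M\<^esub> m"
    using x y by (simp flip: G.nat_pow_pow)
  also have "\<dots> = gp_unit M (a [^]\<^bsub>M\<^esub> n \<otimes>\<^bsub>M\<^esub> b [^]\<^bsub>M\<^esub> m)"
    using x y by (simp add: mhomD(2)[OF u] mhom_pow[OF monoid_axioms u])
  finally have "(x \<otimes>\<^bsub>gp M\<^esub> y) [^]\<^bsub>gp M\<^esub> (m * n) \<in> gp_unit M ` carrier M"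
    using x y by simp
  moreover have "m * n \<ge> 1" using x y by simp
  ultimately show "x \<otimes>\<^bsub>gp M\<^esub> y \<in> carrier (saturation M)"
    using x y saturation_memI[of "x \<otimes>\<^bsub>gp M\<^esub> y" M "m * n"] by simp
qed

lemma saturation_eq: "saturation M = (gp M)\<lparr>carrier := carrier (saturation M)\<rparr>"
  by (simp add: saturation_def)

lemma saturation_pow: "x [^]\<^bsub>saturation M\<^esub> (n::nat) = x [^]\<^bsub>gp M\<^esub> n"
  by (simp add: saturation_def nat_pow_def)

lemma saturation_unit:
  assumes "comm_monoid M"
  shows "gp_unit M \<in> mhom M (saturation M)"
proof (rule mhomI)
  interpret comm_monoid M by fact
  note u = gp_unit_mhom[OF assms]
  show "gp_unit M x \<in> carrier (saturation M)" if "x \<in> carrier M" for x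
    using saturation_sup[OF assms] that by blast
  show "gp_unit M (x \<otimes>\<^bsub>M\<^esub> y) = gp_unit M x \<otimes>\<^bsub>saturation M\<^esub> gp_unit M y"
    if "x \<in> carrier M" "y \<in> carrier M" for x y
    using that mhomD(2)[OF u] by (simp add: saturation_def)
  show "gp_unit M \<one>\<^bsub>M\<^esub> = \<one>\<^bsub>saturation M\<^esub>"
    using mhomD(3)[OF u] by (simp add: saturation_def)
qed

lemma saturation_saturated:
  assumes "comm_monoid M"
  shows "saturated_monoid (saturation M)"
proof -
  interpret comm_monoid M by fact
  interpret G: comm_group "gp M" by (rule gp_comm_group) fact
  let ?N = "saturation M"
  have int: "integral_monoid ?N"
    using gp_sub_integral[OF assms saturation_sub[OF assms] saturation_sup[OF assms]
        saturation_mult_closed[OF assms]] saturation_eq[of M] by simp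
  then have cN: "comm_monoid ?N" by (simp add: integral_monoid_def)
  have mem: "x \<in> carrier (gp M)" if "x \<in> carrier ?N" for x
    using saturation_sub[OF assms] that by blast
  have mult: "x \<otimes>\<^bsub>?N\<^esub> y = x \<otimes>\<^bsub>gp M\<^esub> y" for x y by (simp add: saturation_def)
  show ?thesis unfolding saturated_monoid_iff[OF cN]
  proof (intro conjI int ballI allI impI)
    fix a b c and n :: nat
    assume abc: "a \<in> carrier ?N" "b \<in> carrier ?N" "c \<in> carrier ?N" and n: "n \<ge> 1"
      and e: "a [^]\<^bsub>?N\<^esub> n = c \<otimes>\<^bsub>?N\<^esub> b [^]\<^bsub>?N\<^esub> n"
    note m[simp] = mem[OF abc(1)] mem[OF abc(2)] mem[OF abc(3)]
    let ?d = "a \<otimes>\<^bsub>gp M\<^esub> inv\<^bsub>gp M\<^esub> b"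
    have "?d [^]\<^bsub>gp M\<^esub> n = a [^]\<^bsub>gp M\<^esub> n \<otimes>\<^bsub>gp M\<^esub> inv\<^bsub>gp M\<^esub> (b [^]\<^bsub>gp M\<^esub> n)"
      by (simp add: G.nat_pow_distrib G.nat_pow_inv)
    also have "\<dots> = c" using e by (simp add: saturation_pow mult G.m_assoc)
    finally have d: "?d [^]\<^bsub>gp M\<^esub> n = c" .
    obtain k :: nat where k: "k \<ge> 1" "c [^]\<^bsub>gp M\<^esub> k \<in> gp_unit M ` carrier M"
      using abc(3) by (auto simp: saturation_def)
    have "?d [^]\<^bsub>gp M\<^esub> (n * k) \<in> gp_unit M ` carrier M"
      using k(2) unfolding d[symmetric] by (subst G.nat_pow_pow[symmetric]) auto
    moreover have "n * k \<ge> 1" using n k by simp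
    ultimately have "?d \<in> carrier ?N" by (intro saturation_memI) simp_all
    then show "\<exists>d \<in> carrier ?N. a = d \<otimes>\<^bsub>?N\<^esub> b"
      by (rule bexI[rotated]) (simp add: mult G.m_assoc)
  qed
qed

lemma saturation_universal:
  assumes "comm_monoid M" "saturated_monoid T" "h \<in> mhom M T"
  shows "\<exists>\<phi> \<in> mhom (saturation M) T. (\<forall>x \<in> carrier M. \<phi> (gp_unit M x) = h x) \<and>
    (\<forall>\<psi> \<in> mhom (saturation M) T. (\<forall>x \<in> carrier M. \<psi> (gp_unit M x) = h x) \<longrightarrow>
       (\<forall>z \<in> carrier (saturation M). \<psi> z = \<phi> z))"
proof -
  interpret comm_monoid M by fact
  interpret G: comm_group "gp M" by (rule gp_comm_group) fact
  have T: "integral_monoid T" using assms(2) by (simp add: saturated_monoid_def)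
  have img: "\<Phi> ` carrier (saturation M) \<subseteq> gp_unit T ` carrier T"
    if \<Phi>: "\<Phi> \<in> mhom (gp M) (gp T)"
      "\<And>x. x \<in> carrier M \<Longrightarrow> \<Phi> (gp_unit M x) = gp_unit T (h x)" for \<Phi>
  proof clarify
    fix z assume "z \<in> carrier (saturation M)"
    then obtain n :: nat and a where z: "z \<in> carrier (gp M)" "n \<ge> 1" "a \<in> carrier M"
      "z [^]\<^bsub>gp M\<^esub> n = gp_unit M a" by (auto simp: saturation_def)
    have "\<Phi> z [^]\<^bsub>gp T\<^esub> n = gp_unit T (h a)"
      using mhom_pow[OF G.monoid_axioms \<Phi>(1) z(1), of n] \<Phi>(2)[OF z(3)] z(4) by simp
    then have "\<Phi> z [^]\<^bsub>gp T\<^esub> n \<in> gp_unit T ` carrier T"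
      using mhomD(1)[OF assms(3) z(3)] by simp
    then show "\<Phi> z \<in> gp_unit T ` carrier T"
      using assms(2)[unfolded saturated_monoid_def, THEN conjunct2, rule_format,
          OF mhomD(1)[OF \<Phi>(1) z(1)] z(2)] by blast
  qed
  show ?thesis
    using gp_sub_universal[OF assms(1) saturation_sub[OF assms(1)] saturation_sup[OF assms(1)]
        saturation_mult_closed[OF assms(1)] T assms(3) img]
    unfolding saturation_eq[symmetric] by blast
qed

end

theory Submission
  imports Defs Complex_Main "HOL-Library.Function_Algebras" "HOL-Algebra.FiniteProduct"
begin

text \<open>
  The proof rests on two properties of \<open>V\<close>: of two elements one divides the other, and every
  element has roots of every order. Monoids are multiplicative here, and \<open>\<theta> m\<close> stands for the
  monomial with exponent vector \<open>m\<close> in finitely many chosen elements of \<open>P\<close>.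

  \<^emph>\<open>The map is saturated.\<close> In the group completion of the pushout of \<open>u : V \<rightarrow> A\<close> and
  \<open>f : V \<rightarrow> P\<close>, two pairs \<open>(a, p)\<close> and \<open>(b, q)\<close> agree when \<open>a u(v) = b u(w)\<close> and
  \<open>p f(w) = q f(v)\<close> for some \<open>v, w\<close> in \<open>V\<close>. One of \<open>v, w\<close> divides the other, so after cancelling
  only one element of \<open>V\<close> is left, and moving it across the pushout identifies the two pairs
  there already (\<open>pushout_congruence\<close>): the pushout is integral. Given an equation between
  \<open>n\<close>-th powers, write \<open>v\<close> and \<open>w\<close> as \<open>n\<close>-th powers; the equation splits into one in \<open>A\<close> and
  one in \<open>P\<close>, whose roots exist because \<open>A\<close> and \<open>P\<close> are saturated (\<open>pushout_saturated\<close>).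

  \<^emph>\<open>The target is finitely generated.\<close> Let \<open>W\<close> be the part of \<open>P\<close> lying in the group generated
  by \<open>f(V)\<close>. It arises from \<open>f(V)\<close> by adjoining a single inverse (\<open>base_part_generated\<close>). Over \<open>W\<close>
  the argument is that of Gordan's lemma with Caratheodory's theorem. Some power of \<open>p\<close> is
  \<open>w \<theta> m\<close>; if the support of \<open>m\<close> is as small as possible, the generators involved are independent
  modulo \<open>W\<close>, since a dependency could be subtracted until an exponent vanishes, total
  comparability in \<open>W\<close> telling in which direction to subtract (\<open>independent_representation\<close>).
  Splitting off integer parts of the exponents and a root of \<open>w\<close> leaves elements with fractional
  exponents below one. These fall into finitely many classes modulo \<open>W\<close>
  (\<open>box_finite_mod_sim\<close>), and independence together with saturation makes each class cyclic over
  \<open>W\<close> (\<open>box_unique\<close>).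

  \<^emph>\<open>Finite generation implies finite presentation.\<close> Let \<open>P\<close> be generated over \<open>V\<close> by the
  monomials \<open>\<theta> m\<close>. The pairs \<open>(m, n)\<close> for which some relation \<open>f(v) \<theta>(m) = f(w) \<theta>(n)\<close> holds are
  closed under subtraction, so by Dickson's lemma finitely many of them generate the others. For
  each of these choose a relation with \<open>v = 1\<close> or \<open>w = 1\<close>. Then every relation follows from a chosen
  one and a shorter one, down to the relations between elements of \<open>V\<close> alone
  (\<open>fin_pres_of_generators\<close>). The latter form a finitely generated congruence because they come
  from products of the finitely many relations of the given presentation, where Dickson's lemma
  applies to the exponents (\<open>kernel_finitely_generated\<close>).
\<close>

section \<open>Exponent vectors and Dickson's lemma\<close>

lemma free_cmonoid_simps [simp]:
  "m \<in> carrier (free_cmonoid r) \<longleftrightarrow> (\<forall>i\<ge>r. m i = 0)"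
  "m \<otimes>\<^bsub>free_cmonoid r\<^esub> n = m + n"
  "\<one>\<^bsub>free_cmonoid r\<^esub> = 0"
  by (auto simp: free_cmonoid_def plus_fun_def zero_fun_def)

lemma free_cmonoid_comm_monoid: "comm_monoid (free_cmonoid r)"
  by (rule comm_monoidI) (auto simp: add_ac)

lemma nondecreasing_subseq_nat:
  fixes f :: "nat \<Rightarrow> nat"
  shows "\<exists>g :: nat \<Rightarrow> nat. strict_mono g \<and> mono (\<lambda>k. f (g k))"
proof -
  obtain g :: "nat \<Rightarrow> nat" where g: "strict_mono g" "monoseq (\<lambda>n. f (g n))"
    using seq_monosub[of f] by blast
  show ?thesis
  proof (cases "mono (\<lambda>n. f (g n))")
    case False
    then have dec: "f (g n) \<le> f (g m)" if "m \<le> n" for m n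
      using g(2) that by (auto simp: monoseq_def mono_def)
    obtain N where N: "\<And>n. f (g N) \<le> f (g n)"
      using ex_has_least_nat[of "\<lambda>_. True" 0 "\<lambda>n. f (g n)"] by auto
    have "f (g (N + n)) = f (g N)" for n
      using N[of "N + n"] dec[of N "N + n"] by simp
    moreover have "strict_mono (\<lambda>n. g (N + n))"
      using g(1) by (auto simp: strict_mono_def)
    ultimately show ?thesis by (intro exI[of _ "\<lambda>n. g (N + n)"]) (auto simp: mono_def)
  qed (use g in blast)
qed

lemma nondecreasing_subseq:
  fixes f :: "nat \<Rightarrow> nat \<Rightarrow> nat"
  shows "\<exists>g :: nat \<Rightarrow> nat. strict_mono g \<and> (\<forall>i<r. mono (\<lambda>k. f (g k) i))"
proof (induction r)
  case 0
  show ?case by (auto intro: exI[of _ id] simp: strict_mono_def)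
next
  case (Suc r)
  then obtain g :: "nat \<Rightarrow> nat" where g: "strict_mono g" "\<forall>i<r. mono (\<lambda>k. f (g k) i)" by blast
  obtain h :: "nat \<Rightarrow> nat" where h: "strict_mono h" "mono (\<lambda>k. f (g (h k)) r)"
    using nondecreasing_subseq_nat[of "\<lambda>k. f (g k) r"] by blast
  have "mono (\<lambda>k. f (g (h k)) i)" if "i < Suc r" for i
    using that g(2) h by (cases "i = r") (auto simp: mono_def strict_mono_less_eq)
  moreover have "strict_mono (\<lambda>k. g (h k))" using g h by (auto simp: strict_mono_def)
  ultimately show ?case by (intro exI[of _ "\<lambda>k. g (h k)"]) auto
qed

text \<open>
  The minimal elements of \<open>A\<close> are pairwise incomparable. An infinite sequence of them would have a
  subsequence that is nondecreasing in every coordinate, so they are finitely many.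
\<close>

lemma Dickson:
  assumes "A \<subseteq> carrier (free_cmonoid r)"
  obtains G where "G \<subseteq> A" "finite G" "\<And>a. a \<in> A \<Longrightarrow> \<exists>g\<in>G. g \<le> a"
proof
  let ?G = "{g \<in> A. \<forall>a\<in>A. a \<le> g \<longrightarrow> a = g}"
  have zero: "a i = 0" if "a \<in> A" "i \<ge> r" for a i using assms that by auto
  show "?G \<subseteq> A" by blast
  show "finite ?G"
  proof (rule ccontr)
    assume "infinite ?G"
    then obtain f :: "nat \<Rightarrow> nat \<Rightarrow> nat" where f: "inj f" "range f \<subseteq> ?G"
      using infinite_countable_subset by blast
    obtain g :: "nat \<Rightarrow> nat" where g: "strict_mono g" "\<forall>i<r. mono (\<lambda>k. f (g k) i)"
      using nondecreasing_subseq by blast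
    have mem: "f k \<in> ?G" for k using f(2) by blast
    have "f (g 0) i \<le> f (g 1) i" for i
      using g(2) zero[of "f (g 0)" i] mem[of "g 0"] by (cases "i < r") (auto simp: mono_def)
    then have "f (g 0) = f (g 1)" using mem[of "g 0"] mem[of "g 1"] by (simp add: le_fun_def)
    then have "g 0 = g 1" using f(1) by (simp add: inj_eq)
    then show False using g(1) by (simp add: strict_mono_eq)
  qed
  show "\<exists>g\<in>?G. g \<le> a" if "a \<in> A" for a
    using that
  proof (induction "\<Sum>i<r. a i" arbitrary: a rule: less_induct)
    case less
    show ?case
    proof (cases "a \<in> ?G")
      case False
      then obtain b where b: "b \<in> A" "b \<le> a" "b \<noteq> a" using less.prems by blast
      then obtain i where "b i \<noteq> a i" by blast
      then have "b i < a i" using b(2) by (simp add: le_fun_def order_less_le)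
      moreover from this have "i < r" using zero[OF less.prems, of i] by (cases "i < r") auto
      ultimately have "(\<Sum>i<r. b i) < (\<Sum>i<r. a i)"
        using b(2) by (intro sum_strict_mono_ex1) (auto simp: le_fun_def)
      then show ?thesis using less.hyps[OF _ b(1)] b(2) by (meson order_trans)
    qed auto
  qed
qed

lemma Dickson_pairs:
  assumes "A \<subseteq> carrier (free_cmonoid r) \<times> carrier (free_cmonoid r)"
  obtains G where "G \<subseteq> A" "finite G" "\<And>a b. (a, b) \<in> A \<Longrightarrow> \<exists>(c, d)\<in>G. c \<le> a \<and> d \<le> b"
proof -
  define e :: "(nat \<Rightarrow> nat) \<times> (nat \<Rightarrow> nat) \<Rightarrow> nat \<Rightarrow> nat"
    where "e = (\<lambda>(a, b) i. if i < r then a i else b (i - r))"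
  have "e ` A \<subseteq> carrier (free_cmonoid (r + r))" using assms by (auto simp: e_def)
  then obtain G where G: "G \<subseteq> e ` A" "finite G" "\<And>a. a \<in> e ` A \<Longrightarrow> \<exists>g\<in>G. g \<le> a"
    using Dickson by blast
  obtain G' where G': "G' \<subseteq> A" "finite G'" "G = e ` G'"
    using finite_subset_image[OF G(2,1)] by blast
  show ?thesis
  proof (rule that[OF G'(1,2)])
    fix a b assume ab: "(a, b) \<in> A"
    then obtain c d where cd: "(c, d) \<in> G'" "e (c, d) \<le> e (a, b)"
      using G(3)[of "e (a, b)"] G'(3) by auto
    have "c i \<le> a i" for i
      using le_funD[OF cd(2), of i] cd(1) G'(1) assms by (cases "i < r") (auto simp: e_def)
    moreover have "d i \<le> b i" for i using le_funD[OF cd(2), of "r + i"] by (auto simp: e_def)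
    ultimately show "\<exists>(c, d)\<in>G'. c \<le> a \<and> d \<le> b" using cd(1) by (auto simp: le_fun_def)
  qed
qed

text \<open>
  A relation between monomials is recorded by the pair of its exponent vectors. In a cancellative
  monoid one valid relation may be divided by another; this is the closure property below, and it
  is what makes such sets of pairs finitely generated.
\<close>

definition subtractive :: "nat \<Rightarrow> ((nat \<Rightarrow> nat) \<times> (nat \<Rightarrow> nat)) set \<Rightarrow> bool" where
  "subtractive r L \<longleftrightarrow> L \<subseteq> carrier (free_cmonoid r) \<times> carrier (free_cmonoid r) \<and>
     (\<forall>(a, b)\<in>L. \<forall>(c, d)\<in>L. c \<le> a \<longrightarrow> d \<le> b \<longrightarrow> (a - c, b - d) \<in> L)"

text \<open>
  The zero pair is left out so that subtracting an element of the basis makes a pair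
  strictly shorter.
\<close>

definition divisor_basis ::
    "((nat \<Rightarrow> nat) \<times> (nat \<Rightarrow> nat)) set \<Rightarrow> ((nat \<Rightarrow> nat) \<times> (nat \<Rightarrow> nat)) set \<Rightarrow> bool" where
  "divisor_basis L G \<longleftrightarrow> finite G \<and> G \<subseteq> L - {(0, 0)} \<and>
     (\<forall>(a, b)\<in>L - {(0, 0)}. \<exists>(c, d)\<in>G. c \<le> a \<and> d \<le> b)"

lemma divisor_basis_exists:
  assumes "L \<subseteq> carrier (free_cmonoid r) \<times> carrier (free_cmonoid r)"
  obtains G where "divisor_basis L G"
proof -
  have "L - {(0, 0)} \<subseteq> carrier (free_cmonoid r) \<times> carrier (free_cmonoid r)" using assms by blast
  then show ?thesis
  proof (rule Dickson_pairs)
    fix G assume "G \<subseteq> L - {(0, 0)}" "finite G"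
      "\<And>a b. (a, b) \<in> L - {(0, 0)} \<Longrightarrow> \<exists>(c, d)\<in>G. c \<le> a \<and> d \<le> b"
    then have "divisor_basis L G" unfolding divisor_basis_def by auto
    then show ?thesis by (rule that)
  qed
qed

text \<open>
  Every pair of \<open>L\<close> is a sum of elements of \<open>G\<close> whose partial sums also lie in \<open>L\<close>: subtract
  basis elements until nothing is left. The finiteness statements below rest on inductions along
  such decompositions.
\<close>

lemma subtractive_induct [consumes 3, case_names zero add]:
  assumes L: "subtractive r L" and G: "divisor_basis L G" and "(a, b) \<in> L"
    and Q0: "Q 0 0"
    and QS: "\<And>a b c d. \<lbrakk>(a, b) \<in> L; (c, d) \<in> G; (c, d) \<in> L; Q a b\<rbrakk> \<Longrightarrow> Q (a + c) (b + d)"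
  shows "Q a b"
  using assms(3)
proof (induction "\<Sum>i<r. a i + b i" arbitrary: a b rule: less_induct)
  case less
  show ?case
  proof (cases "(a, b) = (0, 0)")
    case False
    then obtain c d where cd: "(c, d) \<in> G" "c \<le> a" "d \<le> b"
      using G less.prems unfolding divisor_basis_def by blast
    have le: "c i \<le> a i" "d i \<le> b i" for i using cd(2,3) by (auto simp: le_fun_def)
    have cdL: "(c, d) \<in> L" "(c, d) \<noteq> (0, 0)" using cd(1) G by (auto simp: divisor_basis_def)
    then obtain i where i: "c i + d i \<noteq> 0" by (fastforce simp: fun_eq_iff)
    have "i < r"
      using i cdL(1) L by (cases "i < r") (auto simp: subtractive_def)
    moreover have "(a i - c i) + (b i - d i) < a i + b i" using i le[of i] by linarith
    moreover have "(a j - c j) + (b j - d j) \<le> a j + b j" for j by linarith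
    ultimately have "(\<Sum>i<r. (a - c) i + (b - d) i) < (\<Sum>i<r. a i + b i)"
      by (intro sum_strict_mono_ex1) auto
    moreover have L': "(a - c, b - d) \<in> L"
      using L less.prems cdL cd unfolding subtractive_def by blast
    ultimately have "Q (a - c) (b - d)" by (rule less.hyps)
    with L' have "Q (a - c + c) (b - d + d)" by (intro QS cd cdL)
    moreover have "a - c + c = a" "b - d + d = b" using le by (auto simp: fun_eq_iff)
    ultimately show ?thesis by simp
  qed (use Q0 in simp)
qed

lemma free_lift:
  assumes "comm_monoid M" "\<And>i. i < r \<Longrightarrow> t i \<in> carrier M"
  obtains \<theta> where "\<theta> \<in> mhom (free_cmonoid r) M"
    "\<And>i. i < r \<Longrightarrow> \<theta> (\<lambda>j. if j = i then 1 else 0) = t i"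
proof -
  interpret comm_monoid M by fact
  define \<theta> where "\<theta> = (\<lambda>m. \<Otimes>\<^bsub>M\<^esub>i\<in>{..<r}. t i [^]\<^bsub>M\<^esub> (m i :: nat))"
  have "\<theta> \<in> mhom (free_cmonoid r) M"
  proof (rule mhomI)
    show "\<theta> m \<in> carrier M" for m using assms(2) by (auto simp: \<theta>_def intro!: finprod_closed)
    have "\<theta> (m + n) = (\<Otimes>\<^bsub>M\<^esub>i\<in>{..<r}. t i [^]\<^bsub>M\<^esub> m i \<otimes>\<^bsub>M\<^esub> t i [^]\<^bsub>M\<^esub> n i)" for m n
      unfolding \<theta>_def by (rule finprod_cong') (use assms(2) in \<open>auto simp: nat_pow_mult\<close>)
    then show "\<theta> (m \<otimes>\<^bsub>free_cmonoid r\<^esub> n) = \<theta> m \<otimes>\<^bsub>M\<^esub> \<theta> n" for m n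
      using assms(2) by (simp add: \<theta>_def Pi_iff)
    show "\<theta> \<one>\<^bsub>free_cmonoid r\<^esub> = \<one>\<^bsub>M\<^esub>" by (auto simp: \<theta>_def intro!: finprod_one_eqI)
  qed
  moreover have "\<theta> (\<lambda>j. if j = i then 1 else 0) = t i" if "i < r" for i
  proof -
    have "\<theta> (\<lambda>j. if j = i then 1 else 0) = (\<Otimes>\<^bsub>M\<^esub>j\<in>{..<r}. if i = j then t j else \<one>\<^bsub>M\<^esub>)"
      unfolding \<theta>_def by (rule finprod_cong') (use assms(2) in auto)
    also have "\<dots> = t i" using that assms(2) by (intro finprod_singleton) auto
    finally show ?thesis .
  qed
  ultimately show ?thesis using that by blast
qed


section \<open>Elementwise forms of the hypotheses\<close>

lemma swap_middle:
  assumes "comm_monoid M" "a \<in> carrier M" "b \<in> carrier M" "c \<in> carrier M" "d \<in> carrier M"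
  shows "a \<otimes>\<^bsub>M\<^esub> b \<otimes>\<^bsub>M\<^esub> (c \<otimes>\<^bsub>M\<^esub> d) = a \<otimes>\<^bsub>M\<^esub> c \<otimes>\<^bsub>M\<^esub> (b \<otimes>\<^bsub>M\<^esub> d)"
proof -
  interpret comm_monoid M by fact
  show ?thesis using assms(2-) by (simp add: m_ac)
qed

lemma integral_monoid_comm: "integral_monoid M \<Longrightarrow> comm_monoid M"
  by (simp add: integral_monoid_def)

lemma integral_monoid_cancel:
  "\<lbrakk>integral_monoid M; a \<in> carrier M; b \<in> carrier M; k \<in> carrier M; a \<otimes>\<^bsub>M\<^esub> k = b \<otimes>\<^bsub>M\<^esub> k\<rbrakk> \<Longrightarrow> a = b"
  using integral_monoid_iff[OF integral_monoid_comm] by blast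

lemma saturated_monoid_root:
  assumes "saturated_monoid M" "a \<in> carrier M" "b \<in> carrier M" "c \<in> carrier M" "n \<ge> 1"
    "a [^]\<^bsub>M\<^esub> (n::nat) = c \<otimes>\<^bsub>M\<^esub> b [^]\<^bsub>M\<^esub> n"
  shows "\<exists>d \<in> carrier M. a = d \<otimes>\<^bsub>M\<^esub> b"
proof -
  have "comm_monoid M" using assms(1) by (simp add: saturated_monoid_def integral_monoid_def)
  from saturated_monoid_iff[OF this] show ?thesis using assms by blast
qed

lemma valuative_total:
  assumes "valuative V" "a \<in> carrier V" "b \<in> carrier V"
  obtains c where "c \<in> carrier V" "a = b \<otimes>\<^bsub>V\<^esub> c" | c where "c \<in> carrier V" "b = a \<otimes>\<^bsub>V\<^esub> c"
proof -
  have int: "integral_monoid V" using assms(1) by (simp add: valuative_def)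
  then have cV: "comm_monoid V" and inj: "inj_on (gp_unit V) (carrier V)"
    by (auto simp: integral_monoid_def)
  interpret V: comm_monoid V by fact
  interpret G: comm_group "gp V" by (rule gp_comm_group[OF cV])
  note u = gp_unit_mhom[OF cV]
  let ?x = "gp_unit V a \<otimes>\<^bsub>gp V\<^esub> inv\<^bsub>gp V\<^esub> gp_unit V b"
  have uc [simp]: "gp_unit V y \<in> carrier (gp V)" if "y \<in> carrier V" for y
    using mhomD(1)[OF u that] .
  have x: "?x \<in> carrier (gp V)" using assms by simp
  have recover: "s = t \<otimes>\<^bsub>gp V\<^esub> (s \<otimes>\<^bsub>gp V\<^esub> inv\<^bsub>gp V\<^esub> t)"
    if "s \<in> carrier (gp V)" "t \<in> carrier (gp V)" for s t
    using that by (simp add: G.m_comm[of t] G.m_assoc)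
  consider c where "c \<in> carrier V" "?x = gp_unit V c"
    | c where "c \<in> carrier V" "inv\<^bsub>gp V\<^esub> ?x = gp_unit V c"
    using assms(1) x unfolding valuative_def by blast
  then show ?thesis
  proof cases
    case (1 c)
    have "gp_unit V a = gp_unit V b \<otimes>\<^bsub>gp V\<^esub> ?x"
      using assms recover by simp
    then have "gp_unit V a = gp_unit V (b \<otimes>\<^bsub>V\<^esub> c)"
      using 1 assms by (simp add: mhomD(2)[OF u])
    then have "a = b \<otimes>\<^bsub>V\<^esub> c" using inj 1 assms by (simp add: inj_on_eq_iff)
    with 1 that show ?thesis by blast
  next
    case (2 c)
    have "inv\<^bsub>gp V\<^esub> ?x = gp_unit V b \<otimes>\<^bsub>gp V\<^esub> inv\<^bsub>gp V\<^esub> gp_unit V a"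
      using assms by (simp add: G.inv_mult G.m_comm)
    then have "gp_unit V b = gp_unit V a \<otimes>\<^bsub>gp V\<^esub> inv\<^bsub>gp V\<^esub> ?x"
      using assms recover by simp
    then have "gp_unit V b = gp_unit V (a \<otimes>\<^bsub>V\<^esub> c)"
      using 2 assms by (simp add: mhomD(2)[OF u])
    then have "b = a \<otimes>\<^bsub>V\<^esub> c" using inj 2 assms by (simp add: inj_on_eq_iff)
    with 2 that show ?thesis by blast
  qed
qed

lemma divisible_root:
  assumes "divisible_monoid V" "v \<in> carrier V" "n \<ge> 1"
  obtains w where "w \<in> carrier V" "v = w [^]\<^bsub>V\<^esub> (n::nat)"
  using assms unfolding divisible_monoid_def by (metis (no_types, lifting) imageE)

lemma gp_unit_iso_integralisation:
  assumes "integral_monoid M"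
  shows "gp_unit M \<in> iso M (integralisation M)"
proof -
  have "gp_unit M \<in> mhom M (integralisation M)"
    using integralisation_unit[OF integral_monoid_comm[OF assms]] .
  then show ?thesis using assms
    by (auto simp: iso_def mhom_def bij_betw_def integralisation_def integral_monoid_def)
qed

lemma gp_unit_iso_saturation:
  assumes "saturated_monoid M"
  shows "gp_unit M \<in> iso M (saturation M)"
proof -
  have int: "integral_monoid M" using assms by (simp add: saturated_monoid_def)
  then have cM: "comm_monoid M" by (rule integral_monoid_comm)
  have "carrier (saturation M) \<subseteq> gp_unit M ` carrier M"
    using assms by (auto simp: saturated_monoid_def saturation_def)
  then have "carrier (saturation M) = gp_unit M ` carrier M"
    using saturation_sup[OF cM] by blast
  then show ?thesis using saturation_unit[OF cM] int
    by (auto simp: iso_def mhom_def bij_betw_def integral_monoid_def)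
qed

section \<open>Pushouts along a valuative monoid\<close>

context
  fixes V :: "'v monoid" and A :: "'a monoid" and P :: "'p monoid" and u f
  assumes V: "valuative V" and A: "integral_monoid A" and P: "integral_monoid P"
    and u: "u \<in> mhom V A" and f: "f \<in> mhom V P"
begin

private abbreviation (input) "gens \<equiv> {((u v, \<one>\<^bsub>P\<^esub>), (\<one>\<^bsub>A\<^esub>, f v)) | v. v \<in> carrier V}"
private abbreviation (input) "C \<equiv> mcong_gen (A \<times>\<times> P) gens"

interpretation V: comm_monoid V using V by (simp add: valuative_def integral_monoid_def)
interpretation A: comm_monoid A using A by (rule integral_monoid_comm)
interpretation P: comm_monoid P using P by (rule integral_monoid_comm)
interpretation AP: comm_monoid "A \<times>\<times> P"
  by (rule comm_monoid_DirProd) (rule A.comm_monoid_axioms P.comm_monoid_axioms)+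

text \<open>
  Equality in the pushout of the group completions, written without inverses: \<open>a / b = u (w / v)\<close>
  and \<open>p / q = f (v / w)\<close>.
\<close>

definition pushout_rel :: "(('a \<times> 'p) \<times> ('a \<times> 'p)) set" where
  "pushout_rel = {((a, p), (b, q)). a \<in> carrier A \<and> b \<in> carrier A \<and> p \<in> carrier P \<and> q \<in> carrier P \<and>
     (\<exists>v\<in>carrier V. \<exists>w\<in>carrier V. a \<otimes>\<^bsub>A\<^esub> u v = b \<otimes>\<^bsub>A\<^esub> u w \<and> p \<otimes>\<^bsub>P\<^esub> f w = q \<otimes>\<^bsub>P\<^esub> f v)}"

private lemma closed [simp]:
  "v \<in> carrier V \<Longrightarrow> u v \<in> carrier A" "v \<in> carrier V \<Longrightarrow> f v \<in> carrier P"
  using mhomD(1)[OF u] mhomD(1)[OF f] by auto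

private lemma pushout_relI:
  "\<lbrakk>a \<in> carrier A; b \<in> carrier A; p \<in> carrier P; q \<in> carrier P; v \<in> carrier V; w \<in> carrier V;
    a \<otimes>\<^bsub>A\<^esub> u v = b \<otimes>\<^bsub>A\<^esub> u w; p \<otimes>\<^bsub>P\<^esub> f w = q \<otimes>\<^bsub>P\<^esub> f v\<rbrakk> \<Longrightarrow> ((a, p), (b, q)) \<in> pushout_rel"
  unfolding pushout_rel_def by blast

private lemma pushout_rel_mult:
  assumes "(x, y) \<in> pushout_rel" "(x', y') \<in> pushout_rel"
  shows "(x \<otimes>\<^bsub>A \<times>\<times> P\<^esub> x', y \<otimes>\<^bsub>A \<times>\<times> P\<^esub> y') \<in> pushout_rel"
proof -
  obtain a p b q v w a' p' b' q' v' w' where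
    e: "x = (a, p)" "y = (b, q)" "x' = (a', p')" "y' = (b', q')"
    and [simp]: "a \<in> carrier A" "b \<in> carrier A" "p \<in> carrier P" "q \<in> carrier P"
      "a' \<in> carrier A" "b' \<in> carrier A" "p' \<in> carrier P" "q' \<in> carrier P"
      "v \<in> carrier V" "w \<in> carrier V" "v' \<in> carrier V" "w' \<in> carrier V"
    and r: "a \<otimes>\<^bsub>A\<^esub> u v = b \<otimes>\<^bsub>A\<^esub> u w" "p \<otimes>\<^bsub>P\<^esub> f w = q \<otimes>\<^bsub>P\<^esub> f v"
      "a' \<otimes>\<^bsub>A\<^esub> u v' = b' \<otimes>\<^bsub>A\<^esub> u w'" "p' \<otimes>\<^bsub>P\<^esub> f w' = q' \<otimes>\<^bsub>P\<^esub> f v'"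
    using assms by (fastforce simp: pushout_rel_def)
  have "a \<otimes>\<^bsub>A\<^esub> a' \<otimes>\<^bsub>A\<^esub> u (v \<otimes>\<^bsub>V\<^esub> v') = b \<otimes>\<^bsub>A\<^esub> b' \<otimes>\<^bsub>A\<^esub> u (w \<otimes>\<^bsub>V\<^esub> w')"
    using r(1,3) swap_middle[OF A.comm_monoid_axioms, of a a' "u v" "u v'"]
      swap_middle[OF A.comm_monoid_axioms, of b b' "u w" "u w'"]
    by (simp add: mhomD(2)[OF u])
  moreover have "p \<otimes>\<^bsub>P\<^esub> p' \<otimes>\<^bsub>P\<^esub> f (w \<otimes>\<^bsub>V\<^esub> w') = q \<otimes>\<^bsub>P\<^esub> q' \<otimes>\<^bsub>P\<^esub> f (v \<otimes>\<^bsub>V\<^esub> v')"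
    using r(2,4) swap_middle[OF P.comm_monoid_axioms, of p p' "f w" "f w'"]
      swap_middle[OF P.comm_monoid_axioms, of q q' "f v" "f v'"]
    by (simp add: mhomD(2)[OF f])
  ultimately show ?thesis unfolding e mult_DirProd by (intro pushout_relI) simp_all
qed

private lemma pushout_rel_cancel:
  assumes "(x \<otimes>\<^bsub>A \<times>\<times> P\<^esub> z, y \<otimes>\<^bsub>A \<times>\<times> P\<^esub> z) \<in> pushout_rel"
    and "x \<in> carrier (A \<times>\<times> P)" "y \<in> carrier (A \<times>\<times> P)" "z \<in> carrier (A \<times>\<times> P)"
  shows "(x, y) \<in> pushout_rel"
proof -
  obtain a p b q c s where e: "x = (a, p)" "y = (b, q)" "z = (c, s)" by (metis surj_pair)
  have [simp]: "a \<in> carrier A" "b \<in> carrier A" "p \<in> carrier P" "q \<in> carrier P"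
      "c \<in> carrier A" "s \<in> carrier P"
    using assms(2-4) e by auto
  obtain v w where [simp]: "v \<in> carrier V" "w \<in> carrier V"
    and r: "a \<otimes>\<^bsub>A\<^esub> c \<otimes>\<^bsub>A\<^esub> u v = b \<otimes>\<^bsub>A\<^esub> c \<otimes>\<^bsub>A\<^esub> u w" "p \<otimes>\<^bsub>P\<^esub> s \<otimes>\<^bsub>P\<^esub> f w = q \<otimes>\<^bsub>P\<^esub> s \<otimes>\<^bsub>P\<^esub> f v"
    using assms(1) e by (auto simp: pushout_rel_def)
  have "a \<otimes>\<^bsub>A\<^esub> u v = b \<otimes>\<^bsub>A\<^esub> u w"
    by (rule integral_monoid_cancel[OF A, where k = c]) (use r(1) in \<open>simp_all add: A.m_ac\<close>)
  moreover have "p \<otimes>\<^bsub>P\<^esub> f w = q \<otimes>\<^bsub>P\<^esub> f v"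
    by (rule integral_monoid_cancel[OF P, where k = s]) (use r(2) in \<open>simp_all add: P.m_ac\<close>)
  ultimately show ?thesis unfolding e by (intro pushout_relI[of _ _ _ _ v w]) simp_all
qed

text \<open>
  Transitivity comes for free from multiplicativity and cancellation: multiply \<open>x \<sim> y\<close> with
  \<open>y \<sim> z\<close> and cancel \<open>y\<close>.
\<close>

private lemma pushout_rel_mcong: "mcong (A \<times>\<times> P) pushout_rel"
proof -
  have refl: "(x, x) \<in> pushout_rel" if "x \<in> carrier (A \<times>\<times> P)" for x
    using that V.one_closed by (cases x) (auto simp: pushout_rel_def intro!: bexI[of _ "\<one>\<^bsub>V\<^esub>"])
  have sub: "pushout_rel \<subseteq> carrier (A \<times>\<times> P) \<times> carrier (A \<times>\<times> P)"
    by (auto simp: pushout_rel_def)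
  have sym: "sym pushout_rel"
    by (auto simp: pushout_rel_def sym_def) metis
  have "(x, z) \<in> pushout_rel" if "(x, y) \<in> pushout_rel" "(y, z) \<in> pushout_rel" for x y z
  proof (rule pushout_rel_cancel)
    have [simp]: "x \<in> carrier (A \<times>\<times> P)" "y \<in> carrier (A \<times>\<times> P)" "z \<in> carrier (A \<times>\<times> P)"
      using that sub by blast+
    show "x \<in> carrier (A \<times>\<times> P)" "z \<in> carrier (A \<times>\<times> P)" "y \<in> carrier (A \<times>\<times> P)" by fact+
    have "(x \<otimes>\<^bsub>A \<times>\<times> P\<^esub> y, y \<otimes>\<^bsub>A \<times>\<times> P\<^esub> z) \<in> pushout_rel" by (rule pushout_rel_mult[OF that])
    then show "(x \<otimes>\<^bsub>A \<times>\<times> P\<^esub> y, z \<otimes>\<^bsub>A \<times>\<times> P\<^esub> y) \<in> pushout_rel" by (simp only: AP.m_comm[of y z] \<open>y \<in> _\<close> \<open>z \<in> _\<close>)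
  qed
  then have "trans pushout_rel" by (rule transI)
  with refl sub sym have "equiv (carrier (A \<times>\<times> P)) pushout_rel"
    by (auto intro!: equivI simp: refl_on_def)
  then show ?thesis unfolding mcong_def using pushout_rel_mult by auto
qed

text \<open>
  This is where valuativity enters. Since \<open>v\<close> divides \<open>w\<close> or conversely, the two equations defining
  \<open>pushout_rel\<close> reduce to \<open>b = a u(x)\<close> and \<open>p = q f(x)\<close> for a single \<open>x\<close>, or to the same with the two
  pairs exchanged, and this is one application of the defining relation of the pushout.
\<close>

lemma pushout_congruence: "C = pushout_rel"
proof
  have "((u v, \<one>\<^bsub>P\<^esub>), (\<one>\<^bsub>A\<^esub>, f v)) \<in> pushout_rel" if "v \<in> carrier V" for v
    using that by (intro pushout_relI[of _ _ _ _ "\<one>\<^bsub>V\<^esub>" v]) (simp_all add: mhomD(3)[OF u] mhomD(3)[OF f])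
  then show "C \<subseteq> pushout_rel"
    by (intro mcong_gen_least[OF pushout_rel_mcong]) auto
next
  have gens: "gens \<subseteq> carrier (A \<times>\<times> P) \<times> carrier (A \<times>\<times> P)" by auto
  have C: "mcong (A \<times>\<times> P) C" by (rule mcong_gen_mcong[OF AP.monoid_axioms gens])
  then have equivC: "equiv (carrier (A \<times>\<times> P)) C" by (simp add: mcong_def)
  have key: "((a \<otimes>\<^bsub>A\<^esub> u v, p), (a, p \<otimes>\<^bsub>P\<^esub> f v)) \<in> C"
    if [simp]: "a \<in> carrier A" "p \<in> carrier P" "v \<in> carrier V" for a p v
  proof -
    have "((a, p), (a, p)) \<in> C" using equivC by (auto simp: equiv_def refl_on_def)
    moreover have "((u v, \<one>\<^bsub>P\<^esub>), (\<one>\<^bsub>A\<^esub>, f v)) \<in> C"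
      using mcong_gen_incl[of gens] that by blast
    ultimately show ?thesis using mcong_mult[OF C] by fastforce
  qed
  show "pushout_rel \<subseteq> C"
  proof clarify
    fix a p b q assume "((a, p), (b, q)) \<in> pushout_rel"
    then obtain v w where [simp]: "a \<in> carrier A" "b \<in> carrier A" "p \<in> carrier P" "q \<in> carrier P"
      "v \<in> carrier V" "w \<in> carrier V"
      and r: "a \<otimes>\<^bsub>A\<^esub> u v = b \<otimes>\<^bsub>A\<^esub> u w" "p \<otimes>\<^bsub>P\<^esub> f w = q \<otimes>\<^bsub>P\<^esub> f v"
      by (auto simp: pushout_rel_def)
    consider x where "x \<in> carrier V" "v = w \<otimes>\<^bsub>V\<^esub> x" | x where "x \<in> carrier V" "w = v \<otimes>\<^bsub>V\<^esub> x"
      using valuative_total[OF V, of v w] by auto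
    then show "((a, p), (b, q)) \<in> C"
    proof cases
      case [simp]: (1 x)
      have "a \<otimes>\<^bsub>A\<^esub> u x = b"
        by (rule integral_monoid_cancel[OF A, where k = "u w"])
          (use r(1) in \<open>simp_all add: mhomD(2)[OF u] A.m_ac\<close>)
      moreover have "p = q \<otimes>\<^bsub>P\<^esub> f x"
        by (rule integral_monoid_cancel[OF P, where k = "f w"])
          (use r(2) in \<open>simp_all add: mhomD(2)[OF f] P.m_ac\<close>)
      ultimately have "((b, q), (a, p)) \<in> C" using key[of a q x] by simp
      then show ?thesis using equivC by (meson equivE symD)
    next
      case [simp]: (2 x)
      have "a = b \<otimes>\<^bsub>A\<^esub> u x"
        by (rule integral_monoid_cancel[OF A, where k = "u v"])
          (use r(1) in \<open>simp_all add: mhomD(2)[OF u] A.m_ac\<close>)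
      moreover have "p \<otimes>\<^bsub>P\<^esub> f x = q"
        by (rule integral_monoid_cancel[OF P, where k = "f v"])
          (use r(2) in \<open>simp_all add: mhomD(2)[OF f] P.m_ac\<close>)
      ultimately show ?thesis using key[of b p x] by simp
    qed
  qed
qed

private abbreviation (input) "cl \<equiv> \<lambda>x. pushout_rel `` {x}"

private lemma pushout_eq: "mpushout V A P u f = mquot (A \<times>\<times> P) pushout_rel"
  unfolding mpushout_def pushout_congruence ..

private lemma pushout_comm: "comm_monoid (mpushout V A P u f)"
  unfolding pushout_eq by (rule mquot_comm_monoid[OF AP.comm_monoid_axioms pushout_rel_mcong])

private lemma pushout_class_eq:
  assumes "x \<in> carrier (A \<times>\<times> P)" "y \<in> carrier (A \<times>\<times> P)"
  shows "cl x = cl y \<longleftrightarrow> (x, y) \<in> pushout_rel"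
  using pushout_rel_mcong assms unfolding mcong_def by (meson eq_equiv_class_iff)

lemma pushout_integral: "integral_monoid (mpushout V A P u f)"
  unfolding integral_monoid_iff[OF pushout_comm]
proof (intro ballI impI)
  fix X Y Z assume X: "X \<in> carrier (mpushout V A P u f)" and Y: "Y \<in> carrier (mpushout V A P u f)"
    and Z: "Z \<in> carrier (mpushout V A P u f)"
    and e: "X \<otimes>\<^bsub>mpushout V A P u f\<^esub> Z = Y \<otimes>\<^bsub>mpushout V A P u f\<^esub> Z"
  obtain x y z where x: "x \<in> carrier (A \<times>\<times> P)" "X = cl x" and y: "y \<in> carrier (A \<times>\<times> P)" "Y = cl y"
    and z: "z \<in> carrier (A \<times>\<times> P)" "Z = cl z"
    using X Y Z unfolding pushout_eq mquot_carrier by blast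
  have "cl (x \<otimes>\<^bsub>A \<times>\<times> P\<^esub> z) = cl (y \<otimes>\<^bsub>A \<times>\<times> P\<^esub> z)"
    using e unfolding pushout_eq x y z
    by (simp only: mquot_mult[OF pushout_rel_mcong] x(1) y(1) z(1))
  then have "(x \<otimes>\<^bsub>A \<times>\<times> P\<^esub> z, y \<otimes>\<^bsub>A \<times>\<times> P\<^esub> z) \<in> pushout_rel"
    using x(1) y(1) z(1) by (simp only: pushout_class_eq AP.m_closed)
  then have "(x, y) \<in> pushout_rel" by (rule pushout_rel_cancel[OF _ x(1) y(1) z(1)])
  then show "X = Y" unfolding x y using x(1) y(1) by (simp only: pushout_class_eq)
qed

private lemma pow_pair: "(a, p) [^]\<^bsub>A \<times>\<times> P\<^esub> (n::nat) = (a [^]\<^bsub>A\<^esub> n, p [^]\<^bsub>P\<^esub> n)"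
  by (induction n) simp_all

text \<open>
  The elements \<open>v, w\<close> that witness an equation between \<open>n\<close>-th powers are \<open>n\<close>-th powers themselves,
  because \<open>V\<close> is divisible. So each of the two coordinates is an equation between \<open>n\<close>-th powers, in \<open>A\<close>
  and in \<open>P\<close>, and saturation of these monoids extracts the root.
\<close>

lemma pushout_saturated:
  assumes div: "divisible_monoid V" and sA: "saturated_monoid A" and sP: "saturated_monoid P"
  shows "saturated_monoid (mpushout V A P u f)"
  unfolding saturated_monoid_iff[OF pushout_comm]
proof (intro conjI pushout_integral ballI allI impI)
  let ?M = "mpushout V A P u f"
  have proj: "cl \<in> mhom (A \<times>\<times> P) ?M" unfolding pushout_eq by (rule mquot_proj[OF pushout_rel_mcong])
  fix X Y Z and n :: nat
  assume X: "X \<in> carrier ?M" and Y: "Y \<in> carrier ?M" and Z: "Z \<in> carrier ?M" and n: "n \<ge> 1"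
    and e: "X [^]\<^bsub>?M\<^esub> n = Z \<otimes>\<^bsub>?M\<^esub> Y [^]\<^bsub>?M\<^esub> n"
  obtain x p y q z s where x: "X = cl (x, p)" and y: "Y = cl (y, q)" and z: "Z = cl (z, s)"
    and [simp]: "x \<in> carrier A" "p \<in> carrier P" "y \<in> carrier A" "q \<in> carrier P"
      "z \<in> carrier A" "s \<in> carrier P"
    using X Y Z unfolding pushout_eq mquot_carrier by auto
  have "X [^]\<^bsub>?M\<^esub> n = cl ((x, p) [^]\<^bsub>A \<times>\<times> P\<^esub> n)"
    unfolding x by (rule mhom_pow[OF AP.monoid_axioms proj, symmetric]) simp
  moreover have "Y [^]\<^bsub>?M\<^esub> n = cl ((y, q) [^]\<^bsub>A \<times>\<times> P\<^esub> n)"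
    unfolding y by (rule mhom_pow[OF AP.monoid_axioms proj, symmetric]) simp
  moreover have "Z \<otimes>\<^bsub>?M\<^esub> cl ((y, q) [^]\<^bsub>A \<times>\<times> P\<^esub> n) = cl ((z, s) \<otimes>\<^bsub>A \<times>\<times> P\<^esub> (y, q) [^]\<^bsub>A \<times>\<times> P\<^esub> n)"
    unfolding z by (rule mhomD(2)[OF proj, symmetric]) (simp_all add: pow_pair)
  ultimately have "cl (x [^]\<^bsub>A\<^esub> n, p [^]\<^bsub>P\<^esub> n) = cl (z \<otimes>\<^bsub>A\<^esub> y [^]\<^bsub>A\<^esub> n, s \<otimes>\<^bsub>P\<^esub> q [^]\<^bsub>P\<^esub> n)"
    using e by (simp add: pow_pair)
  then have "((x [^]\<^bsub>A\<^esub> n, p [^]\<^bsub>P\<^esub> n), (z \<otimes>\<^bsub>A\<^esub> y [^]\<^bsub>A\<^esub> n, s \<otimes>\<^bsub>P\<^esub> q [^]\<^bsub>P\<^esub> n)) \<in> pushout_rel"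
    by (subst pushout_class_eq[symmetric]) simp_all
  then obtain v w where "v \<in> carrier V" "w \<in> carrier V"
    and r: "x [^]\<^bsub>A\<^esub> n \<otimes>\<^bsub>A\<^esub> u v = z \<otimes>\<^bsub>A\<^esub> y [^]\<^bsub>A\<^esub> n \<otimes>\<^bsub>A\<^esub> u w"
      "p [^]\<^bsub>P\<^esub> n \<otimes>\<^bsub>P\<^esub> f w = s \<otimes>\<^bsub>P\<^esub> q [^]\<^bsub>P\<^esub> n \<otimes>\<^bsub>P\<^esub> f v"
    by (auto simp: pushout_rel_def)
  then obtain v' w' where [simp]: "v' \<in> carrier V" "w' \<in> carrier V"
    and vw: "v = v' [^]\<^bsub>V\<^esub> n" "w = w' [^]\<^bsub>V\<^esub> n"
    using divisible_root[OF div _ n] by metis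
  have uf: "u (v' [^]\<^bsub>V\<^esub> n) = u v' [^]\<^bsub>A\<^esub> n" "u (w' [^]\<^bsub>V\<^esub> n) = u w' [^]\<^bsub>A\<^esub> n"
    "f (v' [^]\<^bsub>V\<^esub> n) = f v' [^]\<^bsub>P\<^esub> n" "f (w' [^]\<^bsub>V\<^esub> n) = f w' [^]\<^bsub>P\<^esub> n"
    by (simp_all add: mhom_pow[OF V.monoid_axioms u] mhom_pow[OF V.monoid_axioms f])
  have "(x \<otimes>\<^bsub>A\<^esub> u v') [^]\<^bsub>A\<^esub> n = z \<otimes>\<^bsub>A\<^esub> (y \<otimes>\<^bsub>A\<^esub> u w') [^]\<^bsub>A\<^esub> n"
    using r(1) unfolding vw uf by (simp add: A.nat_pow_distrib A.m_assoc)
  then obtain d where d: "d \<in> carrier A" "x \<otimes>\<^bsub>A\<^esub> u v' = d \<otimes>\<^bsub>A\<^esub> (y \<otimes>\<^bsub>A\<^esub> u w')"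
    using saturated_monoid_root[OF sA _ _ _ n, of "x \<otimes>\<^bsub>A\<^esub> u v'" "y \<otimes>\<^bsub>A\<^esub> u w'" z] by auto
  have "(p \<otimes>\<^bsub>P\<^esub> f w') [^]\<^bsub>P\<^esub> n = s \<otimes>\<^bsub>P\<^esub> (q \<otimes>\<^bsub>P\<^esub> f v') [^]\<^bsub>P\<^esub> n"
    using r(2) unfolding vw uf by (simp add: P.nat_pow_distrib P.m_assoc)
  then obtain d' where d': "d' \<in> carrier P" "p \<otimes>\<^bsub>P\<^esub> f w' = d' \<otimes>\<^bsub>P\<^esub> (q \<otimes>\<^bsub>P\<^esub> f v')"
    using saturated_monoid_root[OF sP _ _ _ n, of "p \<otimes>\<^bsub>P\<^esub> f w'" "q \<otimes>\<^bsub>P\<^esub> f v'" s] by auto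
  have "((x, p), (d \<otimes>\<^bsub>A\<^esub> y, d' \<otimes>\<^bsub>P\<^esub> q)) \<in> pushout_rel"
    using d d' by (intro pushout_relI[of _ _ _ _ v' w']) (simp_all add: A.m_assoc P.m_assoc)
  then have "X = cl (d \<otimes>\<^bsub>A\<^esub> y, d' \<otimes>\<^bsub>P\<^esub> q)"
    unfolding x using d(1) d'(1) by (subst pushout_class_eq) auto
  also have "\<dots> = cl ((d, d') \<otimes>\<^bsub>A \<times>\<times> P\<^esub> (y, q))" by simp
  also have "\<dots> = cl (d, d') \<otimes>\<^bsub>?M\<^esub> Y"
    unfolding y by (rule mhomD(2)[OF proj]) (use d d' in auto)
  finally show "\<exists>D\<in>carrier ?M. X = D \<otimes>\<^bsub>?M\<^esub> Y"
    using mhomD(1)[OF proj, of "(d, d')"] d d' by auto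
qed

end

lemma valuative_source_saturated_hom:
  assumes V: "valuative V" "divisible_monoid V" and P: "saturated_monoid P" and f: "f \<in> mhom V P"
  shows "saturated_hom TYPE('c) V P f"
proof -
  have i: "integral_monoid V" "saturated_monoid V" "integral_monoid P"
    using assms by (auto simp: valuative_def saturated_monoid_def divisible_monoid_def)
  have "integral_hom TYPE('c) V P f"
    unfolding integral_hom_def
    using i f pushout_integral[OF V(1) _ i(3) _ f] by (blast intro: gp_unit_iso_integralisation)
  moreover have "gp_unit (mpushout V A P u f) \<in> iso (mpushout V A P u f) (saturation (mpushout V A P u f))"
    if A: "saturated_monoid A" and u: "u \<in> mhom V A" for A :: "'c monoid" and u
  proof (rule gp_unit_iso_saturation)
    have "integral_monoid A" using A by (simp add: saturated_monoid_def)
    then show "saturated_monoid (mpushout V A P u f)"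
      by (rule pushout_saturated[OF V(1) _ i(3) u f V(2) A P])
  qed
  ultimately show ?thesis
    unfolding saturated_hom_def using i P by blast
qed

section \<open>Finite generation over a divisible totally preordered submonoid\<close>

inductive_set mspan :: "('a, 'b) monoid_scheme \<Rightarrow> 'a set \<Rightarrow> 'a set" for M X where
  one: "\<one>\<^bsub>M\<^esub> \<in> mspan M X"
| gen: "x \<in> X \<Longrightarrow> x \<in> mspan M X"
| mult: "x \<in> mspan M X \<Longrightarrow> y \<in> mspan M X \<Longrightarrow> x \<otimes>\<^bsub>M\<^esub> y \<in> mspan M X"

lemma mspan_mono: "X \<subseteq> mspan M Y \<Longrightarrow> x \<in> mspan M X \<Longrightarrow> x \<in> mspan M Y"
  by (rotate_tac 1, induction rule: mspan.induct) (auto intro: mspan.intros)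

lemma mspan_pow: "x \<in> mspan M X \<Longrightarrow> x [^]\<^bsub>M\<^esub> (n::nat) \<in> mspan M X"
  by (induction n) (auto intro: mspan.intros)

lemma free_hom_image_fin_gen:
  assumes "comm_monoid M" "\<theta> \<in> mhom (free_cmonoid r) M"
  obtains T where "finite T" "T \<subseteq> carrier M" "\<And>m. m \<in> carrier (free_cmonoid r) \<Longrightarrow> \<theta> m \<in> mspan M T"
proof -
  interpret comm_monoid M by fact
  let ?L = "{(a, b). a \<in> carrier (free_cmonoid r) \<and> b = (0 :: nat \<Rightarrow> nat)}"
  have L: "subtractive r ?L" by (auto simp: subtractive_def)
  then obtain G where G: "divisor_basis ?L G"
    using divisor_basis_exists[of ?L r] unfolding subtractive_def by blast
  show ?thesis
  proof (rule that[of "(\<lambda>(a, b). \<theta> a) ` G"])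
    show "finite ((\<lambda>(a, b). \<theta> a) ` G)" using G by (simp add: divisor_basis_def)
    show "(\<lambda>(a, b). \<theta> a) ` G \<subseteq> carrier M"
      using G by (auto simp: divisor_basis_def intro!: mhomD(1)[OF assms(2)])
    fix m assume "m \<in> carrier (free_cmonoid r)"
    then have "(m, 0) \<in> ?L" by simp
    with L G show "\<theta> m \<in> mspan M ((\<lambda>(a, b). \<theta> a) ` G)"
    proof (induction rule: subtractive_induct)
      case zero
      show ?case using mhomD(3)[OF assms(2)] by (simp add: mspan.one zero_fun_def)
    next
      case (add a b c d)
      then have "\<theta> (a + c) = \<theta> a \<otimes>\<^bsub>M\<^esub> \<theta> c" using mhomD(2)[OF assms(2), of a c] by simp
      moreover have "\<theta> c \<in> mspan M ((\<lambda>(a, b). \<theta> a) ` G)"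
        using add by (intro mspan.gen) force
      ultimately show ?case using add by (simp add: mspan.mult plus_fun_def)
    qed
  qed
qed

text \<open>
  The abstract situation for the finite generation argument: a saturated monoid \<open>P\<close> with a divisible
  submonoid \<open>W\<close> that is totally preordered by divisibility and equals the intersection of \<open>P\<close> with
  the group generated by \<open>W\<close>. The last two assumptions say that \<open>P\<close> lies in the saturation and in
  the group completion of the submonoid generated by \<open>W\<close> and the monomials \<open>\<theta> m\<close>.
\<close>

locale saturated_over_total =
  comm_monoid P for P :: "'p monoid" (structure) +
  fixes W :: "'p set" and r :: nat and \<theta> :: "(nat \<Rightarrow> nat) \<Rightarrow> 'p"
  assumes cancel: "\<lbrakk>a \<in> carrier P; b \<in> carrier P; k \<in> carrier P; a \<otimes> k = b \<otimes> k\<rbrakk> \<Longrightarrow> a = b"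
    and root: "\<lbrakk>a \<in> carrier P; b \<in> carrier P; c \<in> carrier P; n \<ge> 1;
      a [^] (n::nat) = c \<otimes> b [^] n\<rbrakk> \<Longrightarrow> \<exists>d\<in>carrier P. a = d \<otimes> b"
    and W_sub: "w \<in> W \<Longrightarrow> w \<in> carrier P"
    and W_one: "\<one> \<in> W"
    and W_mult: "\<lbrakk>v \<in> W; w \<in> W\<rbrakk> \<Longrightarrow> v \<otimes> w \<in> W"
    and W_exact: "\<lbrakk>p \<in> carrier P; v \<in> W; p \<otimes> v \<in> W\<rbrakk> \<Longrightarrow> p \<in> W"
    and W_total: "\<lbrakk>v \<in> W; w \<in> W\<rbrakk> \<Longrightarrow> \<exists>z\<in>W. v = w \<otimes> z \<or> w = v \<otimes> z"
    and W_div: "\<lbrakk>w \<in> W; n \<ge> 1\<rbrakk> \<Longrightarrow> \<exists>v\<in>W. w = v [^] (n::nat)"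
    and \<theta>_hom: "\<theta> \<in> mhom (free_cmonoid r) P"
    and power_reach: "p \<in> carrier P \<Longrightarrow>
      \<exists>n\<ge>1. \<exists>w\<in>W. \<exists>m\<in>carrier (free_cmonoid r). p [^] (n::nat) = w \<otimes> \<theta> m"
    and group_reach: "p \<in> carrier P \<Longrightarrow> \<exists>v\<in>W. \<exists>w\<in>W. \<exists>a\<in>carrier (free_cmonoid r).
      \<exists>b\<in>carrier (free_cmonoid r). p \<otimes> v \<otimes> \<theta> a = w \<otimes> \<theta> b"
begin

abbreviation (input) "F \<equiv> carrier (free_cmonoid r)"

lemma \<theta>_closed [simp]: "(\<And>i. i \<ge> r \<Longrightarrow> m i = 0) \<Longrightarrow> \<theta> m \<in> carrier P"
  using mhomD(1)[OF \<theta>_hom, of m] by simp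

lemma \<theta>_add: "a \<in> F \<Longrightarrow> b \<in> F \<Longrightarrow> \<theta> (a + b) = \<theta> a \<otimes> \<theta> b"
  using mhomD(2)[OF \<theta>_hom, of a b] by simp

lemma \<theta>_scale: "a \<in> F \<Longrightarrow> \<theta> (\<lambda>i. n * a i) = \<theta> a [^] n"
proof (induction n)
  case 0
  then show ?case using mhomD(3)[OF \<theta>_hom] by (simp add: zero_fun_def)
next
  case (Suc n)
  have "(\<lambda>i. Suc n * a i) = (\<lambda>i. n * a i) + a" by (auto simp: fun_eq_iff)
  then show ?case using Suc \<theta>_add[of "\<lambda>i. n * a i" a] by simp
qed

lemma W_pow: "w \<in> W \<Longrightarrow> w [^] (n::nat) \<in> W"
  by (induction n) (auto intro: W_one W_mult)

text \<open>
  Equality modulo the group generated by \<open>W\<close>.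
\<close>

definition sim :: "'p \<Rightarrow> 'p \<Rightarrow> bool" where
  "sim x y \<longleftrightarrow> x \<in> carrier P \<and> y \<in> carrier P \<and> (\<exists>v\<in>W. \<exists>w\<in>W. x \<otimes> v = y \<otimes> w)"

lemma simI: "\<lbrakk>x \<in> carrier P; y \<in> carrier P; v \<in> W; w \<in> W; x \<otimes> v = y \<otimes> w\<rbrakk> \<Longrightarrow> sim x y"
  by (auto simp: sim_def)

lemma sim_closed: "sim x y \<Longrightarrow> x \<in> carrier P" "sim x y \<Longrightarrow> y \<in> carrier P"
  by (auto simp: sim_def)

lemma sim_refl: "x \<in> carrier P \<Longrightarrow> sim x x"
  using W_one by (auto simp: sim_def)

lemma sim_sym: "sim x y \<Longrightarrow> sim y x"
  unfolding sim_def by metis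

lemma sim_mult:
  assumes "sim x y" "sim x' y'"
  shows "sim (x \<otimes> x') (y \<otimes> y')"
proof -
  obtain v w v' w' where m: "v \<in> W" "w \<in> W" "v' \<in> W" "w' \<in> W"
    and e: "x \<otimes> v = y \<otimes> w" "x' \<otimes> v' = y' \<otimes> w'" using assms by (auto simp: sim_def)
  note [simp] = m[THEN W_sub] sim_closed[OF assms(1)] sim_closed[OF assms(2)]
  have "x \<otimes> x' \<otimes> (v \<otimes> v') = (x \<otimes> v) \<otimes> (x' \<otimes> v')" by (simp add: m_ac)
  also have "\<dots> = y \<otimes> y' \<otimes> (w \<otimes> w')" unfolding e by (simp add: m_ac)
  finally show ?thesis using m by (intro simI[of _ _ "v \<otimes> v'" "w \<otimes> w'"] W_mult) simp_all
qed

lemma sim_cancel: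
  assumes "sim (x \<otimes> z) (y \<otimes> z')" "sim z z'" "x \<in> carrier P" "y \<in> carrier P"
  shows "sim x y"
proof -
  note [simp] = assms(3,4) sim_closed[OF assms(2)]
  obtain v w where m: "v \<in> W" "w \<in> W"
    and e: "x \<otimes> z \<otimes> z' \<otimes> v = y \<otimes> z' \<otimes> z \<otimes> w"
    using sim_mult[OF assms(1) sim_sym[OF assms(2)]] by (auto simp: sim_def)
  note [simp] = m[THEN W_sub]
  have "x \<otimes> v = y \<otimes> w"
    by (rule cancel[where k = "z \<otimes> z'"]) (use e in \<open>simp_all add: m_ac\<close>)
  then show ?thesis by (intro simI[of _ _ v w]) (simp_all add: m)
qed

lemma sim_trans: "sim x y \<Longrightarrow> sim y z \<Longrightarrow> sim x z"
  using sim_mult[of x y y z] sim_cancel[of x y z y] sim_refl[of y] sim_closed[of x y] sim_closed[of y z]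
  by (simp add: m_comm[of y z])

lemma sim_pow: "sim x y \<Longrightarrow> sim (x [^] (n::nat)) (y [^] n)"
  by (induction n) (auto intro: sim_mult sim_refl)

lemma sim_total:
  assumes "sim x y"
  obtains w where "w \<in> W" "x = w \<otimes> y" | w where "w \<in> W" "y = w \<otimes> x"
proof -
  obtain v w where m: "v \<in> W" "w \<in> W" and e: "x \<otimes> v = y \<otimes> w"
    using assms by (auto simp: sim_def)
  note [simp] = m[THEN W_sub] sim_closed[OF assms]
  obtain z where z: "z \<in> W" "v = w \<otimes> z \<or> w = v \<otimes> z" using W_total[OF m] by blast
  note [simp] = W_sub[OF z(1)]
  from z(2) show ?thesis
  proof
    assume vw: "v = w \<otimes> z"
    have "y = z \<otimes> x" by (rule cancel[where k = w]) (use e in \<open>simp_all add: vw m_ac\<close>)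
    then show ?thesis using that(2) z(1) by blast
  next
    assume vw: "w = v \<otimes> z"
    have "x = z \<otimes> y" by (rule cancel[where k = v]) (use e in \<open>simp_all add: vw m_ac\<close>)
    then show ?thesis using that(1) z(1) by blast
  qed
qed

text \<open>
  Saturation makes \<open>x / y\<close> an element of \<open>P\<close>, being a root of unity; it lies in the group generated by
  \<open>W\<close>, hence in \<open>W\<close>.
\<close>

lemma sim_torsion:
  assumes "sim x y" "x [^] (n::nat) = y [^] n" "n \<ge> 1"
  shows "\<exists>w\<in>W. x = w \<otimes> y"
proof -
  note [simp] = sim_closed[OF assms(1)]
  obtain d where d: "d \<in> carrier P" "x = d \<otimes> y"
    using root[of x y \<one> n] assms(2,3) by auto
  have "sim (d \<otimes> y) (\<one> \<otimes> y)" using assms(1) d(2) by simp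
  then have "sim d \<one>" by (rule sim_cancel) (use d(1) in \<open>simp_all add: sim_refl\<close>)
  then obtain v w where "v \<in> W" "w \<in> W" "d \<otimes> v = w"
    using W_sub by (auto simp: sim_def)
  then have "d \<in> W" using W_exact d(1) by blast
  with d show ?thesis by blast
qed

abbreviation (input) "supp \<equiv> \<lambda>m :: nat \<Rightarrow> nat. {i. m i \<noteq> 0}"

lemma supp_bounded: "m \<in> F \<Longrightarrow> supp m \<subseteq> {..<r}"
  by (auto intro: ccontr)

text \<open>
  The exchange step of Caratheodory's theorem. The vector \<open>a - b\<close> has monomial value \<open>u\<close> in \<open>W\<close>, so
  subtracting a nonnegative multiple of it from \<open>m\<close> only changes the coefficient \<open>w\<close> within \<open>W\<close>. The
  largest multiple that keeps all exponents nonnegative makes one of them zero.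
\<close>

lemma reduce_support:
  assumes p: "p \<in> carrier P" and n: "n \<ge> 1" and w: "w \<in> W" and m: "m \<in> F"
    and e: "p [^] (n::nat) = w \<otimes> \<theta> m"
    and a: "a \<in> F" "supp a \<subseteq> supp m" and b: "b \<in> F" "supp b \<subseteq> supp m"
    and u: "u \<in> W" "\<theta> a = u \<otimes> \<theta> b" and i0: "a i0 > b i0"
  shows "\<exists>n'\<ge>1. \<exists>w'\<in>W. \<exists>m'\<in>F. p [^] (n'::nat) = w' \<otimes> \<theta> m' \<and> supp m' \<subset> supp m"
proof -
  define J where "J = {i. a i > b i}"
  have "J \<subseteq> supp a" by (auto simp: J_def)
  also have "\<dots> \<subseteq> {..<r}" by (rule supp_bounded[OF a(1)])
  finally have "J \<subseteq> {..<r}" .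
  then have finJ: "finite J" by (rule finite_subset) simp
  (* The exponent m - t (a - b) first reaches zero at the coordinate of J where this ratio is
     least, for t equal to that ratio. Multiplying by c = a i - b i clears the denominator. *)
  define \<rho> where "\<rho> = (\<lambda>i. real (m i) / real (a i - b i))"
  obtain i where i: "i \<in> J" and min: "\<And>j. j \<in> J \<Longrightarrow> \<rho> i \<le> \<rho> j"
    using arg_min_if_finite[of J \<rho>] finJ i0 J_def
    by (metis (mono_tags, lifting) arg_min_least empty_iff mem_Collect_eq)
  define c where "c = a i - b i"
  have c: "c \<ge> 1" using i by (auto simp: c_def J_def)
  have le: "m i * a j \<le> c * m j + m i * b j" for j
  proof (cases "j \<in> J")
    case True
    then have "real (m i) * real (a j - b j) \<le> real (m j) * real c"
      using min[OF True] i by (simp add: \<rho>_def c_def J_def field_simps)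
    then have "m i * (a j - b j) \<le> m j * c" by (metis of_nat_le_iff of_nat_mult)
    moreover have "m i * a j = m i * (a j - b j) + m i * b j"
      using True by (simp add: J_def flip: add_mult_distrib2)
    ultimately show ?thesis by (simp add: mult.commute)
  next
    case False
    then show ?thesis by (simp add: J_def trans_le_add2)
  qed
  define m' where "m' = (\<lambda>j. c * m j + m i * b j - m i * a j)"
  have m'F: "m' \<in> F" using m b(1) by (auto simp: m'_def)
  have "a i = c + b i" using i by (simp add: c_def J_def)
  then have m'i: "m' i = 0" by (simp add: m'_def algebra_simps)
  have mi: "m i \<noteq> 0" using subsetD[OF a(2), of i] \<open>a i = c + b i\<close> c by simp
  have m'0: "m' j = 0" if "m j = 0" for j
    using that subsetD[OF b(2), of j] by (cases "b j = 0") (simp_all add: m'_def)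
  have sub: "supp m' \<subset> supp m"
  proof (rule psubsetI)
    show "supp m' \<subseteq> supp m" using m'0 by (intro Collect_mono impI) metis
    show "supp m' \<noteq> supp m"
    proof
      assume "supp m' = supp m"
      then have "i \<in> supp m'" using mi by simp
      then show False using m'i by simp
    qed
  qed
  have F: "(\<lambda>j. k * x j) \<in> F" if "x \<in> F" for k and x :: "nat \<Rightarrow> nat" using that by simp
  have "(\<lambda>j. c * m j) + (\<lambda>j. m i * b j) = m' + (\<lambda>j. m i * a j)"
    using le by (auto simp: m'_def fun_eq_iff)
  then have "\<theta> (\<lambda>j. c * m j) \<otimes> \<theta> (\<lambda>j. m i * b j) = \<theta> m' \<otimes> \<theta> (\<lambda>j. m i * a j)"
    using \<theta>_add[OF F[OF m] F[OF b(1)]] \<theta>_add[OF m'F F[OF a(1)]] by metis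
  then have eq: "\<theta> m [^] c \<otimes> \<theta> b [^] m i = \<theta> m' \<otimes> (u \<otimes> \<theta> b) [^] m i"
    using \<theta>_scale m a(1) b(1) u(2) by simp
  note [simp] = W_sub[OF w] W_sub[OF u(1)] p
  have [simp]: "\<theta> m \<in> carrier P" "\<theta> m' \<in> carrier P" "\<theta> b \<in> carrier P"
    using m m'F b(1) by simp_all
  have "\<theta> m [^] c = \<theta> m' \<otimes> u [^] m i"
    by (rule cancel[where k = "\<theta> b [^] m i"]) (use eq in \<open>simp_all add: nat_pow_distrib m_ac\<close>)
  then have "p [^] (n * c) = (w [^] c \<otimes> u [^] m i) \<otimes> \<theta> m'"
    using e by (simp add: nat_pow_distrib m_ac flip: nat_pow_pow)
  moreover have "w [^] c \<otimes> u [^] m i \<in> W" using w u by (intro W_mult W_pow)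
  moreover have "n * c \<ge> 1" using n c by simp
  ultimately show ?thesis using m'F sub by blast
qed

text \<open>
  No monomial with exponents in \<open>\<int>\<close>, supported in \<open>J\<close> and different from one, lies in the group
  generated by \<open>W\<close>.
\<close>

definition independent :: "nat set \<Rightarrow> bool" where
  "independent J \<longleftrightarrow> (\<forall>a\<in>F. \<forall>b\<in>F. supp a \<subseteq> J \<longrightarrow> supp b \<subseteq> J \<longrightarrow> sim (\<theta> a) (\<theta> b) \<longrightarrow> a = b)"

lemma independentD:
  assumes "independent J" "sim (\<theta> a) (\<theta> b)" "a \<in> F" "b \<in> F" "supp a \<subseteq> J" "supp b \<subseteq> J"
  shows "a = b"
  using assms(1)[unfolded independent_def, rule_format, OF assms(3-6,2)] .

text \<open>
  If \<open>a - b\<close> has a positive coordinate, \<open>reduce_support\<close> applies directly. Otherwise \<open>b - a\<close> is a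
  nonnegative vector whose monomial is inverse to \<open>u\<close>. That monomial is an element of \<open>P\<close>, hence of
  \<open>W\<close>, and the exchange step works with \<open>b - a\<close> in place of \<open>a - b\<close>.
\<close>

lemma reduce_dependent:
  assumes p: "p \<in> carrier P" and n: "n \<ge> 1" and w: "w \<in> W" and m: "m \<in> F"
    and e: "p [^] (n::nat) = w \<otimes> \<theta> m"
    and a: "a \<in> F" "supp a \<subseteq> supp m" and b: "b \<in> F" "supp b \<subseteq> supp m"
    and u: "u \<in> W" "\<theta> a = u \<otimes> \<theta> b" and ne: "a \<noteq> b"
  shows "\<exists>n'\<ge>1. \<exists>w'\<in>W. \<exists>m'\<in>F. p [^] (n'::nat) = w' \<otimes> \<theta> m' \<and> supp m' \<subset> supp m"
proof (cases "\<exists>i. a i > b i")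
  case True
  then show ?thesis using reduce_support[OF p n w m e a b u] by blast
next
  case False
  then have le: "a i \<le> b i" for i by (meson not_less)
  define d where "d = b - a"
  have d: "d \<in> F" using b(1) by (auto simp: d_def)
  have b_eq: "b = d + a" using le by (auto simp: d_def fun_eq_iff)
  obtain i where "b i > a i" using ne le by (metis ext le_neq_implies_less)
  have [simp]: "\<theta> a \<in> carrier P" "\<theta> d \<in> carrier P" "u \<in> carrier P"
    using a(1) d W_sub[OF u(1)] by simp_all
  have ab: "\<theta> b = \<theta> d \<otimes> \<theta> a" using \<theta>_add[OF d a(1)] b_eq by simp
  have "\<theta> d \<otimes> u = \<one>"
    by (rule cancel[where k = "\<theta> a"]) (use u(2) ab in \<open>simp_all add: m_ac\<close>)
  then have "\<theta> d \<in> W" using W_exact[of "\<theta> d" u] u(1) W_one by simp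
  then show ?thesis using reduce_support[OF p n w m e b a _ ab \<open>b i > a i\<close>] by blast
qed

lemma independent_representation:
  assumes p: "p \<in> carrier P"
  obtains n w m where "n \<ge> 1" "w \<in> W" "m \<in> F" "p [^] (n::nat) = w \<otimes> \<theta> m" "independent (supp m)"
proof -
  define R where "R = (\<lambda>m. m \<in> F \<and> (\<exists>n\<ge>1. \<exists>w\<in>W. p [^] (n::nat) = w \<otimes> \<theta> m))"
  obtain m0 where "R m0" using power_reach[OF p] unfolding R_def by blast
  then obtain m where m: "R m" and min: "\<And>m'. R m' \<Longrightarrow> card (supp m) \<le> card (supp m')"
    using ex_has_least_nat[of R m0 "\<lambda>m. card (supp m)"] by blast
  obtain n w where nw: "n \<ge> 1" "w \<in> W" "m \<in> F" "p [^] (n::nat) = w \<otimes> \<theta> m"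
    using m unfolding R_def by blast
  have "supp m \<subseteq> {..<r}" by (rule supp_bounded[OF nw(3)])
  then have fin: "finite (supp m)" by (rule finite_subset) simp
  have "independent (supp m)"
    unfolding independent_def
  proof (intro ballI impI, rule ccontr)
    fix a b assume a: "a \<in> F" and b: "b \<in> F" and a': "supp a \<subseteq> supp m" and b': "supp b \<subseteq> supp m"
      and s: "sim (\<theta> a) (\<theta> b)" and ne: "a \<noteq> b"
    from s have "\<exists>n'\<ge>1. \<exists>w'\<in>W. \<exists>m'\<in>F. p [^] (n'::nat) = w' \<otimes> \<theta> m' \<and> supp m' \<subset> supp m"
    proof (cases rule: sim_total)
      case (1 u)
      then show ?thesis using reduce_dependent[OF p nw a a' b b'] ne by blast
    next
      case (2 u)
      then show ?thesis using reduce_dependent[OF p nw b b' a a'] ne by blast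
    qed
    then obtain m' where m': "R m'" "supp m' \<subset> supp m" unfolding R_def by blast
    show False using min[OF m'(1)] psubset_card_mono[OF fin m'(2)] by simp
  qed
  then show ?thesis by (rule that[OF nw])
qed

text \<open>
  The elements whose exponents \<open>s / n\<close> are fractions in the half-open unit cube.
\<close>

definition box :: "nat set \<Rightarrow> 'p set" where
  "box J = {x \<in> carrier P. \<exists>n. \<exists>s\<in>F. x [^] (n::nat) = \<theta> s \<and> (\<forall>i. s i < n) \<and> supp s \<subseteq> J}"

text \<open>
  Write \<open>m = n q + s\<close> by division with remainder. Since the coefficient has an \<open>n\<close>-th root \<open>v\<close> in \<open>W\<close>,
  the element \<open>p / (v \<theta>(q))\<close> has \<open>n\<close>-th power \<open>\<theta>(s)\<close>; it lies in \<open>P\<close> by saturation.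
\<close>

lemma box_decomposition:
  assumes p: "p \<in> carrier P"
  obtains J q w x where "J \<subseteq> {..<r}" "independent J" "q \<in> F" "w \<in> W" "x \<in> box J" "p = w \<otimes> x \<otimes> \<theta> q"
proof -
  obtain n w m where n: "n \<ge> 1" and w: "w \<in> W" and m: "m \<in> F" and e: "p [^] (n::nat) = w \<otimes> \<theta> m"
    and ind: "independent (supp m)"
    using independent_representation[OF p] .
  define q s where "q = (\<lambda>i. m i div n)" and "s = (\<lambda>i. m i mod n)"
  have q: "q \<in> F" and s: "s \<in> F" using m by (auto simp: q_def s_def)
  obtain v where v: "v \<in> W" "w = v [^] n" using W_div[OF w n] by blast
  note [simp] = W_sub[OF v(1)] p
  have [simp]: "\<theta> q \<in> carrier P" "\<theta> s \<in> carrier P" using q s by simp_all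
  have "m = s + (\<lambda>i. n * q i)" by (auto simp: q_def s_def fun_eq_iff)
  then have "\<theta> m = \<theta> s \<otimes> \<theta> q [^] n" using \<theta>_add[of s "\<lambda>i. n * q i"] \<theta>_scale[of q n] q s by simp
  then have e': "p [^] n = \<theta> s \<otimes> (v \<otimes> \<theta> q) [^] n" using e v(2) by (simp add: nat_pow_distrib m_ac)
  then obtain x where x: "x \<in> carrier P" "p = x \<otimes> (v \<otimes> \<theta> q)"
    using root[of p "v \<otimes> \<theta> q" "\<theta> s" n] n by auto
  have "x [^] n = \<theta> s"
    by (rule cancel[where k = "(v \<otimes> \<theta> q) [^] n"]) (use x e' in \<open>simp_all add: nat_pow_distrib\<close>)
  moreover have "supp s \<subseteq> supp m" by (auto simp: s_def intro: gr0I)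
  moreover have "s i < n" for i using n by (simp add: s_def)
  ultimately have "x \<in> box (supp m)" using x(1) s unfolding box_def by blast
  moreover have "p = v \<otimes> x \<otimes> \<theta> q" using x by (simp add: m_ac)
  moreover have "supp m \<subseteq> {..<r}" by (rule supp_bounded[OF m])
  ultimately show ?thesis by (intro that[OF _ ind q v(1)])
qed

text \<open>
  Congruent elements have, by independence, the same fractional exponents, so some power of \<open>x\<close>
  equals the same power of \<open>y\<close>.
\<close>

lemma box_unique:
  assumes J: "independent J" and x: "x \<in> box J" and y: "y \<in> box J" and xy: "sim x y"
  shows "\<exists>w\<in>W. x = w \<otimes> y"
proof -
  obtain n s where s: "s \<in> F" "x [^] (n::nat) = \<theta> s" "\<And>i. s i < n" "supp s \<subseteq> J"
    using x by (auto simp: box_def)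
  obtain n' s' where s': "s' \<in> F" "y [^] (n'::nat) = \<theta> s'" "\<And>i. s' i < n'" "supp s' \<subseteq> J"
    using y by (auto simp: box_def)
  have xyc [simp]: "x \<in> carrier P" "y \<in> carrier P" using x y by (auto simp: box_def)
  have ex: "x [^] (n * n') = \<theta> (\<lambda>i. n' * s i)"
    using s(1,2) by (simp add: \<theta>_scale flip: nat_pow_pow)
  have "y [^] (n' * n) = \<theta> (\<lambda>i. n * s' i)"
    using s'(1,2) by (simp add: \<theta>_scale flip: nat_pow_pow)
  then have ey: "y [^] (n * n') = \<theta> (\<lambda>i. n * s' i)" by (simp add: mult.commute)
  have "sim (\<theta> (\<lambda>i. n' * s i)) (\<theta> (\<lambda>i. n * s' i))"
    using sim_pow[OF xy, of "n * n'"] unfolding ex ey .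
  moreover have "(\<lambda>i. n' * s i) \<in> F" "(\<lambda>i. n * s' i) \<in> F" using s(1) s'(1) by simp_all
  moreover have "supp (\<lambda>i. n' * s i) \<subseteq> J" "supp (\<lambda>i. n * s' i) \<subseteq> J" using s(4) s'(4) by auto
  ultimately have "(\<lambda>i. n' * s i) = (\<lambda>i. n * s' i)"
    by (intro independentD[OF J])
  then have "x [^] (n * n') = y [^] (n * n')" unfolding ex ey by simp
  moreover have "n * n' \<ge> 1" using s(3)[of 0] s'(3)[of 0] by (cases n; cases n') auto
  ultimately show ?thesis using sim_torsion[OF xy] by blast
qed

lemma divisor_basis_sum:
  assumes "subtractive k L" "divisor_basis L G" "(a, b) \<in> L"
  shows "\<exists>N. (\<forall>i. a i = (\<Sum>g\<in>G. N g * fst g i)) \<and> (\<forall>i. b i = (\<Sum>g\<in>G. N g * snd g i))"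
  using assms
proof (induction rule: subtractive_induct)
  case zero
  show ?case by (rule exI[of _ "\<lambda>_. 0"]) simp
next
  case (add a b c d)
  then obtain N where N: "\<And>i. a i = (\<Sum>g\<in>G. N g * fst g i)" "\<And>i. b i = (\<Sum>g\<in>G. N g * snd g i)"
    by blast
  have fin: "finite G" using assms(2) by (simp add: divisor_basis_def)
  let ?N = "N((c, d) := Suc (N (c, d)))"
  have eq: "(\<Sum>g\<in>G. ?N g * h g) = (\<Sum>g\<in>G. N g * h g) + h (c, d)" for h :: "_ \<Rightarrow> nat"
  proof -
    have "(\<Sum>g\<in>G. ?N g * h g) = (\<Sum>g\<in>G. N g * h g + (if g = (c, d) then h g else 0))"
      by (intro sum.cong) auto
    then show ?thesis using fin \<open>(c, d) \<in> G\<close> by (simp add: sum.distrib)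
  qed
  show ?case
  proof (intro exI[of _ ?N] conjI allI)
    show "(a + c) i = (\<Sum>g\<in>G. ?N g * fst g i)" for i
      unfolding eq N(1)[of i, symmetric] by (simp add: plus_fun_def)
    show "(b + d) i = (\<Sum>g\<in>G. ?N g * snd g i)" for i
      unfolding eq N(2)[of i, symmetric] by (simp add: plus_fun_def)
  qed
qed

lemma sim_group_reach:
  assumes p: "p \<in> carrier P"
  obtains a b where "a \<in> F" "b \<in> F" "sim (p \<otimes> \<theta> a) (\<theta> b)"
proof -
  obtain v w a b where vw: "v \<in> W" "w \<in> W" and F: "a \<in> F" "b \<in> F"
    and e: "p \<otimes> v \<otimes> \<theta> a = w \<otimes> \<theta> b" using group_reach[OF p] by blast
  have [simp]: "\<theta> a \<in> carrier P" "\<theta> b \<in> carrier P" using F by simp_all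
  note [simp] = p vw[THEN W_sub]
  have "sim (p \<otimes> \<theta> a) (\<theta> b)" using vw e by (intro simI[of _ _ v w]) (simp_all add: m_ac)
  then show ?thesis by (rule that[OF F])
qed

lemma finite_bounded_exponents:
  fixes B :: "nat \<Rightarrow> nat"
  shows "finite {a \<in> F. \<forall>i. a i \<le> B i}"
proof (rule finite_subset)
  show "{a \<in> F. \<forall>i. a i \<le> B i} \<subseteq>
      {a. \<forall>i. (i \<in> {..<r} \<longrightarrow> a i \<in> {.. \<Sum>i<r. B i}) \<and> (i \<notin> {..<r} \<longrightarrow> a i = 0)}"
  proof clarsimp
    fix a :: "nat \<Rightarrow> nat" and i assume "\<forall>i. a i \<le> B i" "i < r"
    then have "a i \<le> B i" "B i \<le> (\<Sum>i<r. B i)" using member_le_sum[of i "{..<r}" B] by auto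
    then show "a i \<le> (\<Sum>i<r. B i)" by linarith
  qed
qed (rule finite_set_of_finite_funs; simp)

text \<open>
  Modulo \<open>W\<close> an element \<open>x\<close> of a box is a quotient \<open>\<theta>(b) / \<theta>(a)\<close>, which depends on \<open>(a, b)\<close> only up to
  adding pairs of the set \<open>L\<close> of monomial relations modulo \<open>W\<close>. Taking \<open>(a, b)\<close> as short as possible
  bounds it independently of \<open>x\<close>: from \<open>x^n = \<theta>(s)\<close> the pair \<open>(s + n a, n b)\<close> lies in \<open>L\<close>, and a
  basis element with multiplicity at least \<open>n\<close> in it could be subtracted from \<open>(a, b)\<close>, because the
  coordinates of \<open>s\<close> are less than \<open>n\<close>.
\<close>

lemma box_finite_mod_sim:
  obtains Z where "finite Z" "Z \<subseteq> F \<times> F"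
    "\<And>J x. x \<in> box J \<Longrightarrow> \<exists>(a, b)\<in>Z. sim (x \<otimes> \<theta> a) (\<theta> b)"
proof -
  define L where "L = {(a, b). a \<in> F \<and> b \<in> F \<and> sim (\<theta> a) (\<theta> b)}"
  have sub: "subtractive r L"
    unfolding subtractive_def
  proof (intro conjI)
    show "L \<subseteq> F \<times> F" by (auto simp: L_def)
    have "(a - c, b - d) \<in> L" if "(a, b) \<in> L" "(c, d) \<in> L" "c \<le> a" "d \<le> b" for a b c d
    proof -
      have F: "a - c \<in> F" "b - d \<in> F" "c \<in> F" "d \<in> F" using that by (auto simp: L_def)
      have "(a - c) + c = a" "(b - d) + d = b" using that by (auto simp: le_fun_def fun_eq_iff)
      then have "sim (\<theta> (a - c) \<otimes> \<theta> c) (\<theta> (b - d) \<otimes> \<theta> d)"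
        using that(1) by (simp add: L_def flip: \<theta>_add[OF F(1,3)] \<theta>_add[OF F(2,4)])
      moreover have "sim (\<theta> c) (\<theta> d)" using that(2) by (auto simp: L_def)
      moreover have "\<theta> (a - c) \<in> carrier P" "\<theta> (b - d) \<in> carrier P" using F by simp_all
      ultimately show ?thesis using F sim_cancel unfolding L_def by blast
    qed
    then show "\<forall>(a, b)\<in>L. \<forall>(c, d)\<in>L. c \<le> a \<longrightarrow> d \<le> b \<longrightarrow> (a - c, b - d) \<in> L" by blast
  qed
  then obtain G where G: "divisor_basis L G"
    using divisor_basis_exists[of L r] unfolding subtractive_def by blast
  define A B where "A = (\<lambda>i. \<Sum>g\<in>G. fst g i)" and "B = (\<lambda>i. \<Sum>g\<in>G. snd g i)"
  show ?thesis
  proof (rule that[of "{a \<in> F. \<forall>i. a i \<le> A i} \<times> {b \<in> F. \<forall>i. b i \<le> B i}"])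
    show "finite ({a \<in> F. \<forall>i. a i \<le> A i} \<times> {b \<in> F. \<forall>i. b i \<le> B i})"
      by (intro finite_cartesian_product finite_bounded_exponents)
    fix J x assume "x \<in> box J"
    then obtain n s where x: "x \<in> carrier P" and s: "s \<in> F" "x [^] (n::nat) = \<theta> s" "\<And>i. s i < n"
      by (auto simp: box_def)
    define Q where "Q = (\<lambda>(a, b). a \<in> F \<and> b \<in> F \<and> sim (x \<otimes> \<theta> a) (\<theta> b))"
    obtain ab0 where "Q ab0" using sim_group_reach[OF x] unfolding Q_def by blast
    then obtain ab where Qab: "Q ab"
      and min: "\<And>cd. Q cd \<Longrightarrow> (\<Sum>i<r. fst ab i + snd ab i) \<le> (\<Sum>i<r. fst cd i + snd cd i)"
      using ex_has_least_nat[of Q ab0 "\<lambda>ab. \<Sum>i<r. fst ab i + snd ab i"] by blast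
    obtain a b where ab: "ab = (a, b)" by fastforce
    have aF: "a \<in> F" and bF: "b \<in> F" and sm: "sim (x \<otimes> \<theta> a) (\<theta> b)" using Qab by (auto simp: Q_def ab)
    have [simp]: "\<theta> a \<in> carrier P" "\<theta> b \<in> carrier P" using aF bF by simp_all
    have "(x \<otimes> \<theta> a) [^] n = \<theta> (s + (\<lambda>i. n * a i))"
      using \<theta>_add[of s "\<lambda>i. n * a i"] \<theta>_scale[of a n] aF s x by (simp add: nat_pow_distrib)
    moreover have "\<theta> b [^] n = \<theta> (\<lambda>i. n * b i)" using \<theta>_scale[of b n] bF by simp
    ultimately have "sim (\<theta> (s + (\<lambda>i. n * a i))) (\<theta> (\<lambda>i. n * b i))"
      using sim_pow[OF sm, of n] by simp
    then have "(s + (\<lambda>i. n * a i), (\<lambda>i. n * b i)) \<in> L" using aF bF s(1) by (auto simp: L_def)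
    from divisor_basis_sum[OF sub G this] obtain N where
      N: "\<And>i. s i + n * a i = (\<Sum>g\<in>G. N g * fst g i)" "\<And>i. n * b i = (\<Sum>g\<in>G. N g * snd g i)"
      by auto
    have fin: "finite G" using G by (simp add: divisor_basis_def)
    have n0: "n > 0" using s(3)[of 0] by simp
    have small: "N g < n" if g: "g \<in> G" for g
    proof (rule ccontr)
      assume "\<not> N g < n"
      then have Ng: "n \<le> N g" by simp
      obtain c d where cd: "g = (c, d)" by fastforce
      have cdL: "(c, d) \<in> L" "(c, d) \<noteq> (0, 0)" using G g cd by (auto simp: divisor_basis_def)
      have cF: "c \<in> F" and dF: "d \<in> F" and scd: "sim (\<theta> c) (\<theta> d)" using cdL by (auto simp: L_def)
      have ca: "c i \<le> a i" for i
      proof -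
        have "n * c i \<le> N g * fst g i" using Ng cd by simp
        also have "\<dots> \<le> s i + n * a i" unfolding N(1) using fin g by (intro member_le_sum) auto
        also have "\<dots> < n * Suc (a i)" using s(3)[of i] by simp
        finally show ?thesis using n0 by (simp only: mult_less_cancel1) simp
      qed
      have db: "d i \<le> b i" for i
      proof -
        have "n * d i \<le> N g * snd g i" using Ng cd by simp
        also have "\<dots> \<le> n * b i" unfolding N(2) using fin g by (intro member_le_sum) auto
        finally show ?thesis using n0 by simp
      qed
      have F': "a - c \<in> F" "b - d \<in> F" using aF bF by auto
      have [simp]: "\<theta> (a - c) \<in> carrier P" "\<theta> (b - d) \<in> carrier P" "\<theta> c \<in> carrier P" "\<theta> d \<in> carrier P"
        using F' cF dF by simp_all
      have "a = (a - c) + c" "b = (b - d) + d" using ca db by (auto simp: fun_eq_iff)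
      then have "\<theta> a = \<theta> (a - c) \<otimes> \<theta> c" "\<theta> b = \<theta> (b - d) \<otimes> \<theta> d"
        using \<theta>_add F' cF dF by metis+
      then have "sim ((x \<otimes> \<theta> (a - c)) \<otimes> \<theta> c) (\<theta> (b - d) \<otimes> \<theta> d)" using sm x by (simp add: m_assoc)
      then have "sim (x \<otimes> \<theta> (a - c)) (\<theta> (b - d))" by (rule sim_cancel[OF _ scd]) (use x in simp_all)
      then have "Q (a - c, b - d)" using F' by (simp add: Q_def)
      then have min': "(\<Sum>i<r. a i + b i) \<le> (\<Sum>i<r. (a i - c i) + (b i - d i))"
        using min[of "(a - c, b - d)"] by (simp add: ab)
      obtain i where i: "c i + d i \<noteq> 0" using cdL(2) by (fastforce simp: fun_eq_iff)
      then have "i < r" using cF dF by (cases "i < r") auto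
      moreover have "(a i - c i) + (b i - d i) < a i + b i" using i ca[of i] db[of i] by linarith
      moreover have "(a j - c j) + (b j - d j) \<le> a j + b j" for j by linarith
      ultimately have "(\<Sum>i<r. (a i - c i) + (b i - d i)) < (\<Sum>i<r. a i + b i)"
        by (intro sum_strict_mono_ex1) auto
      with min' show False by simp
    qed
    have bound: "(\<Sum>g\<in>G. N g * h g) \<le> n * (\<Sum>g\<in>G. h g)" for h :: "_ \<Rightarrow> nat"
      unfolding sum_distrib_left using small by (intro sum_mono mult_right_mono) (auto intro: less_imp_le)
    have "n * a i \<le> n * A i" for i
      using N(1)[of i] bound[of "\<lambda>g. fst g i"] unfolding A_def by linarith
    moreover have "n * b i \<le> n * B i" for i
      using N(2)[of i] bound[of "\<lambda>g. snd g i"] unfolding B_def by linarith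
    ultimately have "a i \<le> A i" "b i \<le> B i" for i using n0 by simp_all
    then show "\<exists>(a, b)\<in>{a \<in> F. \<forall>i. a i \<le> A i} \<times> {b \<in> F. \<forall>i. b i \<le> B i}. sim (x \<otimes> \<theta> a) (\<theta> b)"
      using aF bF sm by blast
  qed auto
qed

theorem finitely_generated:
  obtains T where "finite T" "T \<subseteq> carrier P" "\<And>p. p \<in> carrier P \<Longrightarrow> p \<in> mspan P (W \<union> T)"
proof -
  obtain T1 where T1: "finite T1" "T1 \<subseteq> carrier P" "\<And>m. m \<in> F \<Longrightarrow> \<theta> m \<in> mspan P T1"
    using free_hom_image_fin_gen[OF comm_monoid_axioms \<theta>_hom] by blast
  obtain Z where Z: "finite Z" "Z \<subseteq> F \<times> F" "\<And>J x. x \<in> box J \<Longrightarrow> \<exists>(a, b)\<in>Z. sim (x \<otimes> \<theta> a) (\<theta> b)"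
    using box_finite_mod_sim by blast
  define C where "C = (\<lambda>J ab. {x \<in> box J. sim (x \<otimes> \<theta> (fst ab)) (\<theta> (snd ab))})"
  (* One representative for each set of generators and each class that meets its box; this is
     enough because independence makes the classes in a box cyclic over W. *)
  define T2 where "T2 = (\<lambda>(J, ab). SOME x. x \<in> C J ab) ` {(J, ab) \<in> Pow {..<r} \<times> Z. C J ab \<noteq> {}}"
  have some: "(SOME x. x \<in> C J ab) \<in> C J ab" if "C J ab \<noteq> {}" for J ab
    using that by (simp add: some_in_eq)
  have "finite T2" unfolding T2_def by (intro finite_imageI finite_subset[OF _ finite_cartesian_product[OF _ Z(1), of "Pow {..<r}"]]) auto
  moreover have "T2 \<subseteq> carrier P"
  proof
    fix x assume "x \<in> T2"
    then obtain J ab where "C J ab \<noteq> {}" "x = (SOME x. x \<in> C J ab)" unfolding T2_def by auto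
    then have "x \<in> C J ab" using some by simp
    then show "x \<in> carrier P" by (simp add: C_def box_def)
  qed
  moreover have "p \<in> mspan P (W \<union> (T1 \<union> T2))" if p: "p \<in> carrier P" for p
  proof -
    obtain J q w x where J: "J \<subseteq> {..<r}" "independent J" and q: "q \<in> F" and w: "w \<in> W"
      and x: "x \<in> box J" and e: "p = w \<otimes> x \<otimes> \<theta> q" using box_decomposition[OF p] .
    obtain a b where ab: "(a, b) \<in> Z" "sim (x \<otimes> \<theta> a) (\<theta> b)" using Z(3)[OF x] by blast
    then have xC: "x \<in> C J (a, b)" using x by (simp add: C_def)
    define y where "y = (SOME x. x \<in> C J (a, b))"
    have yC: "y \<in> C J (a, b)" unfolding y_def using some xC by blast
    have yT: "y \<in> T2"
      unfolding T2_def y_def using J(1) ab(1) xC by (intro image_eqI[of _ _ "(J, (a, b))"]) auto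
    have y: "y \<in> box J" "sim (y \<otimes> \<theta> a) (\<theta> b)" using yC by (auto simp: C_def)
    have "sim (x \<otimes> \<theta> a) (y \<otimes> \<theta> a)" using ab(2) y(2) sim_sym sim_trans by blast
    moreover have "\<theta> a \<in> carrier P" using Z(2) ab(1) by auto
    ultimately have "sim x y" using x y(1) by (intro sim_cancel[of x "\<theta> a" y "\<theta> a"] sim_refl) (auto simp: box_def)
    then obtain w' where w': "w' \<in> W" "x = w' \<otimes> y" using box_unique[OF J(2) x y(1)] by blast
    have "\<theta> q \<in> mspan P (W \<union> (T1 \<union> T2))"
      by (rule mspan_mono[OF _ T1(3)[OF q]]) (auto intro: mspan.gen)
    moreover have "w \<in> mspan P (W \<union> (T1 \<union> T2))" "w' \<in> mspan P (W \<union> (T1 \<union> T2))"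
      "y \<in> mspan P (W \<union> (T1 \<union> T2))"
      using w w'(1) yT by (auto intro: mspan.gen)
    ultimately show ?thesis unfolding e w'(2) by (intro mspan.mult)
  qed
  ultimately show ?thesis using that[of "T1 \<union> T2"] T1(1,2) by blast
qed

end

section \<open>The saturation of a finitely presented monoid\<close>

text \<open>
  The hypothesis in terms of a single homomorphism \<open>H\<close> from the free monoid over \<open>V\<close>. Elements of
  \<open>P\<close> are those of a saturation: they have a power in the image of \<open>H\<close>, they are quotients of elements
  of the image, and \<open>H x = H y\<close> holds only when \<open>x\<close> and \<open>y\<close> agree in the group completion of the
  finitely presented monoid.
\<close>

lemma sfp_presentation:
  fixes V :: "'v monoid" and P :: "'p monoid"
  assumes "sfp TYPE('d) V P f"
  obtains r S H where
    "finite S" "S \<subseteq> carrier (V \<times>\<times> free_cmonoid r) \<times> carrier (V \<times>\<times> free_cmonoid r)"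
    "H \<in> mhom (V \<times>\<times> free_cmonoid r) P"
    "\<And>v. v \<in> carrier V \<Longrightarrow> H (v, 0) = f v"
    "\<And>x y. (x, y) \<in> S \<Longrightarrow> H x = H y"
    "\<And>p. p \<in> carrier P \<Longrightarrow> \<exists>n\<ge>1. \<exists>x\<in>carrier (V \<times>\<times> free_cmonoid r). p [^]\<^bsub>P\<^esub> (n::nat) = H x"
    "\<And>p. p \<in> carrier P \<Longrightarrow> \<exists>x\<in>carrier (V \<times>\<times> free_cmonoid r).
       \<exists>y\<in>carrier (V \<times>\<times> free_cmonoid r). p \<otimes>\<^bsub>P\<^esub> H x = H y"
    "\<And>x y. \<lbrakk>x \<in> carrier (V \<times>\<times> free_cmonoid r); y \<in> carrier (V \<times>\<times> free_cmonoid r); H x = H y\<rbrakk> \<Longrightarrow>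
       \<exists>z\<in>carrier (V \<times>\<times> free_cmonoid r). (x \<otimes>\<^bsub>V \<times>\<times> free_cmonoid r\<^esub> z, y \<otimes>\<^bsub>V \<times>\<times> free_cmonoid r\<^esub> z)
         \<in> mcong_gen (V \<times>\<times> free_cmonoid r) S"
proof -
  obtain Q' :: "'d monoid" and g h \<psi> where fp: "fin_pres V Q' g" and h: "h \<in> mhom Q' P"
    and fhg: "\<And>p. p \<in> carrier V \<Longrightarrow> f p = h (g p)"
    and \<psi>: "\<psi> \<in> iso (saturation Q') P" "\<And>x. x \<in> carrier Q' \<Longrightarrow> \<psi> (gp_unit Q' x) = h x"
    using assms unfolding sfp_def by blast
  obtain r S \<phi> where cV: "comm_monoid V" and cQ: "comm_monoid Q'" and g: "g \<in> mhom V Q'"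
    and S: "finite S" "S \<subseteq> carrier (V \<times>\<times> free_cmonoid r) \<times> carrier (V \<times>\<times> free_cmonoid r)"
    and \<phi>: "\<phi> \<in> iso (mquot (V \<times>\<times> free_cmonoid r) (mcong_gen (V \<times>\<times> free_cmonoid r) S)) Q'"
      "\<And>p. p \<in> carrier V \<Longrightarrow> \<phi> (mcong_gen (V \<times>\<times> free_cmonoid r) S `` {(p, \<one>\<^bsub>free_cmonoid r\<^esub>)}) = g p"
    using fp unfolding fin_pres_def by blast
  let ?M = "V \<times>\<times> free_cmonoid r"
  let ?C = "mcong_gen ?M S"
  interpret V: comm_monoid V by fact
  interpret Q: comm_monoid Q' by fact
  interpret M: comm_monoid ?M by (rule comm_monoid_DirProd[OF cV free_cmonoid_comm_monoid])
  interpret G: comm_group "gp Q'" by (rule gp_comm_group[OF cQ])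
  have C: "mcong ?M ?C" by (rule mcong_gen_mcong[OF M.monoid_axioms S(2)])
  then have eqC: "equiv (carrier ?M) ?C" by (simp add: mcong_def)
  define \<kappa> where "\<kappa> = (\<lambda>x. \<phi> (?C `` {x}))"
  have \<phi>h: "\<phi> \<in> hom (mquot ?M ?C) Q'" and \<phi>b: "bij_betw \<phi> (carrier (mquot ?M ?C)) (carrier Q')"
    using \<phi>(1) by (auto simp: iso_def)
  have \<kappa>0: "\<kappa> (v, 0) = g v" if "v \<in> carrier V" for v using \<phi>(2)[OF that] by (simp add: \<kappa>_def)
  have \<kappa>: "\<kappa> \<in> mhom ?M Q'"
  proof (rule mhomI)
    show "\<kappa> x \<in> carrier Q'" if "x \<in> carrier ?M" for x
      unfolding \<kappa>_def using hom_in_carrier[OF \<phi>h] that by (auto simp: mquot_carrier)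
    show "\<kappa> (x \<otimes>\<^bsub>?M\<^esub> y) = \<kappa> x \<otimes>\<^bsub>Q'\<^esub> \<kappa> y" if "x \<in> carrier ?M" "y \<in> carrier ?M" for x y
      unfolding \<kappa>_def mquot_mult[OF C that, symmetric]
      by (rule hom_mult[OF \<phi>h]) (use that in \<open>simp_all only: mquot_carrier image_eqI\<close>)
    show "\<kappa> \<one>\<^bsub>?M\<^esub> = \<one>\<^bsub>Q'\<^esub>" using \<kappa>0[of "\<one>\<^bsub>V\<^esub>"] mhomD(3)[OF g] by simp
  qed
  have \<kappa>surj: "carrier Q' = \<kappa> ` carrier ?M"
  proof -
    have "carrier Q' = \<phi> ` carrier (mquot ?M ?C)" using \<phi>b by (simp add: bij_betw_def)
    then show ?thesis unfolding mquot_carrier \<kappa>_def image_image .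
  qed
  have \<kappa>eq: "(x, y) \<in> ?C" if "x \<in> carrier ?M" "y \<in> carrier ?M" "\<kappa> x = \<kappa> y" for x y
  proof -
    have "?C `` {x} = ?C `` {y}"
      by (rule inj_onD[OF bij_betw_imp_inj_on[OF \<phi>b]])
        (use that in \<open>simp_all only: \<kappa>_def mquot_carrier image_eqI\<close>)
    then show ?thesis using eq_equiv_class_iff[OF eqC that(1,2)] by simp
  qed
  have \<psi>h: "\<psi> \<in> hom (saturation Q') P" and \<psi>b: "bij_betw \<psi> (carrier (saturation Q')) (carrier P)"
    using \<psi>(1) by (auto simp: iso_def)
  have satm: "x \<otimes>\<^bsub>saturation Q'\<^esub> y = x \<otimes>\<^bsub>gp Q'\<^esub> y" for x y by (simp add: saturation_def)
  have u: "gp_unit Q' \<in> mhom Q' (saturation Q')" by (rule saturation_unit[OF cQ])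
  have \<psi>m: "\<psi> \<in> mhom (saturation Q') P"
    using \<psi>h \<psi>(2)[of "\<one>\<^bsub>Q'\<^esub>"] mhomD(3)[OF u] mhomD(3)[OF h] by (simp add: mhom_def)
  have "comm_monoid (saturation Q')"
    using saturation_saturated[OF cQ] unfolding saturated_monoid_def integral_monoid_def by simp
  then have monS: "monoid (saturation Q')" by (rule comm_monoid.axioms(1))
  have \<psi>surj: "\<exists>y. y \<in> carrier (saturation Q') \<and> p = \<psi> y" if "p \<in> carrier P" for p
    using that unfolding bij_betw_imp_surj_on[OF \<psi>b, symmetric] by auto
  define H where "H = (\<lambda>x. h (\<kappa> x))"
  show ?thesis
  proof (rule that[OF S, of H])
    show "H \<in> mhom ?M P"
      by (rule mhomI) (simp_all only: H_def mhomD[OF h] mhomD[OF \<kappa>])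
    show "H (v, 0) = f v" if "v \<in> carrier V" for v using that by (simp add: H_def \<kappa>0 fhg)
    show "H x = H y" if "(x, y) \<in> S" for x y
    proof -
      have "?C `` {x} = ?C `` {y}"
        by (rule equiv_class_eq[OF eqC subsetD[OF mcong_gen_incl that]])
      then show ?thesis by (simp add: H_def \<kappa>_def)
    qed
    show "\<exists>n\<ge>1. \<exists>x\<in>carrier ?M. p [^]\<^bsub>P\<^esub> (n::nat) = H x" if p: "p \<in> carrier P" for p
    proof -
      obtain y where "y \<in> carrier (saturation Q') \<and> p = \<psi> y"
        using \<psi>surj[OF p] ..
      then have y: "y \<in> carrier (saturation Q')" "p = \<psi> y" by simp_all
      obtain n :: nat and q where n: "n \<ge> 1" and q: "q \<in> carrier Q'" "y [^]\<^bsub>gp Q'\<^esub> n = gp_unit Q' q"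
        using y(1) by (auto simp: saturation_def)
      obtain x where x: "x \<in> carrier ?M" "q = \<kappa> x" using q(1) unfolding \<kappa>surj by blast
      have "p [^]\<^bsub>P\<^esub> n = \<psi> (y [^]\<^bsub>saturation Q'\<^esub> n)"
        unfolding y(2) by (rule mhom_pow[OF monS \<psi>m y(1), symmetric])
      also have "\<dots> = H x" using q \<psi>(2) x(2) by (simp add: saturation_pow H_def)
      finally show ?thesis using n x(1) by blast
    qed
    show "\<exists>x\<in>carrier ?M. \<exists>y\<in>carrier ?M. p \<otimes>\<^bsub>P\<^esub> H x = H y" if p: "p \<in> carrier P" for p
    proof -
      obtain y where "y \<in> carrier (saturation Q') \<and> p = \<psi> y"
        using \<psi>surj[OF p] ..
      then have y: "y \<in> carrier (saturation Q')" "p = \<psi> y" by simp_all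
      have "y \<in> carrier (gp Q')" using saturation_sub[OF cQ] y(1) by blast
      then obtain a b where ab: "a \<in> carrier Q'" "b \<in> carrier Q'" "y = gp_frac Q' a b"
        by (auto simp: gp_carrier[OF cQ])
      have "y \<otimes>\<^bsub>gp Q'\<^esub> gp_unit Q' b = gp_unit Q' a"
        using ab mhomD(1)[OF gp_unit_mhom[OF cQ]] by (simp add: gp_frac_unit[OF cQ] G.m_assoc)
      then have "\<psi> (y \<otimes>\<^bsub>saturation Q'\<^esub> gp_unit Q' b) = h a" using \<psi>(2) ab by (simp add: satm)
      then have "p \<otimes>\<^bsub>P\<^esub> h b = h a"
        using mhomD(2)[OF \<psi>m y(1) mhomD(1)[OF u ab(2)]] \<psi>(2) ab y(2) by simp
      moreover obtain x z where "x \<in> carrier ?M" "b = \<kappa> x" "z \<in> carrier ?M" "a = \<kappa> z"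
        using ab(1,2) unfolding \<kappa>surj by blast
      ultimately show ?thesis unfolding H_def by blast
    qed
    show "\<exists>z\<in>carrier ?M. (x \<otimes>\<^bsub>?M\<^esub> z, y \<otimes>\<^bsub>?M\<^esub> z) \<in> ?C"
      if x: "x \<in> carrier ?M" and y: "y \<in> carrier ?M" and e: "H x = H y" for x y
    proof -
      have \<kappa>c: "\<kappa> x \<in> carrier Q'" "\<kappa> y \<in> carrier Q'" using x y mhomD(1)[OF \<kappa>] by blast+
      have "\<psi> (gp_unit Q' (\<kappa> x)) = \<psi> (gp_unit Q' (\<kappa> y))" using e \<psi>(2) \<kappa>c by (simp add: H_def)
      then have "gp_unit Q' (\<kappa> x) = gp_unit Q' (\<kappa> y)"
        by (rule inj_onD[OF bij_betw_imp_inj_on[OF \<psi>b]]) (use mhomD(1)[OF u] \<kappa>c in blast)+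
      then obtain k where "k \<in> carrier Q'" "\<kappa> x \<otimes>\<^bsub>Q'\<^esub> k = \<kappa> y \<otimes>\<^bsub>Q'\<^esub> k"
        using \<kappa>c by (auto simp: gp_unit_frac[OF cQ] gp_frac_eq_iff[OF cQ])
      moreover then obtain z where z: "z \<in> carrier ?M" "k = \<kappa> z" unfolding \<kappa>surj by blast
      ultimately have "\<kappa> (x \<otimes>\<^bsub>?M\<^esub> z) = \<kappa> (y \<otimes>\<^bsub>?M\<^esub> z)" using mhomD(2)[OF \<kappa>] x y by simp
      then have "(x \<otimes>\<^bsub>?M\<^esub> z, y \<otimes>\<^bsub>?M\<^esub> z) \<in> ?C"
        using x y z(1) by (intro \<kappa>eq M.m_closed)
      with z(1) show ?thesis by blast
    qed
  qed
qed

section \<open>The kernel congruence\<close>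

lemma integral_DirProd_free:
  assumes "integral_monoid V"
  shows "integral_monoid (V \<times>\<times> free_cmonoid r)"
proof -
  have "comm_monoid (V \<times>\<times> free_cmonoid r)"
    by (rule comm_monoid_DirProd[OF integral_monoid_comm[OF assms] free_cmonoid_comm_monoid])
  then show ?thesis
    by (auto simp: integral_monoid_iff intro: integral_monoid_cancel[OF assms])
qed

text \<open>
  Two elements become equal in the group completion of \<open>M / S\<close> only if their quotient in the group
  completion of \<open>M\<close> is a product of quotients \<open>x / y\<close> of relations \<open>(x, y)\<close> of \<open>S\<close> and their inverses.
  The homomorphisms \<open>c\<close> and \<open>d\<close> send an exponent vector to the product of the left, respectively
  right sides; the vectors \<open>m\<close> and \<open>m'\<close> carry the positive and the negative exponents.
\<close>

lemma cancellative_congruence_bound: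
  assumes M: "integral_monoid M" and N: "integral_monoid P" and H: "H \<in> mhom M P"
    and S: "finite S" "S \<subseteq> carrier M \<times> carrier M" "\<And>x y. (x, y) \<in> S \<Longrightarrow> H x = H y"
  obtains k c d where "c \<in> mhom (free_cmonoid k) M" "d \<in> mhom (free_cmonoid k) M"
    "\<And>m. m \<in> carrier (free_cmonoid k) \<Longrightarrow> H (c m) = H (d m)"
    "\<And>x y z. \<lbrakk>x \<in> carrier M; y \<in> carrier M; z \<in> carrier M; (x \<otimes>\<^bsub>M\<^esub> z, y \<otimes>\<^bsub>M\<^esub> z) \<in> mcong_gen M S\<rbrakk> \<Longrightarrow>
      \<exists>m\<in>carrier (free_cmonoid k). \<exists>m'\<in>carrier (free_cmonoid k).
        x \<otimes>\<^bsub>M\<^esub> (c m \<otimes>\<^bsub>M\<^esub> d m') = y \<otimes>\<^bsub>M\<^esub> (d m \<otimes>\<^bsub>M\<^esub> c m')"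
proof -
  interpret M: comm_monoid M using M by (rule integral_monoid_comm)
  (* Lifting into the monoid of pairs with equal image under H makes c and d agree after H. *)
  define E where "E = (M \<times>\<times> M)\<lparr>carrier := {(x, y). x \<in> carrier M \<and> y \<in> carrier M \<and> H x = H y}\<rparr>"
  have cE: "comm_monoid E"
    by (rule comm_monoidI) (auto simp: E_def mult_DirProd' M.m_ac mhomD[OF H])
  obtain s :: "nat \<Rightarrow> _" and k where s: "S = s ` {i. i < k}"
    using S(1) finite_imp_nat_seg_image_inj_on by metis
  have "s i \<in> carrier E" if "i < k" for i
  proof -
    have "s i \<in> S" using that s by auto
    moreover then obtain x y where "s i = (x, y)" "(x, y) \<in> S" by (metis surj_pair)
    ultimately show ?thesis using S(2) S(3)[of x y] by (auto simp: E_def)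
  qed
  then obtain e where e: "e \<in> mhom (free_cmonoid k) E"
    and es: "\<And>i. i < k \<Longrightarrow> e (\<lambda>j. if j = i then 1 else 0) = s i"
    using free_lift[OF cE] by metis
  define c d where "c = (\<lambda>m. fst (e m))" and "d = (\<lambda>m. snd (e m))"
  have ecl: "c m \<in> carrier M" "d m \<in> carrier M" "H (c m) = H (d m)" if "m \<in> carrier (free_cmonoid k)" for m
    using mhomD(1)[OF e that] by (auto simp: E_def c_def d_def)
  have c: "c \<in> mhom (free_cmonoid k) M" and d: "d \<in> mhom (free_cmonoid k) M"
    using mhomD(2,3)[OF e] ecl(1,2)
    by (auto intro!: mhomI simp del: free_cmonoid_simps simp: E_def mult_DirProd' c_def d_def)
  define R where "R = {(x, y). x \<in> carrier M \<and> y \<in> carrier M \<and>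
    (\<exists>m\<in>carrier (free_cmonoid k). \<exists>m'\<in>carrier (free_cmonoid k).
        x \<otimes>\<^bsub>M\<^esub> (c m \<otimes>\<^bsub>M\<^esub> d m') = y \<otimes>\<^bsub>M\<^esub> (d m \<otimes>\<^bsub>M\<^esub> c m'))}"
  have RI: "(x, y) \<in> R" if "x \<in> carrier M" "y \<in> carrier M" "m \<in> carrier (free_cmonoid k)"
    "m' \<in> carrier (free_cmonoid k)" "x \<otimes>\<^bsub>M\<^esub> (c m \<otimes>\<^bsub>M\<^esub> d m') = y \<otimes>\<^bsub>M\<^esub> (d m \<otimes>\<^bsub>M\<^esub> c m')" for x y m m'
    using that unfolding R_def by blast
  have RE: thesis if "(x, y) \<in> R" "\<And>m m'. \<lbrakk>x \<in> carrier M; y \<in> carrier M; m \<in> carrier (free_cmonoid k);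
    m' \<in> carrier (free_cmonoid k); x \<otimes>\<^bsub>M\<^esub> (c m \<otimes>\<^bsub>M\<^esub> d m') = y \<otimes>\<^bsub>M\<^esub> (d m \<otimes>\<^bsub>M\<^esub> c m')\<rbrakk> \<Longrightarrow> thesis" for x y thesis
    using that unfolding R_def by blast
  have mult: "(x \<otimes>\<^bsub>M\<^esub> x', y \<otimes>\<^bsub>M\<^esub> y') \<in> R" if xy: "(x, y) \<in> R" and xy': "(x', y') \<in> R" for x y x' y'
  proof -
    obtain m n where 1: "x \<in> carrier M" "y \<in> carrier M" "m \<in> carrier (free_cmonoid k)"
      "n \<in> carrier (free_cmonoid k)" "x \<otimes>\<^bsub>M\<^esub> (c m \<otimes>\<^bsub>M\<^esub> d n) = y \<otimes>\<^bsub>M\<^esub> (d m \<otimes>\<^bsub>M\<^esub> c n)"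
      using RE[OF xy] by metis
    obtain m' n' where 2: "x' \<in> carrier M" "y' \<in> carrier M" "m' \<in> carrier (free_cmonoid k)"
      "n' \<in> carrier (free_cmonoid k)" "x' \<otimes>\<^bsub>M\<^esub> (c m' \<otimes>\<^bsub>M\<^esub> d n') = y' \<otimes>\<^bsub>M\<^esub> (d m' \<otimes>\<^bsub>M\<^esub> c n')"
      using RE[OF xy'] by metis
    note cl [simp] = 1(1,2) 2(1,2) ecl(1,2)[OF 1(3)] ecl(1,2)[OF 1(4)] ecl(1,2)[OF 2(3)] ecl(1,2)[OF 2(4)]
    have cd: "c (m + m') = c m \<otimes>\<^bsub>M\<^esub> c m'" "c (n + n') = c n \<otimes>\<^bsub>M\<^esub> c n'"
      "d (m + m') = d m \<otimes>\<^bsub>M\<^esub> d m'" "d (n + n') = d n \<otimes>\<^bsub>M\<^esub> d n'"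
      using mhomD(2)[OF c] mhomD(2)[OF d] 1(3,4) 2(3,4) by simp_all
    have "x \<otimes>\<^bsub>M\<^esub> x' \<otimes>\<^bsub>M\<^esub> (c (m + m') \<otimes>\<^bsub>M\<^esub> d (n + n'))
        = (x \<otimes>\<^bsub>M\<^esub> (c m \<otimes>\<^bsub>M\<^esub> d n)) \<otimes>\<^bsub>M\<^esub> (x' \<otimes>\<^bsub>M\<^esub> (c m' \<otimes>\<^bsub>M\<^esub> d n'))"
      unfolding cd by (simp add: M.m_ac)
    also have "\<dots> = y \<otimes>\<^bsub>M\<^esub> y' \<otimes>\<^bsub>M\<^esub> (d (m + m') \<otimes>\<^bsub>M\<^esub> c (n + n'))"
      unfolding cd 1(5) 2(5) by (simp add: M.m_ac)
    finally show ?thesis using 1(3,4) 2(3,4) by (intro RI[of _ _ "m + m'" "n + n'"]) simp_all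
  qed
  have zero: "c 0 = \<one>\<^bsub>M\<^esub>" "d 0 = \<one>\<^bsub>M\<^esub>" using mhomD(3)[OF c] mhomD(3)[OF d] by simp_all
  have refl: "(x, x) \<in> R" if "x \<in> carrier M" for x
    using that zero by (intro RI[of _ _ 0 0]) simp_all
  have cancel: "(x, y) \<in> R" if xyz: "x \<in> carrier M" "y \<in> carrier M" "z \<in> carrier M"
    and R: "(x \<otimes>\<^bsub>M\<^esub> z, y \<otimes>\<^bsub>M\<^esub> z) \<in> R" for x y z
  proof -
    obtain m n where mn: "m \<in> carrier (free_cmonoid k)" "n \<in> carrier (free_cmonoid k)"
      and eq: "x \<otimes>\<^bsub>M\<^esub> z \<otimes>\<^bsub>M\<^esub> (c m \<otimes>\<^bsub>M\<^esub> d n) = y \<otimes>\<^bsub>M\<^esub> z \<otimes>\<^bsub>M\<^esub> (d m \<otimes>\<^bsub>M\<^esub> c n)"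
      using RE[OF R] by metis
    note [simp] = xyz ecl(1,2)[OF mn(1)] ecl(1,2)[OF mn(2)]
    have "x \<otimes>\<^bsub>M\<^esub> (c m \<otimes>\<^bsub>M\<^esub> d n) = y \<otimes>\<^bsub>M\<^esub> (d m \<otimes>\<^bsub>M\<^esub> c n)"
      by (rule integral_monoid_cancel[OF M, where k = z]) (use eq in \<open>simp_all add: M.m_ac\<close>)
    then show ?thesis using mn xyz by (intro RI[of _ _ m n])
  qed
  have sub: "R \<subseteq> carrier M \<times> carrier M" by (auto simp: R_def)
  have sym: "(y, x) \<in> R" if "(x, y) \<in> R" for x y
  proof (rule RE[OF that])
    fix m n assume 1: "x \<in> carrier M" "y \<in> carrier M" "m \<in> carrier (free_cmonoid k)"
      "n \<in> carrier (free_cmonoid k)" "x \<otimes>\<^bsub>M\<^esub> (c m \<otimes>\<^bsub>M\<^esub> d n) = y \<otimes>\<^bsub>M\<^esub> (d m \<otimes>\<^bsub>M\<^esub> c n)"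
    then show "(y, x) \<in> R"
      by (intro RI[of _ _ n m]) (simp_all add: M.m_comm[OF ecl(1)[OF 1(4)] ecl(2)[OF 1(3)]]
          M.m_comm[OF ecl(2)[OF 1(4)] ecl(1)[OF 1(3)]])
  qed
  have trans: "(x, z) \<in> R" if "(x, y) \<in> R" "(y, z) \<in> R" for x y z
  proof -
    have cl: "x \<in> carrier M" "y \<in> carrier M" "z \<in> carrier M" using that sub by blast+
    have "(x \<otimes>\<^bsub>M\<^esub> y, z \<otimes>\<^bsub>M\<^esub> y) \<in> R" using mult[OF that] M.m_comm[OF cl(2,3)] by simp
    then show ?thesis by (rule cancel[OF cl(1,3,2)])
  qed
  have "equiv (carrier M) R"
  proof (rule equivI[OF sub])
    show "refl_on (carrier M) R" using refl by (simp add: refl_on_def)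
    show "sym R" using sym by (rule symI)
    show "trans R" using trans by (rule transI)
  qed
  then have R: "mcong M R" using mult by (auto simp: mcong_def)
  have "S \<subseteq> R"
  proof
    fix xy assume xy: "xy \<in> S"
    then obtain i where i: "i < k" "xy = s i" using s by auto
    let ?u = "\<lambda>j. if j = i then 1 else 0 :: nat"
    have uk: "?u \<in> carrier (free_cmonoid k)" using i by simp
    have cdu: "c ?u = fst xy" "d ?u = snd xy" using es[OF i(1)] i(2) by (simp_all add: c_def d_def)
    have cl: "fst xy \<in> carrier M" "snd xy \<in> carrier M" using xy S(2) by auto
    have "(fst xy, snd xy) \<in> R"
      using cl uk by (intro RI[of _ _ 0 ?u]) (simp_all add: cdu zero M.m_comm)
    then show "xy \<in> R" by simp
  qed
  then have "mcong_gen M S \<subseteq> R" by (rule mcong_gen_least[OF R])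
  then have bound: "\<exists>m\<in>carrier (free_cmonoid k). \<exists>m'\<in>carrier (free_cmonoid k).
        x \<otimes>\<^bsub>M\<^esub> (c m \<otimes>\<^bsub>M\<^esub> d m') = y \<otimes>\<^bsub>M\<^esub> (d m \<otimes>\<^bsub>M\<^esub> c m')"
    if "x \<in> carrier M" "y \<in> carrier M" "z \<in> carrier M" "(x \<otimes>\<^bsub>M\<^esub> z, y \<otimes>\<^bsub>M\<^esub> z) \<in> mcong_gen M S" for x y z
    using cancel[OF that(1-3)] that(4) unfolding R_def by blast
  show ?thesis by (rule that[OF c d ecl(3) bound])
qed

text \<open>
  If \<open>f v = f w\<close>, then \<open>v / w\<close> is a product of quotients of the relations in \<open>S\<close> whose component in
  the free part cancels. The exponent pairs with this cancellation property are subtractive, so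
  finitely many of them generate the others, and each contributes an equation \<open>a = b u\<close> or \<open>b = a u\<close> in the
  valuative monoid \<open>V\<close>. The finitely many \<open>u\<close> obtained in this way generate the kernel.
\<close>

lemma kernel_finitely_generated:
  fixes V :: "'v monoid" and P :: "'p monoid"
  assumes V: "valuative V" and P: "integral_monoid P" and H: "H \<in> mhom (V \<times>\<times> free_cmonoid r) P"
    and f: "\<And>v. v \<in> carrier V \<Longrightarrow> H (v, 0) = f v" "f \<in> mhom V P"
    and S: "finite S" "S \<subseteq> carrier (V \<times>\<times> free_cmonoid r) \<times> carrier (V \<times>\<times> free_cmonoid r)"
      "\<And>x y. (x, y) \<in> S \<Longrightarrow> H x = H y"
    and gp_eq: "\<And>x y. \<lbrakk>x \<in> carrier (V \<times>\<times> free_cmonoid r); y \<in> carrier (V \<times>\<times> free_cmonoid r); H x = H y\<rbrakk> \<Longrightarrow>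
       \<exists>z\<in>carrier (V \<times>\<times> free_cmonoid r). (x \<otimes>\<^bsub>V \<times>\<times> free_cmonoid r\<^esub> z, y \<otimes>\<^bsub>V \<times>\<times> free_cmonoid r\<^esub> z)
         \<in> mcong_gen (V \<times>\<times> free_cmonoid r) S"
  obtains K where "finite K" "K \<subseteq> carrier V" "\<And>u. u \<in> K \<Longrightarrow> f u = \<one>\<^bsub>P\<^esub>"
    "\<And>R v w. \<lbrakk>mcong V R; \<And>u. u \<in> K \<Longrightarrow> (u, \<one>\<^bsub>V\<^esub>) \<in> R; v \<in> carrier V; w \<in> carrier V; f v = f w\<rbrakk> \<Longrightarrow> (v, w) \<in> R"
proof -
  let ?M = "V \<times>\<times> free_cmonoid r"
  have iV: "integral_monoid V" using V by (simp add: valuative_def)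
  interpret V: comm_monoid V using iV by (rule integral_monoid_comm)
  interpret P: comm_monoid P using P by (rule integral_monoid_comm)
  have iM: "integral_monoid ?M" by (rule integral_DirProd_free[OF iV])
  interpret M: comm_monoid ?M using iM by (rule integral_monoid_comm)
  show ?thesis
  proof (rule cancellative_congruence_bound[OF iM P H S])
    fix k c d assume c: "c \<in> mhom (free_cmonoid k) ?M" and d: "d \<in> mhom (free_cmonoid k) ?M"
      and Hcd: "\<And>m. m \<in> carrier (free_cmonoid k) \<Longrightarrow> H (c m) = H (d m)"
      and bound: "\<And>x y z. \<lbrakk>x \<in> carrier ?M; y \<in> carrier ?M; z \<in> carrier ?M; (x \<otimes>\<^bsub>?M\<^esub> z, y \<otimes>\<^bsub>?M\<^esub> z) \<in> mcong_gen ?M S\<rbrakk> \<Longrightarrow>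
        \<exists>m\<in>carrier (free_cmonoid k). \<exists>m'\<in>carrier (free_cmonoid k).
          x \<otimes>\<^bsub>?M\<^esub> (c m \<otimes>\<^bsub>?M\<^esub> d m') = y \<otimes>\<^bsub>?M\<^esub> (d m \<otimes>\<^bsub>?M\<^esub> c m')"
    define A where "A = (\<lambda>m m'. c m \<otimes>\<^bsub>?M\<^esub> d m')"
    define B where "B = (\<lambda>m m'. d m \<otimes>\<^bsub>?M\<^esub> c m')"
    let ?F = "carrier (free_cmonoid k)"
    have ABcl: "A m m' \<in> carrier ?M" "B m m' \<in> carrier ?M" if "m \<in> ?F" "m' \<in> ?F" for m m'
      unfolding A_def B_def using that mhomD(1)[OF c] mhomD(1)[OF d] by (blast intro: M.m_closed)+
    have ABadd: "A (m + n) (m' + n') = A m m' \<otimes>\<^bsub>?M\<^esub> A n n'"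
      "B (m + n) (m' + n') = B m m' \<otimes>\<^bsub>?M\<^esub> B n n'"
      if F: "m \<in> ?F" "m' \<in> ?F" "n \<in> ?F" "n' \<in> ?F" for m m' n n'
    proof -
      note cl = mhomD(1)[OF c] mhomD(1)[OF d]
      have e: "c (m + n) = c m \<otimes>\<^bsub>?M\<^esub> c n" "c (m' + n') = c m' \<otimes>\<^bsub>?M\<^esub> c n'"
        "d (m + n) = d m \<otimes>\<^bsub>?M\<^esub> d n" "d (m' + n') = d m' \<otimes>\<^bsub>?M\<^esub> d n'"
        using mhomD(2)[OF c] mhomD(2)[OF d] F by simp_all
      show "A (m + n) (m' + n') = A m m' \<otimes>\<^bsub>?M\<^esub> A n n'"
        unfolding A_def e by (rule swap_middle[OF M.comm_monoid_axioms]) (rule cl F)+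
      show "B (m + n) (m' + n') = B m m' \<otimes>\<^bsub>?M\<^esub> B n n'"
        unfolding B_def e by (rule swap_middle[OF M.comm_monoid_axioms]) (rule cl F)+
    qed
    define a where "a = (\<lambda>m m'. fst (A m m'))"
    define b where "b = (\<lambda>m m'. fst (B m m'))"
    have abcl [simp]: "a m m' \<in> carrier V" "b m m' \<in> carrier V" if "m \<in> ?F" "m' \<in> ?F" for m m'
      using ABcl[OF that] by (auto simp: a_def b_def simp del: free_cmonoid_simps)
    have abadd: "a (m + n) (m' + n') = a m m' \<otimes>\<^bsub>V\<^esub> a n n'" "b (m + n) (m' + n') = b m m' \<otimes>\<^bsub>V\<^esub> b n n'"
      if "m \<in> ?F" "m' \<in> ?F" "n \<in> ?F" "n' \<in> ?F" for m m' n n'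
      using ABadd[OF that] by (simp_all add: a_def b_def mult_DirProd')
    have ab0: "a 0 0 = \<one>\<^bsub>V\<^esub>" "b 0 0 = \<one>\<^bsub>V\<^esub>"
      using mhomD(3)[OF c] mhomD(3)[OF d] by (simp_all add: a_def b_def A_def B_def)
    define L where "L = {(m, m'). m \<in> ?F \<and> m' \<in> ?F \<and> snd (A m m') = snd (B m m')}"
    have LF: "m \<in> ?F" "m' \<in> ?F" "snd (A m m') = snd (B m m')" if "(m, m') \<in> L" for m m'
      using that by (simp_all add: L_def)
    have L: "subtractive k L"
      unfolding subtractive_def
    proof (intro conjI)
      show "L \<subseteq> ?F \<times> ?F" by (auto simp: L_def)
      have "(m - n, m' - n') \<in> L" if L: "(m, m') \<in> L" "(n, n') \<in> L" and le: "n \<le> m" "n' \<le> m'" for m m' n n'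
      proof -
        have F: "m - n \<in> ?F" "m' - n' \<in> ?F" "n \<in> ?F" "n' \<in> ?F"
          using LF[OF L(1)] LF[OF L(2)] by auto
        have eq: "(m - n) + n = m" "(m' - n') + n' = m'" using le by (auto simp: le_fun_def fun_eq_iff)
        have "snd (A (m - n) (m' - n')) + snd (A n n') = snd (A m m')"
          using ABadd(1)[OF F(1,2,3,4)] unfolding eq by (simp add: mult_DirProd')
        moreover have "snd (B (m - n) (m' - n')) + snd (B n n') = snd (B m m')"
          using ABadd(2)[OF F(1,2,3,4)] unfolding eq by (simp add: mult_DirProd')
        ultimately have "snd (A (m - n) (m' - n')) + snd (A n n') = snd (B (m - n) (m' - n')) + snd (A n n')"
          using LF(3)[OF L(1)] LF(3)[OF L(2)] by simp
        then show ?thesis using F by (simp add: L_def)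
      qed
      then show "\<forall>(m, m')\<in>L. \<forall>(n, n')\<in>L. n \<le> m \<longrightarrow> n' \<le> m' \<longrightarrow> (m - n, m' - n') \<in> L" by blast
    qed
    then obtain G where G: "divisor_basis L G"
      using divisor_basis_exists[of L k] unfolding subtractive_def by blast
    have fab: "f (a m m') = f (b m m')" if mL: "(m, m') \<in> L" for m m'
    proof -
      note F = LF(1,2)[OF mL]
      note Hcl = mhomD(1)[OF H]
      have "H (A m m') = H (B m m')"
        unfolding A_def B_def using Hcd F mhomD(1)[OF c] mhomD(1)[OF d] mhomD(2)[OF H] by simp
      moreover have split: "H x = f (fst x) \<otimes>\<^bsub>P\<^esub> H (\<one>\<^bsub>V\<^esub>, snd x)" if "x \<in> carrier ?M" for x
        using that f(1)[of "fst x"] mhomD(2)[OF H, of "(fst x, 0)" "(\<one>\<^bsub>V\<^esub>, snd x)"] by (cases x) auto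
      ultimately have "f (a m m') \<otimes>\<^bsub>P\<^esub> H (\<one>\<^bsub>V\<^esub>, snd (B m m')) = f (b m m') \<otimes>\<^bsub>P\<^esub> H (\<one>\<^bsub>V\<^esub>, snd (B m m'))"
        using ABcl[OF F] LF(3)[OF mL] by (simp add: a_def b_def)
      moreover have "(\<one>\<^bsub>V\<^esub>, snd (B m m')) \<in> carrier ?M" using ABcl(2)[OF F] by auto
      ultimately show ?thesis
        using integral_monoid_cancel[OF P, of "f (a m m')" "f (b m m')"] mhomD(1)[OF f(2)] abcl[OF F] Hcl by blast
    qed
    have "\<exists>u\<in>carrier V. f u = \<one>\<^bsub>P\<^esub> \<and> (a (fst g) (snd g) = b (fst g) (snd g) \<otimes>\<^bsub>V\<^esub> u \<or>
        b (fst g) (snd g) = a (fst g) (snd g) \<otimes>\<^bsub>V\<^esub> u)" if g: "g \<in> G" for g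
    proof -
      have gL: "(fst g, snd g) \<in> L" using G g by (auto simp: divisor_basis_def)
      let ?a = "a (fst g) (snd g)" and ?b = "b (fst g) (snd g)"
      have [simp]: "?a \<in> carrier V" "?b \<in> carrier V" using LF[OF gL] abcl by blast+
      have one: "f u = \<one>\<^bsub>P\<^esub>" if u: "u \<in> carrier V" and e: "f x = f x \<otimes>\<^bsub>P\<^esub> f u" and x: "x \<in> carrier V" for u x
        by (rule integral_monoid_cancel[OF P, where k = "f x"])
          (use mhomD(1)[OF f(2)] u x e P.m_comm in simp_all)
      consider u where "u \<in> carrier V" "?a = ?b \<otimes>\<^bsub>V\<^esub> u" | u where "u \<in> carrier V" "?b = ?a \<otimes>\<^bsub>V\<^esub> u"
        using valuative_total[OF V, of ?a ?b] by auto
      then show ?thesis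
      proof cases
        case (1 u)
        have "f ?b = f ?b \<otimes>\<^bsub>P\<^esub> f u" using fab[OF gL] 1 mhomD(2)[OF f(2), of ?b u] by simp
        then show ?thesis using one[of u ?b] 1 by auto
      next
        case (2 u)
        have "f ?a = f ?a \<otimes>\<^bsub>P\<^esub> f u" using fab[OF gL] 2 mhomD(2)[OF f(2), of ?a u] by simp
        then show ?thesis using one[of u ?a] 2 by auto
      qed
    qed
    then obtain \<kappa> where \<kappa>: "\<And>g. g \<in> G \<Longrightarrow> \<kappa> g \<in> carrier V" "\<And>g. g \<in> G \<Longrightarrow> f (\<kappa> g) = \<one>\<^bsub>P\<^esub>"
      "\<And>g. g \<in> G \<Longrightarrow> a (fst g) (snd g) = b (fst g) (snd g) \<otimes>\<^bsub>V\<^esub> \<kappa> g \<or>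
        b (fst g) (snd g) = a (fst g) (snd g) \<otimes>\<^bsub>V\<^esub> \<kappa> g" by metis
    show ?thesis
    proof (rule that[of "\<kappa> ` G"])
      show "finite (\<kappa> ` G)" using G by (simp add: divisor_basis_def)
      show "\<kappa> ` G \<subseteq> carrier V" using \<kappa>(1) by blast
      show "f u = \<one>\<^bsub>P\<^esub>" if "u \<in> \<kappa> ` G" for u using that \<kappa>(2) by blast
      fix R v w assume R: "mcong V R" and KR: "\<And>u. u \<in> \<kappa> ` G \<Longrightarrow> (u, \<one>\<^bsub>V\<^esub>) \<in> R"
        and vw: "v \<in> carrier V" "w \<in> carrier V" "f v = f w"
      have eqR: "equiv (carrier V) R" using R by (simp add: mcong_def)
      have absorb: "(x \<otimes>\<^bsub>V\<^esub> \<kappa> g, x) \<in> R" if "x \<in> carrier V" "g \<in> G" for x g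
      proof -
        have "(x, x) \<in> R" using eqR that(1) by (simp add: equiv_def refl_on_def)
        from mcong_mult[OF R this KR[of "\<kappa> g"]] that show ?thesis by simp
      qed
      have claim: "(v, w) \<in> R" if "(m, m') \<in> L" "v \<in> carrier V" "w \<in> carrier V"
        "v \<otimes>\<^bsub>V\<^esub> a m m' = w \<otimes>\<^bsub>V\<^esub> b m m'" for m m' v w
        using L G that(1) that(2-)
      proof (induction arbitrary: v w rule: subtractive_induct)
        case zero
        have "v \<otimes>\<^bsub>V\<^esub> a 0 0 = w \<otimes>\<^bsub>V\<^esub> b 0 0" by (rule zero.prems(3))
        then have "v = w" using zero.prems(1,2) ab0 by simp
        then show ?case using zero.prems eqR by (simp add: equiv_def refl_on_def)
      next
        case (add m m' n n')
        note F = LF(1,2)[OF add.hyps(1)] LF(1,2)[OF add.hyps(3)]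
        note [simp] = add.prems(1,2) abcl[OF F(1,2)] abcl[OF F(3,4)] \<kappa>(1)[OF add.hyps(2)]
        let ?u = "\<kappa> (n, n')"
        have "v \<otimes>\<^bsub>V\<^esub> a (m + n) (m' + n') = w \<otimes>\<^bsub>V\<^esub> b (m + n) (m' + n')" by (rule add.prems(3))
        then have e: "v \<otimes>\<^bsub>V\<^esub> (a m m' \<otimes>\<^bsub>V\<^esub> a n n') = w \<otimes>\<^bsub>V\<^esub> (b m m' \<otimes>\<^bsub>V\<^esub> b n n')"
          unfolding abadd[OF F] .
        from \<kappa>(3)[OF add.hyps(2)] have "a n n' = b n n' \<otimes>\<^bsub>V\<^esub> ?u \<or> b n n' = a n n' \<otimes>\<^bsub>V\<^esub> ?u" by simp
        then show ?case
        proof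
          assume u: "a n n' = b n n' \<otimes>\<^bsub>V\<^esub> ?u"
          have "(v \<otimes>\<^bsub>V\<^esub> ?u) \<otimes>\<^bsub>V\<^esub> a m m' = w \<otimes>\<^bsub>V\<^esub> b m m'"
            by (rule integral_monoid_cancel[OF iV, where k = "b n n'"]) (use e in \<open>simp_all add: u V.m_ac\<close>)
          then have "(v \<otimes>\<^bsub>V\<^esub> ?u, w) \<in> R" by (intro add.IH) simp_all
          then show ?thesis using absorb[OF add.prems(1) add.hyps(2)] eqR by (meson equivE symD transD)
        next
          assume u: "b n n' = a n n' \<otimes>\<^bsub>V\<^esub> ?u"
          have "v \<otimes>\<^bsub>V\<^esub> a m m' = (w \<otimes>\<^bsub>V\<^esub> ?u) \<otimes>\<^bsub>V\<^esub> b m m'"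
            by (rule integral_monoid_cancel[OF iV, where k = "a n n'"]) (use e in \<open>simp_all add: u V.m_ac\<close>)
          then have "(v, w \<otimes>\<^bsub>V\<^esub> ?u) \<in> R" by (intro add.IH) simp_all
          then show ?thesis using absorb[OF add.prems(2) add.hyps(2)] eqR by (meson equivE transD)
        qed
      qed
      have vM: "(v, 0) \<in> carrier ?M" "(w, 0) \<in> carrier ?M" using vw by simp_all
      have "H (v, 0) = H (w, 0)" using f(1) vw by simp
      from gp_eq[OF vM this] obtain z where "z \<in> carrier ?M"
        "((v, 0) \<otimes>\<^bsub>?M\<^esub> z, (w, 0) \<otimes>\<^bsub>?M\<^esub> z) \<in> mcong_gen ?M S" by blast
      from bound[OF vM this] obtain m m' where mm: "m \<in> ?F" "m' \<in> ?F"
        and e: "(v, 0) \<otimes>\<^bsub>?M\<^esub> A m m' = (w, 0) \<otimes>\<^bsub>?M\<^esub> B m m'" unfolding A_def B_def by blast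
      have "(m, m') \<in> L" "v \<otimes>\<^bsub>V\<^esub> a m m' = w \<otimes>\<^bsub>V\<^esub> b m m'"
        using e mm by (auto simp: L_def a_def b_def mult_DirProd')
      then show "(v, w) \<in> R" using claim vw by blast
    qed
  qed
qed

section \<open>Finite generation implies finite presentation\<close>

text \<open>
  Let \<open>(x, c) \<sim> (y, d)\<close> be the chosen relation of a basis element, say with \<open>y = 1\<close>. A relation
  \<open>(v, a + c) \<sim> (w, b + d)\<close> to be derived yields, after division in \<open>P\<close>, the shorter relation
  \<open>(v, a) \<sim> (w x, b)\<close>. The derivation then reads
  \<open>(w, b + d) \<sim> (w x, b + c) \<sim> (v, a + c)\<close> and uses no cancellation in the quotient, which is not known
  to be cancellative at this point. The case \<open>x = 1\<close> is symmetric.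
\<close>

lemma fin_pres_of_generators:
  fixes V :: "'v monoid" and P :: "'p monoid"
  assumes V: "valuative V" and P: "integral_monoid P" and f: "f \<in> mhom V P"
    and \<theta>: "\<theta> \<in> mhom (free_cmonoid r) P"
    and gen: "\<And>p. p \<in> carrier P \<Longrightarrow> \<exists>v\<in>carrier V. \<exists>m\<in>carrier (free_cmonoid r). p = f v \<otimes>\<^bsub>P\<^esub> \<theta> m"
    and K: "finite K" "K \<subseteq> carrier V" "\<And>u. u \<in> K \<Longrightarrow> f u = \<one>\<^bsub>P\<^esub>"
    and kernel: "\<And>R v w. \<lbrakk>mcong V R; \<And>u. u \<in> K \<Longrightarrow> (u, \<one>\<^bsub>V\<^esub>) \<in> R; v \<in> carrier V; w \<in> carrier V; f v = f w\<rbrakk> \<Longrightarrow> (v, w) \<in> R"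
  shows "fin_pres V P f"
proof -
  let ?F = "carrier (free_cmonoid r)"
  let ?M = "V \<times>\<times> free_cmonoid r"
  have iV: "integral_monoid V" using V by (simp add: valuative_def)
  interpret V: comm_monoid V using iV by (rule integral_monoid_comm)
  interpret P: comm_monoid P using P by (rule integral_monoid_comm)
  interpret M: comm_monoid ?M by (rule comm_monoid_DirProd[OF V.comm_monoid_axioms free_cmonoid_comm_monoid])
  note fcl = mhomD(1)[OF f] and \<theta>cl = mhomD(1)[OF \<theta>]
  define H where "H = (\<lambda>(v, m). f v \<otimes>\<^bsub>P\<^esub> \<theta> m)"
  have H: "H \<in> mhom ?M P"
  proof (rule mhomI)
    fix x y assume x: "x \<in> carrier ?M" and y: "y \<in> carrier ?M"
    obtain v m w n where e: "x = (v, m)" "y = (w, n)" by fastforce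
    have vm: "v \<in> carrier V" "w \<in> carrier V" "m \<in> ?F" "n \<in> ?F" using x y e by auto
    show "H x \<in> carrier P" using vm fcl \<theta>cl by (simp add: H_def e)
    show "H (x \<otimes>\<^bsub>?M\<^esub> y) = H x \<otimes>\<^bsub>P\<^esub> H y"
      using mhomD(2)[OF f vm(1,2)] mhomD(2)[OF \<theta> vm(3,4)]
        swap_middle[OF P.comm_monoid_axioms fcl[OF vm(1)] fcl[OF vm(2)] \<theta>cl[OF vm(3)] \<theta>cl[OF vm(4)]]
      by (simp add: H_def e)
  qed (use mhomD(3)[OF f] mhomD(3)[OF \<theta>] in \<open>simp add: H_def\<close>)
  note Hcl = mhomD(1)[OF H]
  define L where "L = {(m, n). m \<in> ?F \<and> n \<in> ?F \<and> (\<exists>v\<in>carrier V. \<exists>w\<in>carrier V. H (v, m) = H (w, n))}"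
  have LI: "(m, n) \<in> L" if "m \<in> ?F" "n \<in> ?F" "v \<in> carrier V" "w \<in> carrier V" "H (v, m) = H (w, n)" for m n v w
    using that unfolding L_def by blast
  have LF: "m \<in> ?F" "n \<in> ?F" if "(m, n) \<in> L" for m n using that by (simp_all add: L_def)
  have diff: "H (v \<otimes>\<^bsub>V\<^esub> y, a) = H (w \<otimes>\<^bsub>V\<^esub> x, b)"
    if cl: "v \<in> carrier V" "w \<in> carrier V" "x \<in> carrier V" "y \<in> carrier V" "a \<in> ?F" "b \<in> ?F" "c \<in> ?F" "d \<in> ?F"
      and e: "H (v, a + c) = H (w, b + d)" "H (x, c) = H (y, d)" for v w x y a b c d
  proof (rule integral_monoid_cancel[OF P])
    have "H (v \<otimes>\<^bsub>V\<^esub> y, a) \<otimes>\<^bsub>P\<^esub> (H (x, c) \<otimes>\<^bsub>P\<^esub> H (\<one>\<^bsub>V\<^esub>, d)) = H (v, a + c) \<otimes>\<^bsub>P\<^esub> H (x \<otimes>\<^bsub>V\<^esub> y, d)"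
      using cl by (simp add: mhomD(2)[OF H, symmetric] V.m_ac add_ac)
    also have "\<dots> = H (w \<otimes>\<^bsub>V\<^esub> x, b) \<otimes>\<^bsub>P\<^esub> (H (y, d) \<otimes>\<^bsub>P\<^esub> H (\<one>\<^bsub>V\<^esub>, d))"
      unfolding e using cl by (simp add: mhomD(2)[OF H, symmetric] V.m_ac add_ac)
    finally show "H (v \<otimes>\<^bsub>V\<^esub> y, a) \<otimes>\<^bsub>P\<^esub> (H (x, c) \<otimes>\<^bsub>P\<^esub> H (\<one>\<^bsub>V\<^esub>, d))
        = H (w \<otimes>\<^bsub>V\<^esub> x, b) \<otimes>\<^bsub>P\<^esub> (H (x, c) \<otimes>\<^bsub>P\<^esub> H (\<one>\<^bsub>V\<^esub>, d))" unfolding e(2) .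
  qed (use cl Hcl in simp_all)
  have L: "subtractive r L"
    unfolding subtractive_def
  proof (intro conjI)
    show "L \<subseteq> ?F \<times> ?F" by (auto simp: L_def)
    have "(m - c, n - d) \<in> L" if mn: "(m, n) \<in> L" and cd: "(c, d) \<in> L" and le: "c \<le> m" "d \<le> n" for m n c d
    proof -
      obtain v w where vw: "v \<in> carrier V" "w \<in> carrier V" "H (v, m) = H (w, n)"
        using mn unfolding L_def by blast
      obtain x y where xy: "x \<in> carrier V" "y \<in> carrier V" "H (x, c) = H (y, d)"
        using cd unfolding L_def by blast
      have F: "m - c \<in> ?F" "n - d \<in> ?F" using LF[OF mn] by auto
      have eq: "(m - c) + c = m" "(n - d) + d = n" using le by (auto simp: le_fun_def fun_eq_iff)
      have "H (v \<otimes>\<^bsub>V\<^esub> y, m - c) = H (w \<otimes>\<^bsub>V\<^esub> x, n - d)"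
        by (rule diff[OF vw(1,2) xy(1,2) F LF[OF cd] _ xy(3)]) (unfold eq, rule vw(3))
      then show ?thesis using F vw xy by (intro LI) simp_all
    qed
    then show "\<forall>(m, n)\<in>L. \<forall>(c, d)\<in>L. c \<le> m \<longrightarrow> d \<le> n \<longrightarrow> (m - c, n - d) \<in> L" by blast
  qed
  then obtain G where G: "divisor_basis L G"
    using divisor_basis_exists[of L r] unfolding subtractive_def by blast
  have "\<exists>x\<in>carrier V. \<exists>y\<in>carrier V. (x = \<one>\<^bsub>V\<^esub> \<or> y = \<one>\<^bsub>V\<^esub>) \<and> H (x, fst g) = H (y, snd g)"
    if g: "g \<in> G" for g
  proof -
    have gL: "(fst g, snd g) \<in> L" using G g by (auto simp: divisor_basis_def)
    note F = LF[OF gL]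
    obtain x y where xy: "x \<in> carrier V" "y \<in> carrier V" "H (x, fst g) = H (y, snd g)"
      using gL unfolding L_def by blast
    have cancel: "H (z, c) = H (z', d)"
      if "z \<in> carrier V" "z' \<in> carrier V" "t \<in> carrier V" "c \<in> ?F" "d \<in> ?F"
        "H (z \<otimes>\<^bsub>V\<^esub> t, c) = H (z' \<otimes>\<^bsub>V\<^esub> t, d)" for z z' t c d
      by (rule integral_monoid_cancel[OF P, where k = "H (t, 0)"])
        (use that Hcl in \<open>simp_all add: mhomD(2)[OF H, symmetric]\<close>)
    consider z where "z \<in> carrier V" "x = y \<otimes>\<^bsub>V\<^esub> z" | z where "z \<in> carrier V" "y = x \<otimes>\<^bsub>V\<^esub> z"
      using valuative_total[OF V xy(1,2)] by blast
    then show ?thesis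
    proof cases
      case (1 z)
      then have "H (z, fst g) = H (\<one>\<^bsub>V\<^esub>, snd g)"
        using cancel[of z "\<one>\<^bsub>V\<^esub>" y "fst g" "snd g"] xy F by (simp add: V.m_comm)
      then show ?thesis using 1(1) V.one_closed by blast
    next
      case (2 z)
      then have "H (\<one>\<^bsub>V\<^esub>, fst g) = H (z, snd g)"
        using cancel[of "\<one>\<^bsub>V\<^esub>" z x "fst g" "snd g"] xy F by (simp add: V.m_comm)
      then show ?thesis using 2(1) V.one_closed by blast
    qed
  qed
  then obtain X Y where XY: "\<And>g. g \<in> G \<Longrightarrow> X g \<in> carrier V" "\<And>g. g \<in> G \<Longrightarrow> Y g \<in> carrier V"
    "\<And>g. g \<in> G \<Longrightarrow> X g = \<one>\<^bsub>V\<^esub> \<or> Y g = \<one>\<^bsub>V\<^esub>" "\<And>g. g \<in> G \<Longrightarrow> H (X g, fst g) = H (Y g, snd g)"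
    by metis
  define S where "S = (\<lambda>u. ((u, 0 :: nat \<Rightarrow> nat), (\<one>\<^bsub>V\<^esub>, 0 :: nat \<Rightarrow> nat))) ` K \<union>
    (\<lambda>g. ((X g, fst g), (Y g, snd g))) ` G"
  let ?C = "mcong_gen ?M S"
  have finS: "finite S" using K(1) G by (simp add: S_def divisor_basis_def)
  have gF: "fst g \<in> ?F" "snd g \<in> ?F" if "g \<in> G" for g
    using LF[of "fst g" "snd g"] G that by (auto simp: divisor_basis_def)
  have SM: "S \<subseteq> carrier ?M \<times> carrier ?M"
    using K(2) XY(1,2) gF by (auto simp: S_def simp del: free_cmonoid_simps(1)) auto
  have C: "mcong ?M ?C" by (rule mcong_gen_mcong[OF M.monoid_axioms SM])
  then have eqC: "equiv (carrier ?M) ?C" by (simp add: mcong_def)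
  have Crefl: "(x, x) \<in> ?C" if "x \<in> carrier ?M" for x
    using eqC that unfolding equiv_def refl_on_def by blast
  have Csym: "(y, x) \<in> ?C" if "(x, y) \<in> ?C" for x y using eqC that by (meson equivE symD)
  have Ctrans: "(x, z) \<in> ?C" if "(x, y) \<in> ?C" "(y, z) \<in> ?C" for x y z using eqC that by (meson equivE transD)
  have HS: "H x = H y" if "(x, y) \<in> S" for x y
    using that XY(4) K(3) mhomD(3)[OF f] by (auto simp: S_def H_def)
  have base: "((v, 0), (w, 0)) \<in> ?C" if vw: "v \<in> carrier V" "w \<in> carrier V" "f v = f w" for v w
  proof -
    define R where "R = {(v, w). ((v, 0 :: nat \<Rightarrow> nat), (w, 0 :: nat \<Rightarrow> nat)) \<in> ?C}"
    have "mcong V R"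
      unfolding mcong_def
    proof (intro conjI)
      have sub: "?C \<subseteq> carrier ?M \<times> carrier ?M" by (rule equiv_type[OF eqC])
      show "equiv (carrier V) R"
      proof (rule equivI)
        show "R \<subseteq> carrier V \<times> carrier V" using sub by (auto simp: R_def)
        show "refl_on (carrier V) R" using Crefl by (simp add: R_def refl_on_def)
        show "sym R" by (rule symI) (use Csym in \<open>simp add: R_def\<close>)
        show "trans R" by (rule transI) (use Ctrans in \<open>simp add: R_def; blast\<close>)
      qed
      have "(a \<otimes>\<^bsub>V\<^esub> c, b \<otimes>\<^bsub>V\<^esub> d) \<in> R" if "(a, b) \<in> R" "(c, d) \<in> R" for a b c d
        using mcong_mult[OF C, of "(a, 0)" "(b, 0)" "(c, 0)" "(d, 0)"] that by (simp add: R_def)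
      then show "\<forall>(a, b)\<in>R. \<forall>(c, d)\<in>R. (a \<otimes>\<^bsub>V\<^esub> c, b \<otimes>\<^bsub>V\<^esub> d) \<in> R" by blast
    qed
    moreover have "(u, \<one>\<^bsub>V\<^esub>) \<in> R" if "u \<in> K" for u
      using mcong_gen_incl[of S ?M] that by (auto simp: R_def S_def)
    ultimately have "(v, w) \<in> R" using kernel vw by blast
    then show ?thesis by (simp add: R_def)
  qed
  have claim: "((v, m), (w, n)) \<in> ?C"
    if mn: "(m, n) \<in> L" and vw: "v \<in> carrier V" "w \<in> carrier V" "H (v, m) = H (w, n)" for v m w n
    using L G mn vw
  proof (induction arbitrary: v w rule: subtractive_induct)
    case zero
    have "H (v, 0) = H (w, 0)" by (rule zero.prems(3))
    then have "f v = f w" using zero.prems(1,2) fcl mhomD(3)[OF \<theta>] by (simp add: H_def)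
    then have "((v, 0), (w, 0)) \<in> ?C" using base zero.prems by blast
    then show ?case .
  next
    case (add a b c d)
    let ?x = "X (c, d)" and ?y = "Y (c, d)"
    note F = LF[OF add.hyps(1)] LF[OF add.hyps(3)]
    note cl = add.prems(1,2) XY(1,2)[OF add.hyps(2)]
    have e: "H (v, a + c) = H (w, b + d)" by (rule add.prems(3))
    have g: "H (?x, c) = H (?y, d)" using XY(4)[OF add.hyps(2)] by simp
    have IH: "((v \<otimes>\<^bsub>V\<^esub> ?y, a), (w \<otimes>\<^bsub>V\<^esub> ?x, b)) \<in> ?C"
      using diff[OF cl F e g] cl by (intro add.IH) simp_all
    have S: "((?x, c), (?y, d)) \<in> ?C"
      using mcong_gen_incl[of S ?M] add.hyps(2) by (auto simp: S_def)
    have mult: "((s \<otimes>\<^bsub>V\<^esub> t, i + j), (s' \<otimes>\<^bsub>V\<^esub> t', i' + j')) \<in> ?C"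
      if "((s, i), (s', i')) \<in> ?C" "((t, j), (t', j')) \<in> ?C" for s t i j s' t' i' j'
      using mcong_mult[OF C that] by simp
    have "((v, a + c), (w, b + d)) \<in> ?C"
      using XY(3)[OF add.hyps(2)]
    proof
      assume x: "?x = \<one>\<^bsub>V\<^esub>"
      have 1: "((v \<otimes>\<^bsub>V\<^esub> \<one>\<^bsub>V\<^esub>, a + c), (v \<otimes>\<^bsub>V\<^esub> ?y, a + d)) \<in> ?C"
        using S F cl unfolding x by (intro mult Crefl) simp_all
      have 2: "((v \<otimes>\<^bsub>V\<^esub> ?y \<otimes>\<^bsub>V\<^esub> \<one>\<^bsub>V\<^esub>, a + d), (w \<otimes>\<^bsub>V\<^esub> ?x \<otimes>\<^bsub>V\<^esub> \<one>\<^bsub>V\<^esub>, b + d)) \<in> ?C"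
        using IH F by (intro mult Crefl) simp_all
      have "((v, a + c), (v \<otimes>\<^bsub>V\<^esub> ?y, a + d)) \<in> ?C" using 1 cl by simp
      moreover have "((v \<otimes>\<^bsub>V\<^esub> ?y, a + d), (w, b + d)) \<in> ?C" using 2 cl x by simp
      ultimately show ?thesis by (rule Ctrans)
    next
      assume y: "?y = \<one>\<^bsub>V\<^esub>"
      have 1: "((w \<otimes>\<^bsub>V\<^esub> \<one>\<^bsub>V\<^esub>, b + d), (w \<otimes>\<^bsub>V\<^esub> ?x, b + c)) \<in> ?C"
        using Csym[OF S] F cl unfolding y by (intro mult Crefl) simp_all
      have 2: "((w \<otimes>\<^bsub>V\<^esub> ?x \<otimes>\<^bsub>V\<^esub> \<one>\<^bsub>V\<^esub>, b + c), (v \<otimes>\<^bsub>V\<^esub> ?y \<otimes>\<^bsub>V\<^esub> \<one>\<^bsub>V\<^esub>, a + c)) \<in> ?C"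
        using Csym[OF IH] F by (intro mult Crefl) simp_all
      have "((w, b + d), (w \<otimes>\<^bsub>V\<^esub> ?x, b + c)) \<in> ?C" using 1 cl by simp
      moreover have "((w \<otimes>\<^bsub>V\<^esub> ?x, b + c), (v, a + c)) \<in> ?C" using 2 cl y by simp
      ultimately have "((w, b + d), (v, a + c)) \<in> ?C" by (rule Ctrans)
      then show ?thesis by (rule Csym)
    qed
    then show ?case .
  qed
  obtain \<phi> where \<phi>: "\<phi> \<in> mhom (mquot ?M ?C) P" "\<And>x. x \<in> carrier ?M \<Longrightarrow> \<phi> (?C `` {x}) = H x"
    using mquot_gen_lift[OF M.monoid_axioms SM H HS] by blast
  have "bij_betw \<phi> (carrier (mquot ?M ?C)) (carrier P)"
    unfolding bij_betw_def
  proof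
    show "inj_on \<phi> (carrier (mquot ?M ?C))"
    proof (rule inj_onI)
      fix A B assume AB: "A \<in> carrier (mquot ?M ?C)" "B \<in> carrier (mquot ?M ?C)" "\<phi> A = \<phi> B"
      obtain x y where x: "x \<in> carrier ?M" "A = ?C `` {x}" and y: "y \<in> carrier ?M" "B = ?C `` {y}"
        using AB(1,2) unfolding mquot_carrier by blast
      obtain v m w n where e: "x = (v, m)" "y = (w, n)" by fastforce
      have cl: "v \<in> carrier V" "w \<in> carrier V" "m \<in> ?F" "n \<in> ?F" using x(1) y(1) e by auto
      have "H (v, m) = H (w, n)" using AB(3) \<phi>(2) x y e by simp
      then have "(x, y) \<in> ?C" unfolding e using cl by (intro claim LI) simp_all
      then show "A = B" unfolding x(2) y(2) by (rule equiv_class_eq[OF eqC])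
    qed
    show "\<phi> ` carrier (mquot ?M ?C) = carrier P"
    proof
      show "\<phi> ` carrier (mquot ?M ?C) \<subseteq> carrier P" using mhomD(1)[OF \<phi>(1)] by blast
      show "carrier P \<subseteq> \<phi> ` carrier (mquot ?M ?C)"
      proof
        fix p assume "p \<in> carrier P"
        then obtain v m where vm: "v \<in> carrier V" "m \<in> ?F" "p = f v \<otimes>\<^bsub>P\<^esub> \<theta> m" using gen by blast
        then have "(v, m) \<in> carrier ?M" "p = H (v, m)" by (simp_all add: H_def)
        then have "p = \<phi> (?C `` {(v, m)})" "?C `` {(v, m)} \<in> carrier (mquot ?M ?C)"
          using \<phi>(2)[of "(v, m)"] unfolding mquot_carrier by (simp_all only: image_eqI)
        then show "p \<in> \<phi> ` carrier (mquot ?M ?C)" by blast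
      qed
    qed
  qed
  then have "\<phi> \<in> iso (mquot ?M ?C) P" using \<phi>(1) by (simp add: iso_def mhom_def)
  moreover have "\<phi> (?C `` {(p, \<one>\<^bsub>free_cmonoid r\<^esub>)}) = f p" if "p \<in> carrier V" for p
    using \<phi>(2)[of "(p, 0)"] that mhomD(3)[OF \<theta>] fcl[OF that] by (simp add: H_def)
  ultimately show ?thesis
    unfolding fin_pres_def using V.comm_monoid_axioms P.comm_monoid_axioms f finS SM by blast
qed

section \<open>The part of the target in the group generated by the source\<close>

text \<open>
  The intersection of \<open>P\<close> with the group generated by the image of \<open>V\<close>.
\<close>

definition base_part :: "'v monoid \<Rightarrow> 'p monoid \<Rightarrow> ('v \<Rightarrow> 'p) \<Rightarrow> 'p set" where
  "base_part V P f = {p \<in> carrier P. \<exists>v\<in>carrier V. \<exists>w\<in>carrier V. p \<otimes>\<^bsub>P\<^esub> f v = f w}"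

context
  fixes V :: "'v monoid" and P :: "'p monoid" and f
  assumes V: "valuative V" and P: "integral_monoid P" and f: "f \<in> mhom V P"
begin

interpretation V: comm_monoid V using V by (simp add: valuative_def integral_monoid_def)
interpretation P: comm_monoid P using P by (rule integral_monoid_comm)

private lemma fcl [simp]: "v \<in> carrier V \<Longrightarrow> f v \<in> carrier P"
  using mhomD(1)[OF f] .

private lemma fmult: "v \<in> carrier V \<Longrightarrow> w \<in> carrier V \<Longrightarrow> f (v \<otimes>\<^bsub>V\<^esub> w) = f v \<otimes>\<^bsub>P\<^esub> f w"
  using mhomD(2)[OF f] .

lemma base_partI:
  "\<lbrakk>p \<in> carrier P; v \<in> carrier V; w \<in> carrier V; p \<otimes>\<^bsub>P\<^esub> f v = f w\<rbrakk> \<Longrightarrow> p \<in> base_part V P f"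
  unfolding base_part_def by blast

text \<open>
  One of \<open>v\<close> and \<open>w\<close> divides the other; cancel it in \<open>p f(v) = f(w)\<close>.
\<close>

lemma base_part_cases:
  assumes "p \<in> base_part V P f"
  obtains x where "x \<in> carrier V" "p = f x" | x where "x \<in> carrier V" "p \<otimes>\<^bsub>P\<^esub> f x = \<one>\<^bsub>P\<^esub>"
proof -
  obtain v w where p [simp]: "p \<in> carrier P" "v \<in> carrier V" "w \<in> carrier V" and e: "p \<otimes>\<^bsub>P\<^esub> f v = f w"
    using assms unfolding base_part_def by blast
  consider x where "x \<in> carrier V" "v = w \<otimes>\<^bsub>V\<^esub> x" | x where "x \<in> carrier V" "w = v \<otimes>\<^bsub>V\<^esub> x"
    using valuative_total[OF V p(2,3)] by blast
  then show ?thesis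
  proof cases
    case (1 x)
    have "p \<otimes>\<^bsub>P\<^esub> f x = \<one>\<^bsub>P\<^esub>"
      by (rule integral_monoid_cancel[OF P, where k = "f w"]) (use 1 e in \<open>simp_all add: fmult P.m_ac\<close>)
    with 1 that show ?thesis by blast
  next
    case (2 x)
    have "p = f x"
      by (rule integral_monoid_cancel[OF P, where k = "f v"]) (use 2 e in \<open>simp_all add: fmult P.m_ac\<close>)
    with 2 that show ?thesis by blast
  qed
qed

lemma base_part_source: "v \<in> carrier V \<Longrightarrow> f v \<in> base_part V P f"
  by (rule base_partI[of _ "\<one>\<^bsub>V\<^esub>" v]) (simp_all add: mhomD(3)[OF f])

lemma base_part_closed: "p \<in> base_part V P f \<Longrightarrow> p \<in> carrier P"
  by (simp add: base_part_def)

lemma base_part_mult: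
  assumes "p \<in> base_part V P f" "q \<in> base_part V P f"
  shows "p \<otimes>\<^bsub>P\<^esub> q \<in> base_part V P f"
proof -
  obtain v w where p [simp]: "p \<in> carrier P" "v \<in> carrier V" "w \<in> carrier V" and e: "p \<otimes>\<^bsub>P\<^esub> f v = f w"
    using assms(1) unfolding base_part_def by blast
  obtain v' w' where q [simp]: "q \<in> carrier P" "v' \<in> carrier V" "w' \<in> carrier V" and e': "q \<otimes>\<^bsub>P\<^esub> f v' = f w'"
    using assms(2) unfolding base_part_def by blast
  have "p \<otimes>\<^bsub>P\<^esub> q \<otimes>\<^bsub>P\<^esub> f (v \<otimes>\<^bsub>V\<^esub> v') = (p \<otimes>\<^bsub>P\<^esub> f v) \<otimes>\<^bsub>P\<^esub> (q \<otimes>\<^bsub>P\<^esub> f v')"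
    by (simp add: fmult P.m_ac)
  also have "\<dots> = f (w \<otimes>\<^bsub>V\<^esub> w')" unfolding e e' by (simp add: fmult)
  finally show ?thesis by (intro base_partI[of _ "v \<otimes>\<^bsub>V\<^esub> v'" "w \<otimes>\<^bsub>V\<^esub> w'"]) simp_all
qed

lemma base_part_pow: "p \<in> base_part V P f \<Longrightarrow> p [^]\<^bsub>P\<^esub> (n::nat) \<in> base_part V P f"
  using base_part_source[of "\<one>\<^bsub>V\<^esub>"] by (induction n) (simp_all add: base_part_mult mhomD(3)[OF f])

lemma base_part_exact:
  assumes "p \<in> carrier P" "q \<in> base_part V P f" "p \<otimes>\<^bsub>P\<^esub> q \<in> base_part V P f"
  shows "p \<in> base_part V P f"
proof -
  note [simp] = assms(1) base_part_closed[OF assms(2)]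
  obtain v w where p [simp]: "v \<in> carrier V" "w \<in> carrier V" and e: "p \<otimes>\<^bsub>P\<^esub> q \<otimes>\<^bsub>P\<^esub> f v = f w"
    using assms(3) unfolding base_part_def by blast
  from assms(2) show ?thesis
  proof (cases rule: base_part_cases)
    case (1 x)
    then have "p \<otimes>\<^bsub>P\<^esub> f (x \<otimes>\<^bsub>V\<^esub> v) = f w" using e by (simp add: fmult P.m_ac)
    then show ?thesis using 1 by (intro base_partI[of _ "x \<otimes>\<^bsub>V\<^esub> v" w]) simp_all
  next
    case (2 x)
    have "p \<otimes>\<^bsub>P\<^esub> f v = p \<otimes>\<^bsub>P\<^esub> f v \<otimes>\<^bsub>P\<^esub> (q \<otimes>\<^bsub>P\<^esub> f x)" using 2 by simp
    also have "\<dots> = (p \<otimes>\<^bsub>P\<^esub> q \<otimes>\<^bsub>P\<^esub> f v) \<otimes>\<^bsub>P\<^esub> f x" using 2(1) by (simp add: P.m_ac)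
    also have "\<dots> = f (w \<otimes>\<^bsub>V\<^esub> x)" unfolding e using 2(1) by (simp add: fmult)
    finally show ?thesis using 2(1) by (intro base_partI[of _ v "w \<otimes>\<^bsub>V\<^esub> x"]) simp_all
  qed
qed

lemma base_part_total:
  assumes "p \<in> base_part V P f" "q \<in> base_part V P f"
  shows "\<exists>z\<in>base_part V P f. p = q \<otimes>\<^bsub>P\<^esub> z \<or> q = p \<otimes>\<^bsub>P\<^esub> z"
proof -
  have unit: "\<exists>z\<in>base_part V P f. s = t \<otimes>\<^bsub>P\<^esub> z"
    if s: "s \<in> base_part V P f" and t: "t \<in> base_part V P f" and x: "x \<in> carrier V" "t \<otimes>\<^bsub>P\<^esub> f x = \<one>\<^bsub>P\<^esub>" for s t x
  proof (rule bexI)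
    show "s = t \<otimes>\<^bsub>P\<^esub> (f x \<otimes>\<^bsub>P\<^esub> s)"
      using x base_part_closed[OF s] base_part_closed[OF t] by (simp flip: P.m_assoc)
    show "f x \<otimes>\<^bsub>P\<^esub> s \<in> base_part V P f" using x(1) s by (intro base_part_mult base_part_source)
  qed
  from assms(2) show ?thesis
  proof (cases rule: base_part_cases)
    case (2 x)
    then show ?thesis using unit[OF assms] by blast
  next
    case q: (1 y)
    from assms(1) show ?thesis
    proof (cases rule: base_part_cases)
      case (2 x)
      then show ?thesis using unit[OF assms(2,1)] by blast
    next
      case p: (1 x)
      consider z where "z \<in> carrier V" "x = y \<otimes>\<^bsub>V\<^esub> z" | z where "z \<in> carrier V" "y = x \<otimes>\<^bsub>V\<^esub> z"
        using valuative_total[OF V p(1) q(1)] by blast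
      then show ?thesis using p q base_part_source by cases (auto simp: fmult)
    qed
  qed
qed

lemma base_part_divisible:
  assumes div: "divisible_monoid V" and p: "p \<in> base_part V P f" and n: "n \<ge> 1"
  shows "\<exists>q\<in>base_part V P f. p = q [^]\<^bsub>P\<^esub> (n::nat)"
  using p
proof (cases rule: base_part_cases)
  case (1 x)
  obtain y where y: "y \<in> carrier V" "x = y [^]\<^bsub>V\<^esub> n" using divisible_root[OF div 1(1) n] .
  have "p = f y [^]\<^bsub>P\<^esub> n" unfolding 1(2) y(2) by (rule mhom_pow[OF V.monoid_axioms f y(1)])
  then show ?thesis using base_part_source[OF y(1)] by blast
next
  case (2 x)
  note [simp] = base_part_closed[OF p]
  obtain y where y: "y \<in> carrier V" "x = y [^]\<^bsub>V\<^esub> n" using divisible_root[OF div 2(1) n] .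
  obtain m where m: "n = Suc m" using n by (cases n) auto
  have fx: "f x = f y [^]\<^bsub>P\<^esub> n" unfolding y(2) by (rule mhom_pow[OF V.monoid_axioms f y(1)])
  let ?q = "p \<otimes>\<^bsub>P\<^esub> f y [^]\<^bsub>P\<^esub> m"
  have qy: "?q \<otimes>\<^bsub>P\<^esub> f y = \<one>\<^bsub>P\<^esub>" using 2(2) y(1) unfolding fx m by (simp add: P.m_assoc)
  have "?q [^]\<^bsub>P\<^esub> n = p"
  proof (rule integral_monoid_cancel[OF P, where k = "f x"])
    have "?q [^]\<^bsub>P\<^esub> n \<otimes>\<^bsub>P\<^esub> f x = (?q \<otimes>\<^bsub>P\<^esub> f y) [^]\<^bsub>P\<^esub> n"
      unfolding fx using y(1) by (simp add: P.nat_pow_distrib)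
    then show "?q [^]\<^bsub>P\<^esub> n \<otimes>\<^bsub>P\<^esub> f x = p \<otimes>\<^bsub>P\<^esub> f x" unfolding qy using 2(2) by simp
  qed (use y(1) 2(1) in simp_all)
  moreover have "?q \<in> base_part V P f"
    using y(1) p by (intro base_part_mult base_part_pow base_part_source)
  ultimately show ?thesis by metis
qed

text \<open>
  The monomials in the base part are generated by finitely many, each of which is the image or
  the inverse of the image of an element of \<open>V\<close>. Let \<open>x\<close> be the product of the elements inverted in this
  way. Multiplying a monomial of the base part by a high power of \<open>f(x)\<close> gives an element of \<open>f(V)\<close>.
  As some power of \<open>p\<close> is such a monomial times an element of \<open>f(V)\<close>, the same follows for
  \<open>p f(x)^a\<close>, and the inverse \<open>\<omega>\<close> of \<open>f(x)\<close> suffices as an additional generator.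
\<close>

lemma base_part_generated:
  assumes \<theta>: "\<theta> \<in> mhom (free_cmonoid r) P"
    and reach: "\<And>p. p \<in> carrier P \<Longrightarrow> \<exists>n\<ge>1. \<exists>v\<in>carrier V. \<exists>m\<in>carrier (free_cmonoid r).
      p [^]\<^bsub>P\<^esub> (n::nat) = f v \<otimes>\<^bsub>P\<^esub> \<theta> m"
  obtains \<omega> where "\<omega> \<in> carrier P" "base_part V P f \<subseteq> mspan P (f ` carrier V \<union> {\<omega>})"
proof -
  let ?W = "base_part V P f"
  let ?F = "carrier (free_cmonoid r)"
  note \<theta>cl = mhomD(1)[OF \<theta>]
  define L where "L = {(m, n). m \<in> ?F \<and> n = (0 :: nat \<Rightarrow> nat) \<and> \<theta> m \<in> ?W}"
  have L: "subtractive r L"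
    unfolding subtractive_def
  proof (intro conjI)
    show "L \<subseteq> ?F \<times> ?F" by (auto simp: L_def)
    have "(m - c, n - d) \<in> L" if mn: "(m, n) \<in> L" and cd: "(c, d) \<in> L" and le: "c \<le> m" for m n c d
    proof -
      have F: "m - c \<in> ?F" "c \<in> ?F" "m \<in> ?F" using mn cd by (auto simp: L_def)
      have "(m - c) + c = m" using le by (auto simp: le_fun_def fun_eq_iff)
      then have "\<theta> (m - c) \<otimes>\<^bsub>P\<^esub> \<theta> c = \<theta> m" using mhomD(2)[OF \<theta> F(1,2)] by simp
      then have "\<theta> (m - c) \<in> ?W"
        using base_part_exact[OF \<theta>cl[OF F(1)], of "\<theta> c"] mn cd by (simp add: L_def)
      then show ?thesis using mn cd F by (auto simp: L_def)
    qed
    then show "\<forall>(a, b)\<in>L. \<forall>(c, d)\<in>L. c \<le> a \<longrightarrow> d \<le> b \<longrightarrow> (a - c, b - d) \<in> L" by blast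
  qed
  then obtain G where G: "divisor_basis L G"
    using divisor_basis_exists[of L r] unfolding subtractive_def by blast
  have finG: "finite G" and GL: "G \<subseteq> L" using G by (auto simp: divisor_basis_def)
  have "\<exists>x\<in>carrier V. \<exists>\<omega>\<in>carrier P. \<omega> \<otimes>\<^bsub>P\<^esub> f x = \<one>\<^bsub>P\<^esub> \<and>
      (\<forall>g\<in>G. \<exists>y\<in>carrier V. \<theta> (fst g) \<otimes>\<^bsub>P\<^esub> f x = f y)"
    using finG GL
  proof (induction rule: finite_subset_induct')
    case empty
    show ?case by (rule bexI[of _ "\<one>\<^bsub>V\<^esub>"], rule bexI[of _ "\<one>\<^bsub>P\<^esub>"]) (simp_all add: mhomD(3)[OF f])
  next
    case (insert g G')
    then obtain x \<omega> where x: "x \<in> carrier V" "\<omega> \<in> carrier P" "\<omega> \<otimes>\<^bsub>P\<^esub> f x = \<one>\<^bsub>P\<^esub>"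
      and G': "\<And>g. g \<in> G' \<Longrightarrow> \<exists>y\<in>carrier V. \<theta> (fst g) \<otimes>\<^bsub>P\<^esub> f x = f y" by blast
    have gW: "\<theta> (fst g) \<in> ?W" using insert.hyps(2) by (auto simp: L_def)
    have clG: "\<theta> (fst h) \<in> carrier P" if "h \<in> insert g G'" for h
    proof -
      have "h \<in> L" using that insert.hyps(2,3) by blast
      then have "fst h \<in> ?F" by (auto simp: L_def)
      then show ?thesis by (rule \<theta>cl)
    qed
    obtain x' \<omega>' y' where x': "x' \<in> carrier V" "\<omega>' \<in> carrier P" "\<omega>' \<otimes>\<^bsub>P\<^esub> f x' = \<one>\<^bsub>P\<^esub>"
      and y': "y' \<in> carrier V" "\<theta> (fst g) \<otimes>\<^bsub>P\<^esub> f x' = f y'"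
      using gW
    proof (cases rule: base_part_cases)
      case (1 y)
      then show ?thesis using that[of "\<one>\<^bsub>V\<^esub>" "\<one>\<^bsub>P\<^esub>" y] by (simp add: mhomD(3)[OF f])
    next
      case (2 x)
      then show ?thesis
        using that[of x "\<theta> (fst g)" "\<one>\<^bsub>V\<^esub>"] base_part_closed[OF gW] by (simp add: mhomD(3)[OF f])
    qed
    note [simp] = x(1,2) x'(1,2) y'(1)
    have one: "(\<omega> \<otimes>\<^bsub>P\<^esub> \<omega>') \<otimes>\<^bsub>P\<^esub> f (x \<otimes>\<^bsub>V\<^esub> x') = \<one>\<^bsub>P\<^esub>"
    proof -
      have "(\<omega> \<otimes>\<^bsub>P\<^esub> \<omega>') \<otimes>\<^bsub>P\<^esub> f (x \<otimes>\<^bsub>V\<^esub> x') = (\<omega> \<otimes>\<^bsub>P\<^esub> f x) \<otimes>\<^bsub>P\<^esub> (\<omega>' \<otimes>\<^bsub>P\<^esub> f x')"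
        by (simp add: fmult P.m_ac)
      then show ?thesis using x(3) x'(3) by simp
    qed
    have "\<exists>y\<in>carrier V. \<theta> (fst h) \<otimes>\<^bsub>P\<^esub> f (x \<otimes>\<^bsub>V\<^esub> x') = f y" if h: "h \<in> insert g G'" for h
    proof (cases "h = g")
      case True
      have "\<theta> (fst g) \<otimes>\<^bsub>P\<^esub> f (x \<otimes>\<^bsub>V\<^esub> x') = (\<theta> (fst g) \<otimes>\<^bsub>P\<^esub> f x') \<otimes>\<^bsub>P\<^esub> f x"
        using base_part_closed[OF gW] by (simp add: fmult P.m_ac)
      also have "\<dots> = f (y' \<otimes>\<^bsub>V\<^esub> x)" unfolding y'(2) by (simp add: fmult)
      finally show ?thesis using True by (intro bexI[of _ "y' \<otimes>\<^bsub>V\<^esub> x"]) simp_all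
    next
      case False
      then obtain y where y: "y \<in> carrier V" "\<theta> (fst h) \<otimes>\<^bsub>P\<^esub> f x = f y" using h G' by blast
      have "\<theta> (fst h) \<otimes>\<^bsub>P\<^esub> f (x \<otimes>\<^bsub>V\<^esub> x') = (\<theta> (fst h) \<otimes>\<^bsub>P\<^esub> f x) \<otimes>\<^bsub>P\<^esub> f x'"
        using clG[OF h] by (simp add: fmult P.m_ac)
      also have "\<dots> = f (y \<otimes>\<^bsub>V\<^esub> x')" unfolding y(2) using y(1) by (simp add: fmult)
      finally show ?thesis using y(1) by (intro bexI[of _ "y \<otimes>\<^bsub>V\<^esub> x'"]) simp_all
    qed
    then show ?case using one by (intro bexI[of _ "x \<otimes>\<^bsub>V\<^esub> x'"] bexI[of _ "\<omega> \<otimes>\<^bsub>P\<^esub> \<omega>'"]) simp_all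
  qed
  then obtain x \<omega> where x [simp]: "x \<in> carrier V" "\<omega> \<in> carrier P" and inv: "\<omega> \<otimes>\<^bsub>P\<^esub> f x = \<one>\<^bsub>P\<^esub>"
    and Gx: "\<And>g. g \<in> G \<Longrightarrow> \<exists>y\<in>carrier V. \<theta> (fst g) \<otimes>\<^bsub>P\<^esub> f x = f y" by blast
  have clear: "\<exists>a. \<exists>y\<in>carrier V. \<theta> m \<otimes>\<^bsub>P\<^esub> f x [^]\<^bsub>P\<^esub> (a::nat) = f y" if m: "(m, n) \<in> L" for m n
    using L G m
  proof (induction rule: subtractive_induct)
    case zero
    have "\<theta> 0 = \<one>\<^bsub>P\<^esub>" using mhomD(3)[OF \<theta>] by simp
    then have "\<theta> 0 \<otimes>\<^bsub>P\<^esub> f x [^]\<^bsub>P\<^esub> (0::nat) = f \<one>\<^bsub>V\<^esub>" by (simp add: mhomD(3)[OF f])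
    then show ?case using V.one_closed by blast
  next
    case (add m n c d)
    have F: "m \<in> ?F" "c \<in> ?F" using add.hyps by (auto simp: L_def)
    note [simp] = \<theta>cl[OF F(1)] \<theta>cl[OF F(2)]
    obtain a y where y: "y \<in> carrier V" "\<theta> m \<otimes>\<^bsub>P\<^esub> f x [^]\<^bsub>P\<^esub> (a::nat) = f y" using add.IH by blast
    obtain z where z: "z \<in> carrier V" "\<theta> c \<otimes>\<^bsub>P\<^esub> f x = f z" using Gx[OF add.hyps(2)] by auto
    have "\<theta> (m + c) \<otimes>\<^bsub>P\<^esub> f x [^]\<^bsub>P\<^esub> Suc a = (\<theta> m \<otimes>\<^bsub>P\<^esub> f x [^]\<^bsub>P\<^esub> a) \<otimes>\<^bsub>P\<^esub> (\<theta> c \<otimes>\<^bsub>P\<^esub> f x)"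
      using mhomD(2)[OF \<theta> F] by (simp add: P.m_ac)
    also have "\<dots> = f (y \<otimes>\<^bsub>V\<^esub> z)" unfolding y(2) z(2) using y(1) z(1) by (simp add: fmult)
    finally have "\<theta> (m + c) \<otimes>\<^bsub>P\<^esub> f x [^]\<^bsub>P\<^esub> Suc a = f (y \<otimes>\<^bsub>V\<^esub> z)" .
    moreover have "y \<otimes>\<^bsub>V\<^esub> z \<in> carrier V" using y z by simp
    ultimately show ?case by blast
  qed
  have "p \<in> mspan P (f ` carrier V \<union> {\<omega>})" if p: "p \<in> ?W" for p
    using p
  proof (cases rule: base_part_cases)
    case (1 y)
    then show ?thesis by (intro mspan.gen) blast
  next
    case (2 s)
    note [simp] = base_part_closed[OF p] 2(1)
    obtain n v m where n: "n \<ge> 1" and v: "v \<in> carrier V" and m: "m \<in> ?F" and e: "p [^]\<^bsub>P\<^esub> (n::nat) = f v \<otimes>\<^bsub>P\<^esub> \<theta> m"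
      using reach[OF base_part_closed[OF p]] by blast
    note [simp] = v \<theta>cl[OF m]
    have "\<theta> m \<otimes>\<^bsub>P\<^esub> f v \<in> ?W" using base_part_pow[OF p, of n] e by (simp add: P.m_comm)
    then have "\<theta> m \<in> ?W" by (rule base_part_exact[OF \<theta>cl[OF m] base_part_source[OF v]])
    then have "(m, 0) \<in> L" using m by (simp add: L_def)
    from clear[OF this] obtain a y where y: "y \<in> carrier V" "\<theta> m \<otimes>\<^bsub>P\<^esub> f x [^]\<^bsub>P\<^esub> (a::nat) = f y" by blast
    obtain k where k: "n = Suc k" using n by (cases n) auto
    (* The exponent a clears the denominator of the n-th power of p, so it is more than enough for
       p itself; the surplus factor, the power of f x with exponent a k, lies in f(V). *)
    define q where "q = p \<otimes>\<^bsub>P\<^esub> f x [^]\<^bsub>P\<^esub> a"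
    have qW: "q \<in> ?W" unfolding q_def using p by (intro base_part_mult base_part_pow base_part_source) simp_all
    note [simp] = base_part_closed[OF qW] y(1)
    have "q [^]\<^bsub>P\<^esub> n = p [^]\<^bsub>P\<^esub> n \<otimes>\<^bsub>P\<^esub> f x [^]\<^bsub>P\<^esub> (a * n)"
      unfolding q_def by (simp add: P.nat_pow_distrib P.nat_pow_pow)
    also have "a * n = a + a * k" using k by simp
    also have "f x [^]\<^bsub>P\<^esub> (a + a * k) = f x [^]\<^bsub>P\<^esub> a \<otimes>\<^bsub>P\<^esub> f x [^]\<^bsub>P\<^esub> (a * k)"
      by (rule P.nat_pow_mult[symmetric]) simp
    also have "p [^]\<^bsub>P\<^esub> n \<otimes>\<^bsub>P\<^esub> (f x [^]\<^bsub>P\<^esub> a \<otimes>\<^bsub>P\<^esub> f x [^]\<^bsub>P\<^esub> (a * k))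
        = f v \<otimes>\<^bsub>P\<^esub> (\<theta> m \<otimes>\<^bsub>P\<^esub> f x [^]\<^bsub>P\<^esub> a) \<otimes>\<^bsub>P\<^esub> f x [^]\<^bsub>P\<^esub> (a * k)"
      unfolding e by (simp add: P.m_assoc)
    also have "\<dots> = f (v \<otimes>\<^bsub>V\<^esub> y \<otimes>\<^bsub>V\<^esub> x [^]\<^bsub>V\<^esub> (a * k))"
      unfolding y(2) by (simp add: fmult mhom_pow[OF V.monoid_axioms f])
    finally have "q [^]\<^bsub>P\<^esub> n = f (v \<otimes>\<^bsub>V\<^esub> y \<otimes>\<^bsub>V\<^esub> x [^]\<^bsub>V\<^esub> (a * k))" .
    moreover have "v \<otimes>\<^bsub>V\<^esub> y \<otimes>\<^bsub>V\<^esub> x [^]\<^bsub>V\<^esub> (a * k) \<in> carrier V" by simp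
    ultimately obtain z where z: "z \<in> carrier V" "q [^]\<^bsub>P\<^esub> n = f z" by blast
    (* If q were only the inverse of some f t, then q = q^n (f t)^k would still lie in f(V). *)
    have "\<exists>t\<in>carrier V. q = f t"
      using qW
    proof (cases rule: base_part_cases)
      case (2 t)
      have ft: "f t [^]\<^bsub>P\<^esub> k = f (t [^]\<^bsub>V\<^esub> k)" using mhom_pow[OF V.monoid_axioms f 2(1)] by simp
      have "q = q \<otimes>\<^bsub>P\<^esub> (q \<otimes>\<^bsub>P\<^esub> f t) [^]\<^bsub>P\<^esub> k" using 2(2) by simp
      also have "\<dots> = q [^]\<^bsub>P\<^esub> n \<otimes>\<^bsub>P\<^esub> f t [^]\<^bsub>P\<^esub> k"
        using 2(1) k by (simp add: P.nat_pow_distrib P.m_ac)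
      also have "\<dots> = f (z \<otimes>\<^bsub>V\<^esub> t [^]\<^bsub>V\<^esub> k)" unfolding z(2) ft using 2(1) z(1) by (simp add: fmult)
      finally show ?thesis using 2(1) z(1) by (intro bexI[of _ "z \<otimes>\<^bsub>V\<^esub> t [^]\<^bsub>V\<^esub> k"]) simp_all
    qed blast
    then obtain t where t: "t \<in> carrier V" "q = f t" by blast
    have "p = p \<otimes>\<^bsub>P\<^esub> (\<omega> \<otimes>\<^bsub>P\<^esub> f x) [^]\<^bsub>P\<^esub> a" using inv by simp
    also have "\<dots> = q \<otimes>\<^bsub>P\<^esub> \<omega> [^]\<^bsub>P\<^esub> a" unfolding q_def by (simp add: P.nat_pow_distrib P.m_ac)
    finally have "p = f t \<otimes>\<^bsub>P\<^esub> \<omega> [^]\<^bsub>P\<^esub> a" unfolding t(2) .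
    moreover have "f t \<otimes>\<^bsub>P\<^esub> \<omega> [^]\<^bsub>P\<^esub> a \<in> mspan P (f ` carrier V \<union> {\<omega>})"
      using t(1) by (intro mspan.mult mspan_pow mspan.gen) simp_all
    ultimately show ?thesis by simp
  qed
  then show ?thesis using that[of \<omega>] by auto
qed

end

section \<open>Finite generation over the valuative monoid\<close>

lemma mspan_source_union:
  assumes V: "monoid V" and P: "comm_monoid P" and f: "f \<in> mhom V P" and T: "finite T" "T \<subseteq> carrier P"
  obtains r \<theta> where "\<theta> \<in> mhom (free_cmonoid r) P"
    "\<And>p. p \<in> mspan P (f ` carrier V \<union> T) \<Longrightarrow> \<exists>v\<in>carrier V. \<exists>m\<in>carrier (free_cmonoid r). p = f v \<otimes>\<^bsub>P\<^esub> \<theta> m"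
proof -
  interpret V: monoid V by fact
  interpret P: comm_monoid P by fact
  obtain t :: "nat \<Rightarrow> _" and r where t: "T = t ` {i. i < r}"
    using T(1) finite_imp_nat_seg_image_inj_on by metis
  have tP: "t i \<in> carrier P" if "i < r" for i using that t T(2) by blast
  obtain \<theta> where \<theta>: "\<theta> \<in> mhom (free_cmonoid r) P"
    and \<theta>t: "\<And>i. i < r \<Longrightarrow> \<theta> (\<lambda>j. if j = i then 1 else 0) = t i"
    using free_lift[OF P, of r t] tP by metis
  have "\<exists>v\<in>carrier V. \<exists>m\<in>carrier (free_cmonoid r). p = f v \<otimes>\<^bsub>P\<^esub> \<theta> m"
    if "p \<in> mspan P (f ` carrier V \<union> T)" for p
    using that
  proof induction
    case one
    have "\<one>\<^bsub>P\<^esub> = f \<one>\<^bsub>V\<^esub> \<otimes>\<^bsub>P\<^esub> \<theta> 0" using mhomD(3)[OF f] mhomD(3)[OF \<theta>] by simp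
    moreover have "(0 :: nat \<Rightarrow> nat) \<in> carrier (free_cmonoid r)" by simp
    ultimately show ?case using V.one_closed by blast
  next
    case (gen p)
    then show ?case
    proof
      assume "p \<in> f ` carrier V"
      then obtain v where v: "v \<in> carrier V" "p = f v" by blast
      then have "p = f v \<otimes>\<^bsub>P\<^esub> \<theta> 0" using mhomD(3)[OF \<theta>] mhomD(1)[OF f] by simp
      moreover have "(0 :: nat \<Rightarrow> nat) \<in> carrier (free_cmonoid r)" by simp
      ultimately show ?case using v(1) by blast
    next
      assume "p \<in> T"
      then obtain i where i: "i < r" "p = t i" using t by blast
      then have "p = f \<one>\<^bsub>V\<^esub> \<otimes>\<^bsub>P\<^esub> \<theta> (\<lambda>j. if j = i then 1 else 0)" using mhomD(3)[OF f] \<theta>t tP by simp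
      moreover have "(\<lambda>j. if j = i then 1 else 0 :: nat) \<in> carrier (free_cmonoid r)" using i by simp
      ultimately show ?case using V.one_closed by blast
    qed
  next
    case (mult p q)
    then obtain v m w n where v: "v \<in> carrier V" "m \<in> carrier (free_cmonoid r)" "p = f v \<otimes>\<^bsub>P\<^esub> \<theta> m"
      and w: "w \<in> carrier V" "n \<in> carrier (free_cmonoid r)" "q = f w \<otimes>\<^bsub>P\<^esub> \<theta> n" by blast
    have "p \<otimes>\<^bsub>P\<^esub> q = f (v \<otimes>\<^bsub>V\<^esub> w) \<otimes>\<^bsub>P\<^esub> \<theta> (m + n)"
      using swap_middle[OF P mhomD(1)[OF f v(1)] mhomD(1)[OF \<theta> v(2)] mhomD(1)[OF f w(1)] mhomD(1)[OF \<theta> w(2)]]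
        mhomD(2)[OF f v(1) w(1)] mhomD(2)[OF \<theta> v(2) w(2)] v(3) w(3) by simp
    moreover have "m + n \<in> carrier (free_cmonoid r)" using v(2) w(2) by simp
    moreover have "v \<otimes>\<^bsub>V\<^esub> w \<in> carrier V" using v(1) w(1) by simp
    ultimately show ?case by blast
  qed
  with \<theta> that show ?thesis by blast
qed

lemma sfp_over_valuative_fin_pres:
  fixes V :: "'v monoid" and P :: "'p monoid"
  assumes V: "valuative V" and div: "divisible_monoid V" and sfp: "sfp TYPE('d) V P f"
  shows "fin_pres V P f"
proof -
  have satP: "saturated_monoid P" and f: "f \<in> mhom V P" using sfp by (auto simp: sfp_def)
  have P: "integral_monoid P" using satP by (simp add: saturated_monoid_def)
  have cV: "comm_monoid V" using V by (simp add: valuative_def integral_monoid_def)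
  interpret V: comm_monoid V by fact
  interpret P: comm_monoid P using P by (rule integral_monoid_comm)
  show ?thesis
    using sfp
  proof (rule sfp_presentation)
    fix r S and H :: "'v \<times> (nat \<Rightarrow> nat) \<Rightarrow> 'p"
    let ?M = "V \<times>\<times> free_cmonoid r"
    let ?F = "carrier (free_cmonoid r)"
    assume S: "finite S" "S \<subseteq> carrier ?M \<times> carrier ?M"
      and H: "H \<in> mhom ?M P" and Hf: "\<And>v. v \<in> carrier V \<Longrightarrow> H (v, 0) = f v"
      and HS: "\<And>x y. (x, y) \<in> S \<Longrightarrow> H x = H y"
      and power: "\<And>p. p \<in> carrier P \<Longrightarrow> \<exists>n\<ge>1. \<exists>x\<in>carrier ?M. p [^]\<^bsub>P\<^esub> (n::nat) = H x"
      and group: "\<And>p. p \<in> carrier P \<Longrightarrow> \<exists>x\<in>carrier ?M. \<exists>y\<in>carrier ?M. p \<otimes>\<^bsub>P\<^esub> H x = H y"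
      and gp_eq: "\<And>x y. \<lbrakk>x \<in> carrier ?M; y \<in> carrier ?M; H x = H y\<rbrakk> \<Longrightarrow>
         \<exists>z\<in>carrier ?M. (x \<otimes>\<^bsub>?M\<^esub> z, y \<otimes>\<^bsub>?M\<^esub> z) \<in> mcong_gen ?M S"
    define \<theta> where "\<theta> = (\<lambda>m. H (\<one>\<^bsub>V\<^esub>, m))"
    have \<theta>: "\<theta> \<in> mhom (free_cmonoid r) P"
    proof (rule mhomI)
      show "\<theta> m \<in> carrier P" if "m \<in> ?F" for m
        unfolding \<theta>_def by (rule mhomD(1)[OF H]) (use that in simp)
      show "\<theta> (m \<otimes>\<^bsub>free_cmonoid r\<^esub> n) = \<theta> m \<otimes>\<^bsub>P\<^esub> \<theta> n" if "m \<in> ?F" "n \<in> ?F" for m n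
        using mhomD(2)[OF H, of "(\<one>\<^bsub>V\<^esub>, m)" "(\<one>\<^bsub>V\<^esub>, n)"] that by (simp add: \<theta>_def)
      show "\<theta> \<one>\<^bsub>free_cmonoid r\<^esub> = \<one>\<^bsub>P\<^esub>" using mhomD(3)[OF H] by (simp add: \<theta>_def)
    qed
    have split: "H (v, m) = f v \<otimes>\<^bsub>P\<^esub> \<theta> m" if "v \<in> carrier V" "m \<in> ?F" for v m
      using mhomD(2)[OF H, of "(v, 0)" "(\<one>\<^bsub>V\<^esub>, m)"] Hf that by (simp add: \<theta>_def)
    have reach: "\<exists>n\<ge>1. \<exists>v\<in>carrier V. \<exists>m\<in>?F. p [^]\<^bsub>P\<^esub> (n::nat) = f v \<otimes>\<^bsub>P\<^esub> \<theta> m"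
      if p: "p \<in> carrier P" for p
    proof -
      obtain n x where n: "n \<ge> 1" "x \<in> carrier ?M" "p [^]\<^bsub>P\<^esub> (n::nat) = H x" using power[OF p] by blast
      obtain v m where x: "x = (v, m)" by fastforce
      have vm: "v \<in> carrier V" "m \<in> ?F" using n(2) x by auto
      have "p [^]\<^bsub>P\<^esub> n = f v \<otimes>\<^bsub>P\<^esub> \<theta> m" using n(3) split[OF vm] x by simp
      with n(1) vm show ?thesis by blast
    qed
    let ?W = "base_part V P f"
    have over: "saturated_over_total P ?W r \<theta>"
    proof (unfold_locales)
      show "a = b" if "a \<in> carrier P" "b \<in> carrier P" "k \<in> carrier P" "a \<otimes>\<^bsub>P\<^esub> k = b \<otimes>\<^bsub>P\<^esub> k" for a b k
        using integral_monoid_cancel[OF P that] .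
      show "\<exists>d\<in>carrier P. a = d \<otimes>\<^bsub>P\<^esub> b" if "a \<in> carrier P" "b \<in> carrier P" "c \<in> carrier P" "n \<ge> 1"
        "a [^]\<^bsub>P\<^esub> n = c \<otimes>\<^bsub>P\<^esub> b [^]\<^bsub>P\<^esub> n" for a b c and n :: nat
        using saturated_monoid_root[OF satP that] .
      show "\<one>\<^bsub>P\<^esub> \<in> ?W"
        using base_part_source[OF V P f, of "\<one>\<^bsub>V\<^esub>"] mhomD(3)[OF f] by simp
      show "\<exists>n\<ge>1. \<exists>w\<in>?W. \<exists>m\<in>?F. p [^]\<^bsub>P\<^esub> (n::nat) = w \<otimes>\<^bsub>P\<^esub> \<theta> m" if "p \<in> carrier P" for p
        using reach[OF that] base_part_source[OF V P f] by blast
      show "\<exists>v\<in>?W. \<exists>w\<in>?W. \<exists>a\<in>?F. \<exists>b\<in>?F. p \<otimes>\<^bsub>P\<^esub> v \<otimes>\<^bsub>P\<^esub> \<theta> a = w \<otimes>\<^bsub>P\<^esub> \<theta> b" if p: "p \<in> carrier P" for p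
      proof -
        obtain x y where xy: "x \<in> carrier ?M" "y \<in> carrier ?M" "p \<otimes>\<^bsub>P\<^esub> H x = H y" using group[OF p] by blast
        obtain v m w n where e: "x = (v, m)" "y = (w, n)" by fastforce
        have cl: "v \<in> carrier V" "m \<in> ?F" "w \<in> carrier V" "n \<in> ?F" using xy e by auto
        have "p \<otimes>\<^bsub>P\<^esub> f v \<otimes>\<^bsub>P\<^esub> \<theta> m = f w \<otimes>\<^bsub>P\<^esub> \<theta> n"
          using xy(3) split[OF cl(1,2)] split[OF cl(3,4)] e p mhomD(1)[OF f cl(1)] mhomD(1)[OF \<theta> cl(2)]
          by (simp add: P.m_assoc)
        then show ?thesis using cl base_part_source[OF V P f] by blast
      qed
    qed (use base_part_closed[OF V P f] base_part_mult[OF V P f] base_part_exact[OF V P f]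
        base_part_total[OF V P f] base_part_divisible[OF V P f div] \<theta> in blast)+
    interpret O: saturated_over_total P ?W r \<theta> by (rule over)
    obtain T where T: "finite T" "T \<subseteq> carrier P" "\<And>p. p \<in> carrier P \<Longrightarrow> p \<in> mspan P (?W \<union> T)"
      using O.finitely_generated by blast
    obtain \<omega> where \<omega>: "\<omega> \<in> carrier P" "?W \<subseteq> mspan P (f ` carrier V \<union> {\<omega>})"
      using base_part_generated[OF V P f \<theta> reach] by blast
    let ?T = "insert \<omega> T"
    have T': "finite ?T" "?T \<subseteq> carrier P" using T \<omega> by auto
    have all: "p \<in> mspan P (f ` carrier V \<union> ?T)" if "p \<in> carrier P" for p
    proof (rule mspan_mono[OF _ T(3)[OF that]])
      have "?W \<subseteq> mspan P (f ` carrier V \<union> ?T)"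
      proof
        fix w assume "w \<in> ?W"
        then have "w \<in> mspan P (f ` carrier V \<union> {\<omega>})" using \<omega>(2) by blast
        then show "w \<in> mspan P (f ` carrier V \<union> ?T)"
          by (rule mspan_mono[rotated]) (auto intro: mspan.gen)
      qed
      then show "?W \<union> T \<subseteq> mspan P (f ` carrier V \<union> ?T)" by (auto intro: mspan.gen)
    qed
    obtain r' \<theta>' where \<theta>': "\<theta>' \<in> mhom (free_cmonoid r') P"
      "\<And>p. p \<in> mspan P (f ` carrier V \<union> ?T) \<Longrightarrow>
        \<exists>v\<in>carrier V. \<exists>m\<in>carrier (free_cmonoid r'). p = f v \<otimes>\<^bsub>P\<^esub> \<theta>' m"
      using mspan_source_union[OF V.monoid_axioms P.comm_monoid_axioms f T'] by blast
    show "fin_pres V P f"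
    proof (rule kernel_finitely_generated[OF V P H Hf f S HS gp_eq])
      fix K assume K: "finite K" "K \<subseteq> carrier V" "\<And>u. u \<in> K \<Longrightarrow> f u = \<one>\<^bsub>P\<^esub>"
        "\<And>R v w. \<lbrakk>mcong V R; \<And>u. u \<in> K \<Longrightarrow> (u, \<one>\<^bsub>V\<^esub>) \<in> R; v \<in> carrier V; w \<in> carrier V; f v = f w\<rbrakk> \<Longrightarrow> (v, w) \<in> R"
      show "fin_pres V P f"
        by (rule fin_pres_of_generators[OF V P f \<theta>'(1) \<theta>'(2)[OF all] K])
    qed
  qed
qed

theorem corollary2p5p18:
  fixes V :: "'v monoid" and P :: "'p monoid" and f :: "'v \<Rightarrow> 'p"
  assumes "divisible_monoid V"
    and "valuative V"
    and "sfp TYPE('d) V P f"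
  shows "saturated_hom TYPE('c) V P f \<and> fin_pres V P f"
proof
  have P: "saturated_monoid P" and f: "f \<in> mhom V P" using assms(3) by (auto simp: sfp_def)
  show "saturated_hom TYPE('c) V P f"
    by (rule valuative_source_saturated_hom[OF assms(2,1) P f])
  show "fin_pres V P f"
    by (rule sfp_over_valuative_fin_pres[OF assms(2,1,3)])
qed

end
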